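(* Let $P$ be a probability measure on the space $\Omega$ of cookie environments satisfying (SE). Then there are constants $v_k$, $k\ge1$, such that for every $k\ge1$, $\frac{X^{(k)}_n}{n}\to v_k$ a.s. as $n\to\infty$.
   Context: $\mathbb{N}=\{1,2,\dots\}$. The space of cookie environments is $\Omega=[0,1]^{\mathbb{Z}\times\mathbb{N}}$ with the Borel $\sigma$-algebra of the product topology. Given $\omega\in\Omega$ and $x\in\mathbb{Z}$, the excited random walk driven by $\omega$ started at $x$ is the nearest-neighbour process $X$ on $\mathbb{Z}$ with $X_0=x$ which, on the $i$-th visit to a site $y$, jumps (conditionally on its past) to $y+1$ with probability $\omega(y,i)$ and to $y-1$ with probability $1-\omega(y,i)$. Condition on $P$: (SE): the family of stacks $(\omega(x,\cdot))_{x\in\mathbb{Z}}$ is stationary and ergodic under $P$ with respect to the shift on $\mathbb{Z}$. Leftover environments: sample $\omega_0=\omega$ from $P$. For $j\ge1$, conditionally on everything before, let $X^{(j)}$ be an excited random walk driven by $\omega_{j-1}$ started at $0$, and let $L^{(j)}(x)\in\{0,1,\dots\}\cup\{\infty\}$ be its total number of visits to $x$. If $X^{(j)}$ is transient ($L^{(j)}$ finite everywhere), the $j$-leftover environment is $\omega_j(x,n)=\omega_{j-1}(x,n+L^{(j)}(x))$ (the cookies not eaten by the walker); if $X^{(j)}$ is recurrent, all cookies are considered eaten, that is, $\omega_j(x,n)=\frac12$ for all $x\in\mathbb{Z}$, $n\in\mathbb{N}$. Thus $X^{(1)}$ is the standard excited random walk and, for $k>1$, $X^{(k)}$ is the excited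 random walk on the $(k-1)$-leftover environment. "A.s." refers to the annealed measure, i.e. averaging also over $\omega\sim P$. *)

theory Defs
  imports "HOL-Probability.Probability"
begin

type_synonym cookie_env = "int \<times> nat \<Rightarrow> real"

text \<open>
  Cookies are numbered from 1, so the index set is \<open>UNIV \<times> {1..}\<close>. As the index set is countable and
  the unit interval is second countable, the product \<open>\<sigma>\<close>-algebra below is the Borel
  \<open>\<sigma>\<close>-algebra of the product topology.
\<close>

definition cookie_space :: "cookie_env measure" where
  "cookie_space = Pi\<^sub>M (UNIV \<times> {1..}) (\<lambda>_. restrict_space borel {0..1})"

definition site_shift :: "cookie_env \<Rightarrow> cookie_env" where
  "site_shift \<omega> = (\<lambda>(x, n). \<omega> (x + 1, n))"

lemma measurable_site_shift: "site_shift \<in> cookie_space \<rightarrow>\<^sub>M cookie_space"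
  unfolding cookie_space_def
proof (rule measurable_PiM_single')
  fix i :: "int \<times> nat" assume "i \<in> UNIV \<times> {1..}"
  then have "(fst i + 1, snd i) \<in> (UNIV :: int set) \<times> {1::nat..}" by auto
  then have "(\<lambda>\<omega>. \<omega> (fst i + 1, snd i)) \<in>
      Pi\<^sub>M (UNIV \<times> {1..}) (\<lambda>_. restrict_space borel {0..1::real}) \<rightarrow>\<^sub>M restrict_space borel {0..1}"
    by (rule measurable_component_singleton)
  then show "(\<lambda>\<omega>. site_shift \<omega> i) \<in>
      Pi\<^sub>M (UNIV \<times> {1..}) (\<lambda>_. restrict_space borel {0..1::real}) \<rightarrow>\<^sub>M restrict_space borel {0..1}"
    by (simp add: site_shift_def split_def)
next
  show "site_shift \<in> space (Pi\<^sub>M (UNIV \<times> {1..}) (\<lambda>_. restrict_space borel {0..1::real}))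
      \<rightarrow> UNIV \<times> {1..} \<rightarrow>\<^sub>E space (restrict_space borel {0..1})"
    by (auto simp: space_PiM PiE_def Pi_def extensional_def site_shift_def)
qed

text \<open>
  Since the shift is invertible, stationarity and ergodicity under it are the same as under the
  whole action of the integers.
\<close>

definition stationary_ergodic :: "cookie_env measure \<Rightarrow> bool" where
  "stationary_ergodic P \<longleftrightarrow>
     distr P cookie_space site_shift = P \<and>
     (\<forall>A\<in>sets P. site_shift -` A \<inter> space P = A \<longrightarrow> measure P A = 0 \<or> measure P A = 1)"

text \<open>Visits up to and including time \<open>n\<close>: at time \<open>n\<close> the path \<open>s\<close> makes its
  \<open>visits s n (s n)\<close>-th visit to its current site.\<close>

definition visits :: "(nat \<Rightarrow> int) \<Rightarrow> nat \<Rightarrow> int \<Rightarrow> nat" where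
  "visits s n y = card {m. m \<le> n \<and> s m = y}"

definition transient_path :: "(nat \<Rightarrow> int) \<Rightarrow> bool" where
  "transient_path s \<longleftrightarrow> (\<forall>y. finite {m. s m = y})"

definition leftover :: "(nat \<Rightarrow> int) \<Rightarrow> cookie_env \<Rightarrow> cookie_env" where
  "leftover s \<omega> =
     (if transient_path s then (\<lambda>(x, n). \<omega> (x, n + card {m. s m = x})) else (\<lambda>_. 1 / 2))"

text \<open>The walkers are numbered from 1; \<open>X j\<close> is the path of the \<open>j\<close>-th walker, and \<open>X 0\<close> is
  not used anywhere.\<close>

primrec leftover_env :: "cookie_env \<Rightarrow> (nat \<Rightarrow> nat \<Rightarrow> int) \<Rightarrow> nat \<Rightarrow> cookie_env" where
  "leftover_env \<omega> X 0 = \<omega>"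
| "leftover_env \<omega> X (Suc j) = leftover (X (Suc j)) (leftover_env \<omega> X j)"

text \<open>The \<open>\<sigma>\<close>-algebra generated by the initial environment \<open>\<eta>\<close>, the entire paths of the walkers
  before the \<open>j\<close>-th, and the \<open>j\<close>-th path up to time \<open>n\<close>.\<close>

definition history ::
  "'a measure \<Rightarrow> ('a \<Rightarrow> cookie_env) \<Rightarrow> (nat \<Rightarrow> nat \<Rightarrow> 'a \<Rightarrow> int) \<Rightarrow> nat \<Rightarrow> nat \<Rightarrow> 'a measure" where
  "history M \<eta> X j n = sigma (space M)
     ({\<eta> -` A \<inter> space M | A. A \<in> sets cookie_space} \<union>
      {X i m -` B \<inter> space M | i m B. 1 \<le> i \<and> (i < j \<or> i = j \<and> m \<le> n)})"

text \<open>
  \<open>M\<close> carries an environment \<open>\<eta>\<close> of law \<open>P\<close> and walks \<open>X 1, X 2, \<dots>\<close> such that, conditionally on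
  everything before, \<open>X j\<close> is an excited random walk started at 0 in the \<open>(j-1)\<close>-leftover
  environment. These conditions determine the joint law, and \<open>M\<close> is the annealed measure.
\<close>

definition leftover_erw ::
  "cookie_env measure \<Rightarrow> 'a measure \<Rightarrow> ('a \<Rightarrow> cookie_env) \<Rightarrow> (nat \<Rightarrow> nat \<Rightarrow> 'a \<Rightarrow> int) \<Rightarrow> bool" where
  "leftover_erw P M \<eta> X \<longleftrightarrow>
     prob_space M \<and>
     \<eta> \<in> M \<rightarrow>\<^sub>M cookie_space \<and>
     distr M cookie_space \<eta> = P \<and>
     (\<forall>j\<ge>1. \<forall>n. X j n \<in> M \<rightarrow>\<^sub>M count_space UNIV) \<and>
     (\<forall>j\<ge>1. AE w in M. X j 0 w = 0) \<and>
     (\<forall>j\<ge>1. \<forall>n. AE w in M. X j (Suc n) w = X j n w + 1 \<or> X j (Suc n) w = X j n w - 1) \<and>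
     (\<forall>j\<ge>1. \<forall>n. AE w in M.
        real_cond_exp M (history M \<eta> X j n)
          (indicator {u \<in> space M. X j (Suc n) u = X j n u + 1}) w
        = leftover_env (\<eta> w) (\<lambda>i m. X i m w) (j - 1)
            (X j n w, visits (\<lambda>m. X j m w) n (X j n w)))"

end

theory Submission
  imports Defs
begin

text \<open>
  The idea is to toss all coins in advance. Given \<open>\<omega>\<close>, each site carries an infinite stack of
  independent arrows, the \<open>i\<close>-th one at \<open>x\<close> pointing right with probability \<open>\<omega> (x, i)\<close>; a walker takes
  the top arrow of the stack at its site and follows it, and its successor finds the arrows that
  are left. The conditional probabilities that define \<open>leftover_erw\<close> determine the joint law of
  environment and walks (\<open>erw_law_unique\<close>), and the arrows realize it (\<open>model_erw\<close>): the arrow that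
  is about to be taken has never been looked at. Under the shift of sites the arrows form an
  ergodic system (\<open>ergodic_skew\<close>), so it suffices to study walkers that move deterministically in an
  ergodic field of arrows.

  Suppose that \<open>k\<close> walkers have disappeared, \<open>r\<close> of them to the right. Far to the right, the number
  of arrows they have taken at a site does not remember the starting point, nor the walkers lost
  on the left: it is the least number \<open>need r\<close> of arrows that lets a net flux of \<open>r\<close> walkers pass
  (\<open>directed_odo_eq_need\<close>), and \<open>need r\<close> at \<open>x\<close> is a function of the arrows seen from \<open>x\<close>. Therefore the
  next walker, if it goes off to the right, needs time about
  \<open>\<Sum>x<N. need (r + 1) x - need r x\<close> to hit \<open>N\<close>; by the ergodic theorem this is \<open>V * N\<close> up to an
  error \<open>o(N)\<close>, where \<open>V\<close> is a constant, possibly infinite, and the walker has speed \<open>1 / V\<close>. If it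
  does not go off to the right, then either it stays bounded on that side or it crosses every
  far site ever more often, which forces \<open>V = \<infinity>\<close>; in both cases the upper speed is at most \<open>0\<close>
  (\<open>right_speed\<close>). The mirror image of this statement treats the left.

  It remains to see that the direction of each walker is not random. If the common starting
  point of the walkers is moved one step to the right, then a walker that used to go to the right
  still does (\<open>right_walker_shift\<close>, a comparison of fluxes). An event that is preserved by an
  ergodic shift has probability 0 or 1, so as long as its predecessors are transient, each walker
  almost surely goes to the right, or almost surely to the left, or almost surely does neither, and
  in the last case its speed is 0. After a walker
  of the last kind all walks are simple symmetric random walks, which have speed 0.
\<close>

section \<open>The pointwise ergodic theorem\<close>

locale ergodic_system = prob_space M for M :: "'a measure" +
  fixes T :: "'a \<Rightarrow> 'a"
  assumes T_measurable [measurable]: "T \<in> M \<rightarrow>\<^sub>M M"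
    and distr_T: "distr M M T = M"
    and ergodic: "\<And>A. A \<in> sets M \<Longrightarrow> T -` A \<inter> space M = A \<Longrightarrow> measure M A = 0 \<or> measure M A = 1"
begin

lemma T_space: "x \<in> space M \<Longrightarrow> T x \<in> space M"
  using measurable_space[OF T_measurable] .

lemma T_iter_measurable [measurable]: "(T ^^ n) \<in> M \<rightarrow>\<^sub>M M"
  by (induction n) (auto intro: measurable_comp)

lemma distr_T_iter: "distr M M (T ^^ n) = M"
proof (induction n)
  case 0
  show ?case by (simp add: distr_id2 eq_id_iff)
next
  case (Suc n)
  have "distr M M (T ^^ Suc n) = distr (distr M M (T ^^ n)) M T"
    by (subst distr_distr) auto
  then show ?case by (simp only: Suc distr_T)
qed

lemma AE_T_iter: "AE x in M. Q x \<Longrightarrow> AE x in M. Q ((T ^^ n) x)"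
  by (rule AE_distrD[of _ _ M]) (auto simp only: distr_T_iter T_iter_measurable)

lemma AE_T_iter_all: "AE x in M. Q x \<Longrightarrow> AE x in M. \<forall>n. Q ((T ^^ n) x)"
  using AE_T_iter by (simp add: AE_all_countable)

lemma integrable_T:
  fixes f :: "'a \<Rightarrow> real"
  shows "integrable M f \<Longrightarrow> integrable M (\<lambda>x. f (T x))"
  using integrable_distr[of T M M f] distr_T by simp

lemma integral_T:
  fixes f :: "'a \<Rightarrow> real"
  shows "f \<in> borel_measurable M \<Longrightarrow> (\<integral>x. f (T x) \<partial>M) = (\<integral>x. f x \<partial>M)"
  using integral_distr[of T M M f] distr_T by simp

text \<open>Writing \<open>m n\<close> for the maximum of \<open>0\<close> and the first \<open>n\<close> ergodic sums, the identity
  \<open>m (n + 1) = max 0 (f + m n \<circ> T)\<close> shows that the set \<open>A\<close> on which the sums are unbounded above is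
  invariant, and that on \<open>A\<close> the difference \<open>m (n + 1) - m n \<circ> T\<close> is eventually \<open>f\<close>. The integral of
  this difference over \<open>A\<close> is nonnegative because \<open>m\<close> increases with \<open>n\<close> and \<open>T\<close> preserves the measure;
  so \<open>f\<close> has nonnegative integral over \<open>A\<close>, which excludes \<open>measure M A = 1\<close>.\<close>

lemma ergodic_sums_bounded_above:
  fixes f :: "'a \<Rightarrow> real"
  assumes f [measurable]: "integrable M f" and neg: "(\<integral>x. f x \<partial>M) < 0"
  shows "AE x in M. \<exists>B. \<forall>n. (\<Sum>i<n. f ((T ^^ i) x)) \<le> B"
proof -
  define m :: "nat \<Rightarrow> 'a \<Rightarrow> real"
    where "m = rec_nat (\<lambda>x. 0) (\<lambda>n g x. max 0 (f x + g (T x)))"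
  have m0: "m 0 = (\<lambda>x. 0)" and mS: "m (Suc n) = (\<lambda>x. max 0 (f x + m n (T x)))" for n
    by (simp_all add: m_def)
  have m_int [measurable]: "integrable M (m n)" for n
  proof (induction n)
    case (Suc n)
    then show ?case unfolding mS by (intro integrable_max) (auto intro: f integrable_T)
  qed (simp add: m0)
  have m_nonneg: "0 \<le> m n x" for n x by (cases n) (auto simp: m0 mS)
  have m_step: "m n x \<le> m (Suc n) x" for n x
  proof (induction n arbitrary: x)
    case (Suc n) then show ?case by (simp add: mS max.coboundedI2) 
  qed (simp add: m0 mS)
  have m_mono: "n \<le> k \<Longrightarrow> m n x \<le> m k x" for n k x
    by (rule lift_Suc_mono_le[of "\<lambda>n. m n x"]) (auto intro: m_step)
  have sum_le: "(\<Sum>i<n. f ((T ^^ i) x)) \<le> m n x" for n x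
  proof (induction n arbitrary: x)
    case (Suc n)
    have "(\<Sum>i<Suc n. f ((T ^^ i) x)) = f x + (\<Sum>i<n. f ((T ^^ i) (T x)))"
      by (subst sum.lessThan_Suc_shift) (simp add: funpow_swap1)
    then show ?case using Suc[of "T x"] by (simp add: mS)
  qed (simp add: m0)
  define A where "A = {x \<in> space M. \<forall>B::nat. \<exists>n. m n x > real B}"
  have A [measurable]: "A \<in> sets M" unfolding A_def by measurable
  have unb: "(\<forall>B::nat. \<exists>n. m n (T x) > real B) \<longleftrightarrow> (\<forall>B::nat. \<exists>n. m n x > real B)" for x
  proof safe
    fix B :: nat assume "\<forall>B::nat. \<exists>n. m n (T x) > real B"
    then obtain n where "m n (T x) > real (nat \<lceil>B + \<bar>f x\<bar>\<rceil>)" by blast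
    then have "m n (T x) > B + \<bar>f x\<bar>" by linarith
    then have "m (Suc n) x > B" by (simp add: mS)
    then show "\<exists>n. m n x > real B" by blast
  next
    fix B :: nat assume "\<forall>B::nat. \<exists>n. m n x > real B"
    then obtain n where n: "m n x > real (nat \<lceil>B + \<bar>f x\<bar>\<rceil>)" by blast
    then have "m n x > B + \<bar>f x\<bar>" by linarith
    then obtain k where "n = Suc k" "m n x > B + \<bar>f x\<bar>" by (cases n) (auto simp: m0)
    then have "m k (T x) > B" by (auto simp: mS)
    then show "\<exists>n. m n (T x) > real B" by blast
  qed
  have TA: "T x \<in> A \<longleftrightarrow> x \<in> A" if "x \<in> space M" for x
    using that unb[of x] T_space[of x] by (simp add: A_def)
  have inv: "T -` A \<inter> space M = A"
    using TA by (auto simp: A_def)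
  have f_A: "0 \<le> (\<integral>x. indicator A x * f x \<partial>M)"
  proof (rule LIMSEQ_le_const)
    define D where "D n x = indicator A x * (m (Suc n) x - m n (T x))" for n x
    have D_meas [measurable]: "D n \<in> borel_measurable M" for n unfolding D_def by measurable
    have int1: "integrable M (\<lambda>x. indicator A x * m n x)" for n
      using integrable_mult_indicator[OF A m_int[of n]] by simp
    have int2: "integrable M (\<lambda>x. indicator A x * m n (T x))" for n
      using integrable_mult_indicator[OF A integrable_T[OF m_int[of n]]] by simp
    have "(\<integral>x. D n x \<partial>M) \<ge> 0" for n
    proof -
      have "(\<integral>x. D n x \<partial>M) = (\<integral>x. indicator A x * m (Suc n) x \<partial>M) - (\<integral>x. indicator A x * m n (T x) \<partial>M)"
        unfolding D_def right_diff_distrib using int1 int2 by (intro Bochner_Integration.integral_diff)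
      also have "(\<integral>x. indicator A x * m n (T x) \<partial>M) = (\<integral>x. indicator A (T x) * m n (T x) \<partial>M)"
        by (intro Bochner_Integration.integral_cong) (auto simp: TA indicator_def)
      also have "\<dots> = (\<integral>x. indicator A x * m n x \<partial>M)"
        by (rule integral_T) measurable
      also have "(\<integral>x. indicator A x * m (Suc n) x \<partial>M) - \<dots> \<ge> 0"
        using int1 m_step by (auto intro!: integral_mono mult_left_mono)
      finally show ?thesis .
    qed
    then show "\<exists>N. \<forall>n\<ge>N. 0 \<le> (\<integral>x. D n x \<partial>M)" by blast
    show "(\<lambda>n. \<integral>x. D n x \<partial>M) \<longlonglongrightarrow> (\<integral>x. indicator A x * f x \<partial>M)"
    proof (rule integral_dominated_convergence[where w="\<lambda>x. \<bar>f x\<bar>"])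
      show "AE x in M. norm (D n x) \<le> \<bar>f x\<bar>" for n
      proof (rule AE_I2)
        fix x show "norm (D n x) \<le> \<bar>f x\<bar>"
          using m_nonneg[of n "T x"] by (auto simp: D_def mS indicator_def)
      qed
      show "AE x in M. (\<lambda>n. D n x) \<longlonglongrightarrow> indicator A x * f x"
      proof (rule AE_I2)
        fix x assume x: "x \<in> space M"
        have "eventually (\<lambda>n. D n x = indicator A x * f x) sequentially"
        proof (cases "x \<in> A")
          case True
          then have "T x \<in> A" using x TA by simp
          then obtain n0 where "m n0 (T x) > real (nat \<lceil>\<bar>f x\<bar>\<rceil>)" unfolding A_def by blast
          then have "m n0 (T x) > \<bar>f x\<bar>" by linarith
          then have "m n (T x) > \<bar>f x\<bar>" if "n \<ge> n0" for n using m_mono[OF that, of "T x"] by linarith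
          then have "D n x = indicator A x * f x" if "n \<ge> n0" for n
            using that[THEN \<open>\<And>n. n \<ge> n0 \<Longrightarrow> m n (T x) > \<bar>f x\<bar>\<close>] True by (auto simp: D_def mS)
          then show ?thesis unfolding eventually_sequentially by blast
        qed (simp add: D_def)
        then show "(\<lambda>n. D n x) \<longlonglongrightarrow> indicator A x * f x" by (rule tendsto_eventually)
      qed
    qed (auto simp: f)
  qed
  have "measure M A \<noteq> 1"
  proof
    assume "measure M A = 1"
    then have "AE x in M. x \<in> A" using prob_eq_1[OF A] by simp
    then have "(\<integral>x. indicator A x * f x \<partial>M) = (\<integral>x. f x \<partial>M)"
      by (intro integral_cong_AE) auto
    then show False using f_A neg by simp
  qed
  with ergodic[OF A inv] have "measure M A = 0" by blast
  then have "AE x in M. x \<notin> A" using prob_eq_0[OF A] by simp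
  then show ?thesis using AE_space
  proof eventually_elim
    case (elim x)
    then obtain B :: nat where "\<And>n. m n x \<le> real B" by (auto simp: A_def not_less)
    then show ?case using sum_le order_trans by blast
  qed
qed

lemma birkhoff_upper:
  fixes f :: "'a \<Rightarrow> real"
  assumes f: "integrable M f" and e: "e > 0"
  shows "AE x in M. eventually (\<lambda>n. (\<Sum>i<n. f ((T ^^ i) x)) / n \<le> (\<integral>x. f x \<partial>M) + e) sequentially"
proof -
  define c where "c = (\<integral>x. f x \<partial>M) + e / 2"
  have "AE x in M. \<exists>B. \<forall>n. (\<Sum>i<n. f ((T ^^ i) x) - c) \<le> B"
    using f e by (intro ergodic_sums_bounded_above) (auto simp: c_def prob_space)
  then show ?thesis
  proof eventually_elim
    case (elim x)
    then obtain B where B: "\<And>n. (\<Sum>i<n. f ((T ^^ i) x) - c) \<le> B" by blast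
    have "eventually (\<lambda>n. B / real n < e / 2) sequentially"
      using e lim_const_over_n[of B] by (intro order_tendstoD(2)) auto
    then show ?case using eventually_gt_at_top[of 0]
    proof eventually_elim
      case (elim n)
      have "(\<Sum>i<n. f ((T ^^ i) x)) \<le> B + n * c" using B[of n] by (simp add: sum_subtractf)
      then have "(\<Sum>i<n. f ((T ^^ i) x)) / n \<le> B / n + c" using elim by (simp add: field_simps)
      then show ?case using elim unfolding c_def by linarith
    qed
  qed
qed

theorem birkhoff:
  fixes f :: "'a \<Rightarrow> real"
  assumes f: "integrable M f"
  shows "AE x in M. (\<lambda>n. (\<Sum>i<n. f ((T ^^ i) x)) / n) \<longlonglongrightarrow> (\<integral>x. f x \<partial>M)"
proof -
  have "AE x in M. \<forall>k. eventually (\<lambda>n. (\<Sum>i<n. f ((T ^^ i) x)) / n \<le> (\<integral>x. f x \<partial>M) + 1 / Suc k) sequentially"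
    unfolding AE_all_countable using f by (auto intro!: birkhoff_upper)
  moreover have "AE x in M. \<forall>k. eventually (\<lambda>n. (\<Sum>i<n. - f ((T ^^ i) x)) / n \<le> (\<integral>x. - f x \<partial>M) + 1 / Suc k) sequentially"
    unfolding AE_all_countable using f by (intro allI birkhoff_upper) auto
  ultimately show ?thesis
  proof eventually_elim
    case (elim x)
    show ?case
    proof (rule tendstoI)
      fix e :: real assume "e > 0"
      then obtain k where k: "1 / real (Suc k) < e" using reals_Archimedean by (metis inverse_eq_divide)
      from elim(1)[rule_format, of k] elim(2)[rule_format, of k]
      show "eventually (\<lambda>n. dist ((\<Sum>i<n. f ((T ^^ i) x)) / n) (\<integral>x. f x \<partial>M) < e) sequentially"
        by eventually_elim (use k in \<open>auto simp: dist_real_def sum_negf abs_less_iff\<close>)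
    qed
  qed
qed

text \<open>This form of ergodicity only asks that the shift does not leave \<open>W\<close>; the monotonicity in the
  starting point supplies exactly such events.\<close>

lemma zero_one_forward:
  assumes W [measurable]: "W \<in> sets M" and imp: "AE x in M. x \<in> W \<longrightarrow> T x \<in> W"
  shows "measure M W = 0 \<or> measure M W = 1"
proof (cases "measure M W = 0")
  case False
  \<comment> \<open>A point of \<open>W\<close> never leaves \<open>W\<close>, so the frequency of its visits to \<open>W\<close> is 1.\<close>
  have "AE x in M. (\<lambda>n. (\<Sum>i<n. indicator W ((T ^^ i) x)) / real n) \<longlonglongrightarrow> measure M W"
    using birkhoff[of "indicator W"] by (simp add: integrable_real_indicator emeasure_eq_measure)
  moreover have "AE x in M. \<forall>n. (T ^^ n) x \<in> W \<longrightarrow> T ((T ^^ n) x) \<in> W"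
    by (rule AE_T_iter_all[OF imp])
  ultimately have ae: "AE x in M. x \<in> W \<longrightarrow> measure M W = 1"
  proof eventually_elim
    case (elim x)
    show ?case
    proof
      assume "x \<in> W"
      then have "(T ^^ n) x \<in> W" for n using elim(2) by (induction n) auto
      then have "eventually (\<lambda>n. (\<Sum>i<n. indicator W ((T ^^ i) x)) / real n = 1) sequentially"
        by (intro eventually_mono[OF eventually_gt_at_top[of 0]]) simp
      then have "(\<lambda>n. (\<Sum>i<n. indicator W ((T ^^ i) x)) / real n) \<longlonglongrightarrow> 1"
        by (rule tendsto_eventually)
      then show "measure M W = 1" using elim(1) LIMSEQ_unique by blast
    qed
  qed
  have "measure M W = 1"
  proof (rule ccontr)
    assume "measure M W \<noteq> 1"
    then have "AE x in M. x \<notin> W" using ae by auto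
    then show False using False prob_eq_0[OF W] by simp
  qed
  then show ?thesis by simp
qed simp

lemma zero_one_backward:
  assumes W [measurable]: "W \<in> sets M" and imp: "AE x in M. T x \<in> W \<longrightarrow> x \<in> W"
  shows "measure M W = 0 \<or> measure M W = 1"
proof -
  have "AE x in M. x \<in> space M - W \<longrightarrow> T x \<in> space M - W"
    using imp by eventually_elim (auto simp: T_space)
  then have "measure M (space M - W) = 0 \<or> measure M (space M - W) = 1"
    by (intro zero_one_forward) auto
  then show ?thesis using prob_compl[OF W] by auto
qed

text \<open>The ergodic averages of an invariant function are the function itself.\<close>

lemma invariant_const:
  fixes f :: "'a \<Rightarrow> real"
  assumes "integrable M f" and inv: "\<And>x. x \<in> space M \<Longrightarrow> f (T x) = f x"
  shows "AE x in M. f x = (\<integral>x. f x \<partial>M)"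
  using birkhoff[OF assms(1)] AE_space
proof eventually_elim
  case (elim x)
  have *: "(T ^^ n) x \<in> space M \<and> f ((T ^^ n) x) = f x" for n
    using elim(2) by (induction n) (auto simp: inv T_space)
  have "eventually (\<lambda>n. (\<Sum>i<n. f ((T ^^ i) x)) / real n = f x) sequentially"
    by (rule eventually_mono[OF eventually_gt_at_top[of 0]]) (simp add: *)
  then have "(\<lambda>n. (\<Sum>i<n. f ((T ^^ i) x)) / real n) \<longlonglongrightarrow> f x" by (rule tendsto_eventually)
  then show ?case using elim(1) LIMSEQ_unique by blast
qed

end

lemma ergodic_system_factor:
  assumes E: "ergodic_system M T" and g: "g \<in> M \<rightarrow>\<^sub>M N" and S: "S \<in> N \<rightarrow>\<^sub>M N"
    and eq: "\<And>x. x \<in> space M \<Longrightarrow> g (T x) = S (g x)"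
  shows "ergodic_system (distr M N g) S"
proof -
  interpret E: ergodic_system M T by fact
  note [measurable] = g S E.T_measurable
  interpret D: prob_space "distr M N g" by (rule E.prob_space_distr) fact
  show ?thesis
  proof
    show "S \<in> distr M N g \<rightarrow>\<^sub>M distr M N g" using S by simp
    have "distr (distr M N g) N S = distr M N (\<lambda>x. S (g x))"
      by (subst distr_distr) (auto simp: o_def)
    also have "\<dots> = distr M N (\<lambda>x. g (T x))"
      by (intro distr_cong) (auto simp: eq)
    also have "\<dots> = distr (distr M M T) N g"
      by (subst distr_distr) (auto simp: o_def)
    finally show "distr (distr M N g) (distr M N g) S = distr M N g"
      by (simp add: E.distr_T cong: distr_cong)
  next
    fix A assume "A \<in> sets (distr M N g)" and inv: "S -` A \<inter> space (distr M N g) = A"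
    then have A: "A \<in> sets N" by simp
    have "T -` (g -` A \<inter> space M) \<inter> space M = g -` A \<inter> space M"
    proof (intro set_eqI iffI; clarsimp simp: E.T_space eq)
      fix x assume "x \<in> space M"
      then have *: "g x \<in> space N" using measurable_space[OF g] by blast
      show "S (g x) \<in> A \<Longrightarrow> g x \<in> A" "g x \<in> A \<Longrightarrow> S (g x) \<in> A" using inv * by auto
    qed
    then have "measure M (g -` A \<inter> space M) = 0 \<or> measure M (g -` A \<inter> space M) = 1"
      using A by (intro E.ergodic) auto
    then show "measure (distr M N g) A = 0 \<or> measure (distr M N g) A = 1"
      using measure_distr[OF g A] by simp
  qed
qed

section \<open>Walks driven by arrows\<close>

type_synonym arrows = "int \<times> nat \<Rightarrow> bool"

text \<open>Arrows at a site are numbered from 0, and \<open>True\<close> points right.\<close>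

primrec rts :: "arrows \<Rightarrow> int \<Rightarrow> nat \<Rightarrow> nat" where
  "rts a x 0 = 0"
| "rts a x (Suc n) = rts a x n + (if a (x, n) then 1 else 0)"

primrec lfs :: "arrows \<Rightarrow> int \<Rightarrow> nat \<Rightarrow> nat" where
  "lfs a x 0 = 0"
| "lfs a x (Suc n) = lfs a x n + (if a (x, n) then 0 else 1)"

lemma rts_mono: "m \<le> n \<Longrightarrow> rts a x m \<le> rts a x n"
  by (rule lift_Suc_mono_le) auto

lemma lfs_mono: "m \<le> n \<Longrightarrow> lfs a x m \<le> lfs a x n"
  by (rule lift_Suc_mono_le) auto

text \<open>The state consists of the position and, for each site, the number of arrows already taken there.
  Starting from counts \<open>c\<close> instead of 0 makes the walker live on the arrows left by its predecessors.\<close>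

primrec walk :: "arrows \<Rightarrow> (int \<Rightarrow> nat) \<Rightarrow> int \<Rightarrow> nat \<Rightarrow> int \<times> (int \<Rightarrow> nat)" where
  "walk a c z 0 = (z, c)"
| "walk a c z (Suc n) = (let (x, d) = walk a c z n in
     (if a (x, d x) then x + 1 else x - 1, d(x := Suc (d x))))"

definition pos :: "arrows \<Rightarrow> (int \<Rightarrow> nat) \<Rightarrow> int \<Rightarrow> nat \<Rightarrow> int" where
  "pos a c z n = fst (walk a c z n)"

definition cnt :: "arrows \<Rightarrow> (int \<Rightarrow> nat) \<Rightarrow> int \<Rightarrow> nat \<Rightarrow> int \<Rightarrow> nat" where
  "cnt a c z n = snd (walk a c z n)"

lemma pos_0 [simp]: "pos a c z 0 = z"
  and cnt_0 [simp]: "cnt a c z 0 = c"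
  and pos_Suc: "pos a c z (Suc n) =
    (if a (pos a c z n, cnt a c z n (pos a c z n)) then pos a c z n + 1 else pos a c z n - 1)"
  and cnt_Suc: "cnt a c z (Suc n) = (cnt a c z n)(pos a c z n := Suc (cnt a c z n (pos a c z n)))"
  by (simp_all add: pos_def cnt_def Let_def split_def)

lemma cnt_visits: "cnt a c z n x = c x + card {m. m < n \<and> pos a c z m = x}"
proof (induction n)
  case (Suc n)
  have "{m. m < Suc n \<and> pos a c z m = x} =
      (if pos a c z n = x then insert n {m. m < n \<and> pos a c z m = x} else {m. m < n \<and> pos a c z m = x})"
    by (auto simp: less_Suc_eq)
  then show ?case using Suc by (cases "pos a c z n = x") (auto simp: cnt_Suc)
qed simp

lemma cnt_mono: "m \<le> n \<Longrightarrow> cnt a c z m x \<le> cnt a c z n x"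
  by (rule lift_Suc_mono_le) (auto simp: cnt_Suc)

lemma cnt_ge: "c x \<le> cnt a c z n x"
  by (simp add: cnt_visits)

text \<open>Each step uses one arrow and crosses one edge, hence the balance of right arrows used at \<open>y\<close>
  and left arrows used at \<open>y + 1\<close> records on which side of the edge the walker is.\<close>

lemma flux_walk:
  "int (rts a y (cnt a c z n y)) - int (lfs a (y + 1) (cnt a c z n (y + 1))) =
   int (rts a y (c y)) - int (lfs a (y + 1) (c (y + 1)))
   + of_bool (y < pos a c z n) - of_bool (y < z)"
proof (induction n)
  case (Suc n)
  consider "pos a c z n = y" | "pos a c z n = y + 1" | "pos a c z n \<noteq> y" "pos a c z n \<noteq> y + 1" by blast
  then show ?case using Suc by cases (auto simp: cnt_Suc pos_Suc)
qed simp

text \<open>A site that has been left behind was last left through a right arrow.\<close>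

lemma last_arrow_right:
  "z \<le> y \<Longrightarrow> y < pos a c z n \<Longrightarrow> 0 < cnt a c z n y \<and> a (y, cnt a c z n y - 1)"
proof (induction n)
  case (Suc n)
  then show ?case by (cases "y = pos a c z n") (auto simp: cnt_Suc pos_Suc split: if_splits)
qed simp

subsection \<open>Nearest-neighbour paths\<close>

definition nn_path :: "(nat \<Rightarrow> int) \<Rightarrow> bool" where
  "nn_path s \<longleftrightarrow> (\<forall>n. s (Suc n) = s n + 1 \<or> s (Suc n) = s n - 1)"

lemma nn_path_pos: "nn_path (pos a c z)"
  by (simp add: nn_path_def pos_Suc)

lemma nn_path_uminus: "nn_path s \<Longrightarrow> nn_path (\<lambda>n. - s n)"
  unfolding nn_path_def by (smt (verit))

lemma nn_path_hits:
  assumes "nn_path s" "s m \<le> y" "y \<le> s n" "m \<le> n"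
  shows "\<exists>k. m \<le> k \<and> k \<le> n \<and> s k = y"
  using assms(4,3)
proof (induction n rule: dec_induct)
  case base
  then show ?case using assms(2) by (intro exI[of _ m]) auto
next
  case (step n)
  show ?case
  proof (cases "y \<le> s n")
    case True
    then show ?thesis using step by (meson le_Suc_eq)
  next
    case False
    then have "s (Suc n) = y" using assms(1) step.prems unfolding nn_path_def by (smt (verit))
    then show ?thesis using step.hyps by (intro exI[of _ "Suc n"]) auto
  qed
qed

lemma nn_path_hits_down:
  assumes "nn_path s" "y \<le> s m" "s n \<le> y" "m \<le> n"
  shows "\<exists>k. m \<le> k \<and> k \<le> n \<and> s k = y"
proof -
  have "\<exists>k. m \<le> k \<and> k \<le> n \<and> - s k = - y"
    by (rule nn_path_hits[OF nn_path_uminus[OF assms(1)]]) (use assms in auto)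
  then show ?thesis by simp
qed

lemma nn_path_bound: "nn_path s \<Longrightarrow> \<bar>s (m + n) - s m\<bar> \<le> int n"
proof (induction n)
  case (Suc n)
  then show ?case unfolding nn_path_def by (smt (verit) add_Suc_right of_nat_Suc)
qed simp

abbreviation to_right :: "(nat \<Rightarrow> int) \<Rightarrow> bool" where
  "to_right s \<equiv> filterlim s at_top sequentially"

abbreviation to_left :: "(nat \<Rightarrow> int) \<Rightarrow> bool" where
  "to_left s \<equiv> filterlim s at_bot sequentially"

lemma filterlim_int_uminus:
  fixes f :: "nat \<Rightarrow> int"
  shows "filterlim (\<lambda>n. - f n) at_top F \<longleftrightarrow> filterlim f at_bot F"
    and "filterlim (\<lambda>n. - f n) at_bot F \<longleftrightarrow> filterlim f at_top F"
proof -
  have reindex: "(\<forall>Z. Q (- Z)) \<longleftrightarrow> (\<forall>Z. Q Z)" for Q :: "int \<Rightarrow> bool"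
    by (metis minus_minus)
  have *: "filterlim (\<lambda>n. - f n) at_top F \<longleftrightarrow> filterlim f at_bot F" for f :: "nat \<Rightarrow> int"
    using reindex[of "\<lambda>Z. eventually (\<lambda>n. f n \<le> Z) F"]
    by (simp add: filterlim_at_top filterlim_at_bot le_minus_iff)
  show "filterlim (\<lambda>n. - f n) at_top F \<longleftrightarrow> filterlim f at_bot F" by (rule *)
  show "filterlim (\<lambda>n. - f n) at_bot F \<longleftrightarrow> filterlim f at_top F"
    using *[of "\<lambda>n. - f n"] by simp
qed

lemma filterlim_int_minus_1:
  fixes f :: "nat \<Rightarrow> int"
  shows "filterlim (\<lambda>n. f n - 1) at_top F \<longleftrightarrow> filterlim f at_top F"
    and "filterlim (\<lambda>n. f n - 1) at_bot F \<longleftrightarrow> filterlim f at_bot F"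
proof -
  have reindex: "(\<forall>Z. Q (Z + 1)) \<longleftrightarrow> (\<forall>Z. Q Z)" for Q :: "int \<Rightarrow> bool"
    by (metis diff_add_cancel)
  show "filterlim (\<lambda>n. f n - 1) at_top F \<longleftrightarrow> filterlim f at_top F"
    using reindex[of "\<lambda>Z. eventually (\<lambda>n. Z \<le> f n) F"] by (simp add: filterlim_at_top le_diff_eq)
  show "filterlim (\<lambda>n. f n - 1) at_bot F \<longleftrightarrow> filterlim f at_bot F"
    using reindex[of "\<lambda>Z. eventually (\<lambda>n. f n \<le> Z) F"] by (simp add: filterlim_at_bot diff_le_eq)
qed

lemma transient_pathI_top: "to_right s \<Longrightarrow> transient_path s"
  unfolding transient_path_def
proof
  fix y assume "to_right s"
  then have "eventually (\<lambda>n. y + 1 \<le> s n) sequentially" by (simp add: filterlim_at_top)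
  then obtain n0 where "\<And>n. n \<ge> n0 \<Longrightarrow> y + 1 \<le> s n" unfolding eventually_sequentially by blast
  then have "{m. s m = y} \<subseteq> {..<n0}" by (force simp: not_le[symmetric])
  then show "finite {m. s m = y}" using finite_subset by blast
qed

lemma transient_path_uminus: "transient_path (\<lambda>n. - s n) \<longleftrightarrow> transient_path s"
proof -
  have "{m. - s m = y} = {m. s m = - y}" for y by auto
  then show ?thesis unfolding transient_path_def by (metis minus_minus)
qed

lemma transient_pathI_bot: "to_left s \<Longrightarrow> transient_path s"
  using transient_pathI_top[of "\<lambda>n. - s n"] by (simp add: transient_path_uminus filterlim_int_uminus)

text \<open>Finally the path avoids 0, and a nearest-neighbour path cannot change sign without visiting 0.\<close>

lemma transient_path_cases:
  assumes nn: "nn_path s" and tr: "transient_path s"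
  shows "to_right s \<or> to_left s"
proof -
  have far: "eventually (\<lambda>n. K < \<bar>s n\<bar>) sequentially" for K
  proof -
    have "finite (\<Union>y\<in>{-K..K}. {m. s m = y})" using tr by (auto simp: transient_path_def)
    moreover have "(\<Union>y\<in>{-K..K}. {m. s m = y}) = {m. \<not> K < \<bar>s m\<bar>}" by auto
    ultimately have "finite {m. \<not> K < \<bar>s m\<bar>}" by simp
    then show ?thesis by (simp add: cofinite_eq_sequentially[symmetric] eventually_cofinite)
  qed
  obtain n0 where n0: "\<And>n. n \<ge> n0 \<Longrightarrow> s n \<noteq> 0"
    using far[of 0] unfolding eventually_sequentially by fastforce
  show ?thesis
  proof (cases "s n0 > 0")
    case True
    have "s n > 0" if "n \<ge> n0" for n
      using nn_path_hits_down[OF nn, of 0 n0 n] True that n0 by force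
    then have "eventually (\<lambda>n. s n > 0) sequentially" unfolding eventually_sequentially by blast
    then have "eventually (\<lambda>n. Z \<le> s n) sequentially" for Z
      using far[of Z] by eventually_elim auto
    then show ?thesis by (simp add: filterlim_at_top)
  next
    case False
    have "s n < 0" if "n \<ge> n0" for n
      using nn_path_hits[OF nn, of n0 0 n] False that n0 by force
    then have "eventually (\<lambda>n. s n < 0) sequentially" unfolding eventually_sequentially by blast
    then have "eventually (\<lambda>n. s n \<le> Z) sequentially" for Z
      using far[of "- Z"] by eventually_elim auto
    then show ?thesis by (simp add: filterlim_at_bot)
  qed
qed

lemma transient_cnt_eventually:
  assumes "transient_path (pos a c z)"
  shows "eventually (\<lambda>n. cnt a c z n x = c x + card {m. pos a c z m = x}) sequentially"
proof -
  have "finite {m. pos a c z m = x}" using assms by (simp add: transient_path_def)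
  then obtain n0 where "\<And>m. pos a c z m = x \<Longrightarrow> m < n0"
    using finite_nat_set_iff_bounded by auto
  then have "{m. m < n \<and> pos a c z m = x} = {m. pos a c z m = x}" if "n \<ge> n0" for n
    using that by fastforce
  then show ?thesis unfolding eventually_sequentially cnt_visits by metis
qed

lemma transient_cnt_le:
  assumes "transient_path (pos a c z)"
  shows "cnt a c z n x \<le> c x + card {m. pos a c z m = x}"
proof -
  have "finite {m. pos a c z m = x}" using assms by (simp add: transient_path_def)
  then show ?thesis unfolding cnt_visits by (auto intro!: card_mono)
qed

lemma transient_if_cnt_bounded:
  assumes "\<And>n x. cnt a c z n x \<le> h x"
  shows "transient_path (pos a c z)"
  unfolding transient_path_def
proof (intro allI, rule ccontr)
  fix y assume inf: "infinite {m. pos a c z m = y}"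
  then obtain A where A: "A \<subseteq> {m. pos a c z m = y}" "finite A" "card A = Suc (h y)"
    using infinite_arbitrarily_large by blast
  then obtain n where "A \<subseteq> {..<n}" using finite_nat_iff_bounded by blast
  then have "card A \<le> card {m. m < n \<and> pos a c z m = y}" using A by (intro card_mono) auto
  then show False using assms[of n y] A by (simp add: cnt_visits)
qed

subsection \<open>Successive walkers\<close>

text \<open>The arrows taken at each site by the first \<open>j\<close> walkers, all started at \<open>z\<close>. The cardinality of an
  infinite set is 0, so this is the total consumption only as long as the walkers are transient.\<close>

primrec odo :: "arrows \<Rightarrow> int \<Rightarrow> nat \<Rightarrow> int \<Rightarrow> nat" where
  "odo a z 0 = (\<lambda>x. 0)"
| "odo a z (Suc j) = (\<lambda>x. odo a z j x + card {m. pos a (odo a z j) z m = x})"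

definition mob :: "arrows \<Rightarrow> int \<Rightarrow> nat \<Rightarrow> nat \<Rightarrow> int" where
  "mob a z j = pos a (odo a z j) z"

definition directed :: "arrows \<Rightarrow> int \<Rightarrow> nat \<Rightarrow> (nat \<Rightarrow> bool) \<Rightarrow> bool" where
  "directed a z k s \<longleftrightarrow> (\<forall>j<k. filterlim (mob a z j) (if s j then at_top else at_bot) sequentially)"

primrec rights :: "(nat \<Rightarrow> bool) \<Rightarrow> nat \<Rightarrow> nat" where
  "rights s 0 = 0"
| "rights s (Suc k) = rights s k + (if s k then 1 else 0)"

abbreviation lefts :: "(nat \<Rightarrow> bool) \<Rightarrow> nat \<Rightarrow> nat" where
  "lefts s \<equiv> rights (\<lambda>j. \<not> s j)"

lemma rights_mono: "j \<le> k \<Longrightarrow> rights s j \<le> rights s k"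
  by (rule lift_Suc_mono_le) auto

lemma rights_cong: "(\<And>j. j < k \<Longrightarrow> s j = s' j) \<Longrightarrow> rights s k = rights s' k"
  by (induction k) auto

lemma nn_path_mob: "nn_path (mob a z j)"
  by (simp add: mob_def nn_path_pos)

lemma directed_Suc:
  "directed a z (Suc k) s \<longleftrightarrow>
    directed a z k s \<and> filterlim (mob a z k) (if s k then at_top else at_bot) sequentially"
  by (auto simp: directed_def less_Suc_eq)

lemma directed_cong: "(\<And>j. j < k \<Longrightarrow> s j = s' j) \<Longrightarrow> directed a z k s \<longleftrightarrow> directed a z k s'"
  by (simp add: directed_def)

lemma directed_transient: "directed a z k s \<Longrightarrow> j < k \<Longrightarrow> transient_path (mob a z j)"
  unfolding directed_def by (metis transient_pathI_bot transient_pathI_top)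

text \<open>A walker lost on the right crosses each edge to the right of \<open>z\<close> once more rightwards than
  leftwards, and each edge to the left of \<open>z\<close> equally often in both directions.\<close>

lemma flux_odo:
  "directed a z k s \<Longrightarrow>
    int (rts a y (odo a z k y)) - int (lfs a (y + 1) (odo a z k (y + 1))) =
    (if z \<le> y then int (rights s k) else - int (lefts s k))"
proof (induction k)
  case (Suc k)
  let ?c = "odo a z k"
  have lim: "filterlim (pos a ?c z) (if s k then at_top else at_bot) sequentially"
    using Suc.prems by (simp add: directed_Suc mob_def)
  have tr: "transient_path (pos a ?c z)"
    using directed_transient[OF Suc.prems, of k] by (simp add: mob_def)
  have "eventually (\<lambda>n. (y < pos a ?c z n) = s k) sequentially"
  proof (cases "s k")
    case True
    then have "eventually (\<lambda>n. y + 1 \<le> pos a ?c z n) sequentially"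
      using lim by (simp add: filterlim_at_top)
    then show ?thesis by eventually_elim (use True in auto)
  next
    case False
    then have "eventually (\<lambda>n. pos a ?c z n \<le> y) sequentially"
      using lim by (simp add: filterlim_at_bot)
    then show ?thesis by eventually_elim (use False in auto)
  qed
  then have "eventually (\<lambda>n. (y < pos a ?c z n) = s k
      \<and> cnt a ?c z n y = odo a z (Suc k) y \<and> cnt a ?c z n (y + 1) = odo a z (Suc k) (y + 1)) sequentially"
    using transient_cnt_eventually[OF tr, of y] transient_cnt_eventually[OF tr, of "y + 1"]
    by eventually_elim auto
  then obtain n where n: "(y < pos a ?c z n) = s k" "cnt a ?c z n y = odo a z (Suc k) y"
      "cnt a ?c z n (y + 1) = odo a z (Suc k) (y + 1)"
    using eventually_happens'[OF sequentially_bot] by blast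
  have IH: "int (rts a y (?c y)) - int (lfs a (y + 1) (?c (y + 1))) =
      (if z \<le> y then int (rights s k) else - int (lefts s k))"
    by (rule Suc.IH) (use Suc.prems in \<open>simp only: directed_Suc\<close>)
  have "int (rts a y (odo a z (Suc k) y)) - int (lfs a (y + 1) (odo a z (Suc k) (y + 1))) =
      (if z \<le> y then int (rights s k) else - int (lefts s k)) + of_bool (s k) - of_bool (y < z)"
    using flux_walk[of a y ?c z n] unfolding n IH .
  then show ?case by (cases "s k"; cases "z \<le> y"; simp del: odo.simps)
qed simp

subsection \<open>Mirror images and translations\<close>

definition reflect_arrows :: "arrows \<Rightarrow> arrows" where
  "reflect_arrows a = (\<lambda>(x, i). \<not> a (- x, i))"

lemma walk_reflect:
  "pos (reflect_arrows a) (\<lambda>x. c (- x)) (- z) n = - pos a c z n \<and>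
   cnt (reflect_arrows a) (\<lambda>x. c (- x)) (- z) n = (\<lambda>x. cnt a c z n (- x))"
proof (induction n)
  case (Suc n)
  then show ?case
    by (auto simp: pos_Suc cnt_Suc reflect_arrows_def fun_eq_iff)
qed simp

lemma odo_reflect: "odo (reflect_arrows a) (- z) j = (\<lambda>x. odo a z j (- x))"
proof (induction j)
  case (Suc j)
  have "pos (reflect_arrows a) (\<lambda>x. odo a z j (- x)) (- z) m = x \<longleftrightarrow> pos a (odo a z j) z m = - x" for m x
    using walk_reflect[of a "odo a z j" z m] by auto
  then show ?case by (simp add: Suc)
qed simp

lemma mob_reflect: "mob (reflect_arrows a) (- z) j = (\<lambda>n. - mob a z j n)"
  using walk_reflect[of a "odo a z j" z] by (simp add: mob_def odo_reflect fun_eq_iff)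

lemma directed_reflect: "directed (reflect_arrows a) (- z) k s \<longleftrightarrow> directed a z k (\<lambda>j. \<not> s j)"
  unfolding directed_def mob_reflect
  by (auto simp: filterlim_int_uminus split: if_splits)

definition translate :: "(int \<times> 'e \<Rightarrow> 'b) \<Rightarrow> int \<times> 'e \<Rightarrow> 'b" where
  "translate a = (\<lambda>(x, i). a (x + 1, i))"

lemma walk_shift:
  "pos (translate a) (\<lambda>x. c (x + 1)) z n = pos a c (z + 1) n - 1 \<and>
   cnt (translate a) (\<lambda>x. c (x + 1)) z n = (\<lambda>x. cnt a c (z + 1) n (x + 1))"
proof (induction n)
  case (Suc n)
  then show ?case by (auto simp: pos_Suc cnt_Suc translate_def fun_eq_iff)
qed simp

lemma odo_shift: "odo (translate a) z j = (\<lambda>x. odo a (z + 1) j (x + 1))"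
proof (induction j)
  case (Suc j)
  have "pos (translate a) (\<lambda>x. odo a (z + 1) j (x + 1)) z m = x \<longleftrightarrow> pos a (odo a (z + 1) j) (z + 1) m = x + 1" for m x
    using walk_shift[of a "odo a (z + 1) j" z m] by auto
  then show ?case by (simp add: Suc)
qed simp

lemma mob_shift: "mob (translate a) z j = (\<lambda>n. mob a (z + 1) j n - 1)"
  using walk_shift[of a "odo a (z + 1) j" z] by (simp add: mob_def odo_shift fun_eq_iff)

lemma directed_shift: "directed (translate a) z k s \<longleftrightarrow> directed a (z + 1) k s"
  unfolding directed_def mob_shift
  by (auto simp: filterlim_int_minus_1)

lemma translate_iter: "(translate ^^ n) a (x, i) = a (x + int n, i)"
proof (induction n arbitrary: x)
  case (Suc n)
  then show ?case by (simp add: translate_def algebra_simps)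
qed simp

section \<open>The least odometer carrying a given flux to the right\<close>

text \<open>Whether \<open>n\<close> arrows at \<open>x\<close> are enough for a net flux of \<open>r\<close> through each of the \<open>K\<close> edges that follow:
  the right arrows at \<open>x\<close> must make up for \<open>r\<close> and for the left arrows used at \<open>x + 1\<close>. Stating the
  recursion as a predicate avoids infinite values where no number of arrows is enough, and makes its
  measurability obvious.\<close>

primrec suffices :: "arrows \<Rightarrow> nat \<Rightarrow> nat \<Rightarrow> int \<Rightarrow> nat \<Rightarrow> bool" where
  "suffices a r 0 x n \<longleftrightarrow> True"
| "suffices a r (Suc K) x n \<longleftrightarrow> (\<exists>m. suffices a r K (x + 1) m \<and> r + lfs a (x + 1) m \<le> rts a x n)"

definition finite_need :: "arrows \<Rightarrow> nat \<Rightarrow> int \<Rightarrow> bool" where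
  "finite_need a r x \<longleftrightarrow> (\<exists>n. \<forall>K. suffices a r K x n)"

text \<open>If \<open>finite_need a r x\<close> fails, then no number of arrows is enough and the value has no meaning.\<close>

definition need :: "arrows \<Rightarrow> nat \<Rightarrow> int \<Rightarrow> nat" where
  "need a r x = (LEAST n. \<forall>K. suffices a r K x n)"

lemma suffices_up: "suffices a r K x n \<Longrightarrow> n \<le> n' \<Longrightarrow> suffices a r K x n'"
  using rts_mono[of n n' a x] by (cases K) (auto intro: order_trans)

lemma suffices_Suc: "suffices a r (Suc K) x n \<Longrightarrow> suffices a r K x n"
proof (induction K arbitrary: x n)
  case (Suc K)
  from Suc.prems obtain m where "suffices a r (Suc K) (x + 1) m" "r + lfs a (x + 1) m \<le> rts a x n"
    by (subst (asm) suffices.simps(2)) blast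
  then have "suffices a r K (x + 1) m \<and> r + lfs a (x + 1) m \<le> rts a x n" using Suc.IH by blast
  then show ?case unfolding suffices.simps(2) by blast
qed simp

lemma suffices_window: "suffices a r K x n \<Longrightarrow> L \<le> K \<Longrightarrow> suffices a r L x n"
  by (induction K rule: nat_induct) (auto simp: le_Suc_eq dest: suffices_Suc simp del: suffices.simps(2))

lemma suffices_flux: "suffices a r K x n \<Longrightarrow> q \<le> r \<Longrightarrow> suffices a q K x n"
proof (induction K arbitrary: x n)
  case (Suc K)
  then obtain m where "suffices a r K (x + 1) m" "r + lfs a (x + 1) m \<le> rts a x n" by auto
  with Suc show ?case by (auto intro!: exI[of _ m])
qed simp

lemma need_suffices: "finite_need a r x \<Longrightarrow> suffices a r K x (need a r x)"
  unfolding finite_need_def need_def using LeastI_ex[of "\<lambda>n. \<forall>K. suffices a r K x n"] by blast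

lemma need_le: "(\<And>K. suffices a r K x n) \<Longrightarrow> need a r x \<le> n"
  unfolding need_def by (rule Least_le) blast

lemma finite_needI: "(\<And>K. suffices a r K x n) \<Longrightarrow> finite_need a r x"
  unfolding finite_need_def by blast

lemma need_mono:
  assumes "finite_need a r x" "q \<le> r"
  shows "finite_need a q x" "need a q x \<le> need a r x"
  using suffices_flux[OF need_suffices[OF assms(1)] assms(2)] by (auto intro: finite_needI need_le)

lemma need_0: "finite_need a 0 x" "need a 0 x = 0"
proof -
  have "suffices a 0 K x 0" for K x by (induction K arbitrary: x) (auto intro!: exI[of _ 0])
  then show "finite_need a 0 x" "need a 0 x = 0" using need_le[of a 0 x 0] by (auto intro: finite_needI)
qed

lemma suffices_shift: "suffices ((translate ^^ d) a) r K x n = suffices a r K (x + int d) n"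
proof -
  have r: "rts ((translate ^^ d) a) x n = rts a (x + int d) n" for x n
    by (induction n) (auto simp: translate_iter)
  have l: "lfs ((translate ^^ d) a) x n = lfs a (x + int d) n" for x n
    by (induction n) (auto simp: translate_iter)
  show ?thesis
    by (induction K arbitrary: x n) (auto simp: r l algebra_simps)
qed

lemma need_shift: "need ((translate ^^ d) a) r x = need a r (x + int d)"
  and finite_need_shift: "finite_need ((translate ^^ d) a) r x = finite_need a r (x + int d)"
  by (simp_all add: need_def finite_need_def suffices_shift)

lemma suffices_if_supersolution:
  assumes "\<And>y. x \<le> y \<Longrightarrow> y < x + int K \<Longrightarrow> r + lfs a (y + 1) (h (y + 1)) \<le> rts a y (h y)"
  shows "suffices a r K x (h x)"
  using assms
proof (induction K arbitrary: x)
  case (Suc K)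
  have "suffices a r K (x + 1) (h (x + 1))" by (rule Suc.IH) (use Suc.prems in auto)
  moreover have "r + lfs a (x + 1) (h (x + 1)) \<le> rts a x (h x)" using Suc.prems by auto
  ultimately show ?case by auto
qed simp

text \<open>The number \<open>need a r (x + 1)\<close> is attained in a finite window already, since one arrow less fails in
  some window; this window, enlarged by \<open>x\<close>, gives the inequality at \<open>x\<close>.\<close>

lemma need_supersolution:
  assumes "finite_need a r x"
  shows "r + lfs a (x + 1) (need a r (x + 1)) \<le> rts a x (need a r x)"
proof -
  have "\<exists>m. need a r (x + 1) \<le> m \<and> r + lfs a (x + 1) m \<le> rts a x (need a r x)"
  proof (cases "need a r (x + 1)")
    case 0
    then show ?thesis using need_suffices[OF assms, of "Suc 0"] by auto
  next
    case (Suc b)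
    have "\<not> (\<forall>K. suffices a r K (x + 1) b)"
      using need_le[of a r "x + 1" b] Suc by auto
    then obtain K where K: "\<not> suffices a r K (x + 1) b" by blast
    obtain m where m: "suffices a r K (x + 1) m" "r + lfs a (x + 1) m \<le> rts a x (need a r x)"
      using need_suffices[OF assms, of "Suc K"] by auto
    have "\<not> m \<le> b" using K m(1) suffices_up by blast
    then show ?thesis using m Suc by (intro exI[of _ m]) auto
  qed
  then obtain m where "need a r (x + 1) \<le> m" "r + lfs a (x + 1) m \<le> rts a x (need a r x)" by blast
  then show ?thesis using lfs_mono[of "need a r (x + 1)" m a "x + 1"] by linarith
qed

text \<open>The situation of a walker that starts after \<open>r\<close> walkers have disappeared to the right, seen to
  the right of a point \<open>m\<close> beyond which the walkers lost on the left have left no trace.\<close>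

definition frontier :: "arrows \<Rightarrow> (int \<Rightarrow> nat) \<Rightarrow> int \<Rightarrow> nat \<Rightarrow> int \<Rightarrow> bool" where
  "frontier a c z r m \<longleftrightarrow> z \<le> m \<and>
    (\<forall>x\<ge>m. finite_need a r x \<and> c x = need a r x \<and> rts a x (c x) = r + lfs a (x + 1) (c (x + 1)))"

lemma frontierD:
  assumes "frontier a c z r m" "m \<le> x"
  shows "finite_need a r x" "c x = need a r x" "rts a x (c x) = r + lfs a (x + 1) (c (x + 1))" "z \<le> x"
  using assms unfolding frontier_def by (blast intro: order_trans)+

lemma frontier_flux:
  assumes "frontier a c z r m" "m \<le> y" "y < pos a c z n"
  shows "rts a y (cnt a c z n y) = Suc r + lfs a (y + 1) (cnt a c z n (y + 1))"
proof -
  have "int (rts a y (c y)) - int (lfs a (y + 1) (c (y + 1))) = int r"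
    unfolding frontierD(3)[OF assms(1,2)] by simp
  then show ?thesis using flux_walk[of a y c z n] assms(3) frontierD(4)[OF assms(1,2)] by auto
qed

text \<open>When the walker is at or beyond \<open>x + K\<close>, the counts behind it carry a flux of \<open>r + 1\<close>.\<close>

lemma frontier_lower:
  assumes "frontier a c z r m" "m \<le> x" "x + int K \<le> pos a c z n"
  shows "suffices a (Suc r) K x (cnt a c z n x)"
  using frontier_flux[OF assms(1)] assms(2,3)
  by (intro suffices_if_supersolution) (auto simp del: add_Suc)

text \<open>The claim propagates from the walker's position, where no arrow has been taken beyond
  \<open>need a r\<close>, towards the left: the counts behind a walker at a new maximum are the smallest that
  carry a flux of \<open>r + 1\<close> into the counts to their right.\<close>

lemma frontier_upper:
  assumes F: "frontier a c z r m" and fin: "\<And>x. m \<le> x \<Longrightarrow> finite_need a (Suc r) x"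
    and first: "\<And>t. t < n \<Longrightarrow> pos a c z t \<noteq> pos a c z n" and x: "m \<le> x" "x \<le> pos a c z n"
  shows "cnt a c z n x \<le> need a (Suc r) x"
  using x
proof (induction "nat (pos a c z n - x)" arbitrary: x)
  case 0
  then have x: "x = pos a c z n" by auto
  have "cnt a c z n x = c x" unfolding cnt_visits using first x by auto
  also have "\<dots> = need a r x" using F 0 by (auto simp: frontier_def)
  also have "\<dots> \<le> need a (Suc r) x" using need_mono(2)[OF fin[OF 0(2)]] by simp
  finally show ?case .
next
  case (Suc d)
  let ?h = "need a (Suc r)" and ?c = "cnt a c z n"
  have x: "x < pos a c z n" using Suc.hyps(2) by auto
  have IH: "?c (x + 1) \<le> ?h (x + 1)" using Suc.hyps Suc.prems by (intro Suc.hyps(1)) auto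
  have "rts a x (?c x) = Suc r + lfs a (x + 1) (?c (x + 1))"
    using frontier_flux[OF F Suc.prems(1) x] .
  also have "\<dots> \<le> Suc r + lfs a (x + 1) (?h (x + 1))" using lfs_mono[OF IH] by simp
  also have "\<dots> \<le> rts a x (?h x)" by (rule need_supersolution[OF fin[OF Suc.prems(1)]])
  finally have le: "rts a x (?c x) \<le> rts a x (?h x)" .
  show ?case
  proof (rule ccontr)
    assume "\<not> ?c x \<le> ?h x"
    \<comment> \<open>The last arrow used at \<open>x\<close> points right, so fewer arrows do not carry the same flux.\<close>
    have "z \<le> x" using F Suc.prems by (auto simp: frontier_def)
    then have "0 < ?c x" "a (x, ?c x - 1)" using last_arrow_right[OF _ x] by auto
    then have "rts a x (?c x) = Suc (rts a x (?c x - 1))" by (cases "?c x") auto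
    moreover have "rts a x (?h x) \<le> rts a x (?c x - 1)"
      using \<open>\<not> ?c x \<le> ?h x\<close> by (intro rts_mono) auto
    ultimately show False using le by simp
  qed
qed

lemma first_hit:
  assumes "nn_path s" "s 0 \<le> N" "N \<le> s k"
  shows "\<exists>n\<le>k. s n = N \<and> (\<forall>t<n. s t < N)"
proof -
  have ex: "\<exists>n\<le>k. s n = N" using nn_path_hits[OF assms(1,2,3)] by auto
  define n where "n = (LEAST n. s n = N)"
  have n: "s n = N" unfolding n_def using ex by (metis (mono_tags) LeastI)
  have less: "s t \<noteq> N" if "t < n" for t using not_less_Least that unfolding n_def by blast
  have "s t < N" if "t < n" for t
    using nn_path_hits[OF assms(1,2), of t] less that
    by (metis le_less_trans less_eq_nat.simps(1) linorder_not_le)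
  moreover have "n \<le> k" using ex Least_le unfolding n_def by (metis (mono_tags) order_trans)
  ultimately show ?thesis using n by blast
qed

text \<open>A walker lost on the left changes nothing beyond its maximum. A walker lost on the right adds one
  unit of flux, so its final counts are at least \<open>need\<close>; they are at most \<open>need\<close> because the counts at
  the hitting times of distant sites are, and these exhaust the final counts.\<close>

theorem directed_odo_eq_need:
  assumes "directed a z k s"
  shows "\<exists>m. frontier a (odo a z k) z (rights s k) m"
  using assms
proof (induction k)
  case 0
  then show ?case
    by (intro exI[of _ z]) (simp add: frontier_def need_0)
next
  case (Suc k)
  let ?c = "odo a z k" and ?c' = "odo a z (Suc k)" and ?r = "rights s k"
  let ?s = "pos a ?c z"
  obtain m where m: "frontier a ?c z ?r m"
    using Suc by (auto simp: directed_Suc)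
  have tr: "transient_path ?s"
    using directed_transient[OF Suc.prems, of k] by (simp add: mob_def)
  have lim: "filterlim ?s (if s k then at_top else at_bot) sequentially"
    using Suc.prems by (simp add: directed_Suc mob_def)
  have flux: "rts a x (?c' x) = rights s (Suc k) + lfs a (x + 1) (?c' (x + 1))" if "x \<ge> z" for x
    using flux_odo[OF Suc.prems, of x] that by (auto simp del: odo.simps rights.simps)
  show ?case
  proof (cases "s k")
    case False
    have "eventually (\<lambda>n. ?s n \<le> z) sequentially"
      using lim False by (simp add: filterlim_at_bot)
    then obtain n0 where n0: "\<And>n. n \<ge> n0 \<Longrightarrow> ?s n \<le> z" unfolding eventually_sequentially by blast
    define m' where "m' = max m (z + int n0 + 1)"
    have "?s n < m'" for n
    proof (cases "n \<ge> n0")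
      case True then show ?thesis using n0[of n] by (auto simp: m'_def)
    next
      case False
      then show ?thesis using nn_path_bound[OF nn_path_pos, of a ?c z 0 n] by (auto simp: m'_def)
    qed
    then have no_visit: "{n. ?s n = x} = {}" if "x \<ge> m'" for x using that by (metis (mono_tags, lifting) Collect_empty_eq leD)
    then have same: "?c' x = ?c x" if "x \<ge> m'" for x using that by simp
    then have "frontier a ?c' z (rights s (Suc k)) m'"
      unfolding frontier_def
    proof (intro conjI allI impI)
      show "z \<le> m'" using m by (auto simp: frontier_def m'_def)
      fix x assume x: "x \<ge> m'"
      then have "x \<ge> m" by (simp add: m'_def)
      note D = frontierD[OF m this]
      show "finite_need a (rights s (Suc k)) x" "?c' x = need a (rights s (Suc k)) x"
        using D(1,2) same[OF x] False by simp_all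
      show "rts a x (?c' x) = rights s (Suc k) + lfs a (x + 1) (?c' (x + 1))"
        using flux D(4) by blast
    qed
    then show ?thesis by blast
  next
    case True
    have r: "rights s (Suc k) = Suc ?r" using True by simp
    have zm: "z \<le> m" using m by (simp add: frontier_def)
    have suffices: "suffices a (Suc ?r) K x (?c' x)" if "x \<ge> m" for K x
      using flux that zm r by (intro suffices_if_supersolution) (auto simp del: odo.simps)
    have fin: "finite_need a (Suc ?r) x" if "x \<ge> m" for x
      using suffices[OF that] by (rule finite_needI)
    have "?c' x \<le> need a (Suc ?r) x" if x: "x \<ge> m" for x
    proof -
      have "eventually (\<lambda>n. cnt a ?c z n x = ?c' x \<and> x \<le> ?s n) sequentially"
        using transient_cnt_eventually[OF tr, of x] lim True
        by (intro eventually_conj) (auto simp: filterlim_at_top)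
      then obtain n0 where n0: "\<And>n. n \<ge> n0 \<Longrightarrow> cnt a ?c z n x = ?c' x" 
        unfolding eventually_sequentially by blast
      define N where "N = max x (z + int n0)"
      have "eventually (\<lambda>n. N \<le> ?s n) sequentially" using lim True by (simp add: filterlim_at_top)
      then obtain k where "N \<le> ?s k" using eventually_happens'[OF sequentially_bot] by blast
      then obtain n where n: "?s n = N" "\<And>t. t < n \<Longrightarrow> ?s t < N"
        using first_hit[OF nn_path_pos, of a ?c z N k] by (auto simp: N_def le_max_iff_disj)
      have "int n0 \<le> int n" using nn_path_bound[OF nn_path_pos, of a ?c z 0 n] n(1) by (auto simp: N_def)
      then have "?c' x = cnt a ?c z n x" using n0 by simp
      also have "\<dots> \<le> need a (Suc ?r) x"
      proof (rule frontier_upper[OF m fin _ x])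
        show "?s t \<noteq> ?s n" if "t < n" for t using n that by (metis less_irrefl)
        show "x \<le> ?s n" using n by (simp add: N_def)
      qed
      finally show ?thesis .
    qed
    moreover have "need a (Suc ?r) x \<le> ?c' x" if "x \<ge> m" for x
      using suffices[OF that] by (rule need_le)
    ultimately have "frontier a ?c' z (rights s (Suc k)) m"
      unfolding frontier_def r using fin flux zm r by (auto simp del: odo.simps intro: antisym)
    then show ?thesis by blast
  qed
qed

text \<open>The counts at the hitting times stay below \<open>need\<close>, hence a walker that reaches arbitrarily distant
  sites visits each site beyond \<open>m\<close> finitely often.\<close>

lemma unbounded_imp_top:
  assumes F: "frontier a c z r m" and fin: "\<And>x. m \<le> x \<Longrightarrow> finite_need a (Suc r) x"
    and unb: "\<And>N. \<exists>n. N \<le> pos a c z n"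
  shows "to_right (pos a c z)"
proof -
  let ?s = "pos a c z"
  have cnt_le: "cnt a c z n x \<le> need a (Suc r) x" if x: "m \<le> x" for n x
  proof -
    define N where "N = max x (z + int n)"
    obtain k where "N \<le> ?s k" using unb by blast
    moreover have "z \<le> N" by (simp add: N_def le_max_iff_disj)
    ultimately obtain t where t: "?s t = N" "\<And>q. q < t \<Longrightarrow> ?s q < N"
      using first_hit[OF nn_path_pos, of a c z N k] by auto
    have "n \<le> t" using nn_path_bound[OF nn_path_pos, of a c z 0 t] t(1) by (auto simp: N_def)
    then have "cnt a c z n x \<le> cnt a c z t x" by (rule cnt_mono)
    also have "\<dots> \<le> need a (Suc r) x"
    proof (rule frontier_upper[OF F fin _ x])
      show "?s q \<noteq> ?s t" if "q < t" for q using t that by (metis less_irrefl)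
      show "x \<le> ?s t" using t by (simp add: N_def)
    qed
    finally show ?thesis .
  qed
  have "eventually (\<lambda>n. Z \<le> ?s n) sequentially" for Z
  proof -
    define y where "y = max Z m"
    have "finite {n. ?s n = y}"
    proof (rule ccontr)
      assume "infinite {n. ?s n = y}"
      then obtain A where A: "A \<subseteq> {n. ?s n = y}" "finite A" "card A = Suc (need a (Suc r) y)"
        using infinite_arbitrarily_large by blast
      then obtain n where "A \<subseteq> {..<n}" using finite_nat_iff_bounded by blast
      then have "card A \<le> card {q. q < n \<and> ?s q = y}" using A by (intro card_mono) auto
      then show False using cnt_le[of y n] A by (simp add: cnt_visits y_def)
    qed
    then obtain n0 where n0: "\<And>n. ?s n = y \<Longrightarrow> n < n0"
      using finite_nat_set_iff_bounded by auto
    obtain n1 where n1: "max (y + 1) (z + int n0) \<le> ?s n1" using unb by blast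
    have "n0 \<le> n1" using n1 nn_path_bound[OF nn_path_pos, of a c z 0 n1] by auto
    have "y \<le> ?s n" if "n \<ge> n1" for n
    proof (rule ccontr)
      assume "\<not> y \<le> ?s n"
      then have "\<exists>q\<ge>n1. q \<le> n \<and> ?s q = y"
        by (intro nn_path_hits_down[OF nn_path_pos]) (use n1 that in auto)
      then obtain q where "n1 \<le> q" "?s q = y" by blast
      then show False using n0[of q] \<open>n0 \<le> n1\<close> by auto
    qed
    then show ?thesis unfolding eventually_sequentially y_def by auto
  qed
  then show ?thesis by (simp add: filterlim_at_top)
qed

section \<open>Moving the starting point\<close>

text \<open>Consider the first moment at which the walker is about to exceed \<open>c\<close>, at a site \<open>x\<close>. Both counts agree
  at \<open>x\<close>, so comparing the fluxes across one of the two edges at \<open>x\<close> gives the walker strictly more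
  arrows than \<open>c\<close> at a neighbour: for \<open>x > z\<close> the right edge does, since fewer than \<open>R\<close> walkers have
  been lost on the right, and for \<open>x \<le> z\<close> the left edge if \<open>L' < L\<close>, and the right edge otherwise.\<close>

lemma cnt_le_of_flux:
  assumes le: "\<And>x. c0 x \<le> c x"
    and c: "\<And>y. int (rts a y (c y)) - int (lfs a (y + 1) (c (y + 1))) = (if z \<le> y then int R else - int L)"
    and c0: "\<And>y. int (rts a y (c0 y)) - int (lfs a (y + 1) (c0 (y + 1))) =
      (if z + 1 \<le> y then int R' else - int L')"
    and less: "R' < R"
  shows "cnt a c0 (z + 1) n x \<le> c x"
proof (induction n arbitrary: x)
  case 0
  then show ?case by (simp add: le)
next
  case (Suc n)
  let ?d = "cnt a c0 (z + 1) n" and ?p = "pos a c0 (z + 1) n"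
  have flux: "int (rts a y (?d y)) - int (lfs a (y + 1) (?d (y + 1))) =
      (if z + 1 \<le> y then int R' else - int L') + of_bool (y < ?p) - of_bool (y < z + 1)" for y
    using flux_walk[of a y c0 "z + 1" n] unfolding c0 .
  have "?d ?p < c ?p"
  proof (rule ccontr)
    assume "\<not> ?d ?p < c ?p"
    with Suc[of ?p] have eq: "?d ?p = c ?p" by simp
    have l: "lfs a (?p + 1) (?d (?p + 1)) \<le> lfs a (?p + 1) (c (?p + 1))" by (rule lfs_mono[OF Suc])
    have r: "rts a (?p - 1) (?d (?p - 1)) \<le> rts a (?p - 1) (c (?p - 1))" by (rule rts_mono[OF Suc])
    show False
      using flux[of ?p] c[of ?p] flux[of "?p - 1"] c[of "?p - 1"] l r less eq
      by (cases "z + 1 \<le> ?p"; cases "L' < L"; cases "?p = z") auto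
  qed
  then show ?case using Suc[of x] by (auto simp: cnt_Suc)
qed

text \<open>Moving the common starting point of the walkers one step to the right can only favour the right
  side: all counts of the walkers from \<open>z + 1\<close> do not exceed the final counts of those from \<open>z\<close>, so the
  \<open>k\<close>-th walker from \<open>z + 1\<close> is transient, and far on the left there is not enough consumption for one
  more walker to be lost there.\<close>

theorem right_walker_shift:
  assumes d0: "directed a z (Suc k) s" and sk: "s k" and d1: "directed a (z + 1) k s"
  shows "to_right (mob a (z + 1) k)"
proof -
  let ?c = "odo a z (Suc k)" and ?o = "odo a (z + 1)"
  have c: "int (rts a y (?c y)) - int (lfs a (y + 1) (?c (y + 1))) =
      (if z \<le> y then int (Suc (rights s k)) else - int (lefts s k))" for y
    using flux_odo[OF d0, of y] sk by (auto simp del: odo.simps)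
  have step: "cnt a (?o j) (z + 1) n x \<le> ?c x" if j: "j \<le> k" and le: "\<And>x. ?o j x \<le> ?c x" for j n x
  proof (rule cnt_le_of_flux[OF le c])
    have "directed a (z + 1) j s" using d1 j by (auto simp: directed_def)
    then show "int (rts a y (?o j y)) - int (lfs a (y + 1) (?o j (y + 1))) =
      (if z + 1 \<le> y then int (rights s j) else - int (lefts s j))" for y
      by (rule flux_odo)
    show "rights s j < Suc (rights s k)" using rights_mono[OF j, of s] by simp
  qed
  have le: "j \<le> k \<Longrightarrow> ?o j x \<le> ?c x" for j x
  proof (induction j arbitrary: x)
    case (Suc j)
    have "transient_path (pos a (?o j) (z + 1))"
      using directed_transient[OF d1, of j] Suc.prems by (simp add: mob_def)
    then have "eventually (\<lambda>n. cnt a (?o j) (z + 1) n x = ?o (Suc j) x) sequentially"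
      using transient_cnt_eventually by simp
    then obtain n where "cnt a (?o j) (z + 1) n x = ?o (Suc j) x"
      using eventually_happens'[OF sequentially_bot] by blast
    then show ?case using step[of j n x] Suc by (simp del: odo.simps)
  qed simp
  have cnt_le: "cnt a (?o k) (z + 1) n x \<le> ?c x" for n x by (rule step[OF order_refl le[OF order_refl]])
  have tr: "transient_path (mob a (z + 1) k)"
    unfolding mob_def by (rule transient_if_cnt_bounded[OF cnt_le])
  show ?thesis
  proof (rule ccontr)
    assume "\<not> ?thesis"
    then have bot: "to_left (mob a (z + 1) k)"
      using transient_path_cases[OF nn_path_mob tr] by blast
    define s' where "s' = s(k := False)"
    have d1': "directed a (z + 1) (Suc k) s'"
      using d1 bot directed_cong[of k s s' a "z + 1"] by (simp add: directed_Suc s'_def)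
    have lefts': "lefts s' (Suc k) = Suc (lefts s k)"
      using rights_cong[of k "\<lambda>j. \<not> s j" "\<lambda>j. \<not> s' j"] by (simp add: s'_def)
    have lefts: "lefts s (Suc k) = lefts s k" using sk by simp
    let ?b = "reflect_arrows a"
    have "directed ?b (- z) (Suc k) (\<lambda>j. \<not> s j)" "directed ?b (- (z + 1)) (Suc k) (\<lambda>j. \<not> s' j)"
      using d0 d1' unfolding directed_reflect by simp_all
    then obtain m m' where m: "frontier ?b (odo ?b (- z) (Suc k)) (- z) (lefts s k) m"
      and m': "frontier ?b (odo ?b (- (z + 1)) (Suc k)) (- (z + 1)) (Suc (lefts s k)) m'"
      using directed_odo_eq_need lefts lefts' by metis
    \<comment> \<open>Far to the left the odometer of the walkers from \<open>z + 1\<close> would carry more flux, hence be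
      larger; as it is also at most the other one, the two agree, and so do their fluxes.\<close>
    have eq: "?o (Suc k) (- x) = ?c (- x)" if "x \<ge> max m m'" for x
    proof (rule antisym)
      have "eventually (\<lambda>n. cnt a (?o k) (z + 1) n (- x) = ?o (Suc k) (- x)) sequentially"
        using transient_cnt_eventually[OF tr[unfolded mob_def]] by simp
      then obtain n where "cnt a (?o k) (z + 1) n (- x) = ?o (Suc k) (- x)"
        using eventually_happens'[OF sequentially_bot] by blast
      then show "?o (Suc k) (- x) \<le> ?c (- x)" using cnt_le[of n "- x"] by simp
      have "?c (- x) = need ?b (lefts s k) x"
        using m that unfolding frontier_def odo_reflect by auto
      also have "\<dots> \<le> need ?b (Suc (lefts s k)) x"
        using m' that by (intro need_mono(2)) (auto simp: frontier_def)
      also have "\<dots> = ?o (Suc k) (- x)"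
        using m' that unfolding frontier_def odo_reflect by auto
      finally show "?c (- x) \<le> ?o (Suc k) (- x)" .
    qed
    define y where "y = - (max (max m m') (max 0 (1 - z)) + 1)"
    have "max m m' \<le> - y" "max m m' \<le> - (y + 1)" "y < z" by (auto simp: y_def)
    then have "?o (Suc k) y = ?c y" "?o (Suc k) (y + 1) = ?c (y + 1)" "y < z"
      using eq[of "- y"] eq[of "- (y + 1)"] unfolding minus_minus by blast+
    then show False
      using flux_odo[OF d1', of y] c[of y] lefts' by (auto simp del: odo.simps rights.simps)
  qed
qed

text \<open>The mirror image of the previous theorem.\<close>

theorem left_walker_shift:
  assumes d0: "directed a (z + 1) (Suc k) s" and sk: "\<not> s k" and d1: "directed a z k s"
  shows "to_left (mob a z k)"
proof -
  let ?b = "reflect_arrows a"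
  have "to_right (mob ?b (- (z + 1) + 1) k)"
  proof (rule right_walker_shift)
    show "directed ?b (- (z + 1)) (Suc k) (\<lambda>j. \<not> s j)" unfolding directed_reflect using d0 by simp
    have "directed ?b (- z) k (\<lambda>j. \<not> s j)" unfolding directed_reflect using d1 by simp
    then show "directed ?b (- (z + 1) + 1) k (\<lambda>j. \<not> s j)" by simp
  qed (use sk in simp)
  then have "to_right (mob ?b (- z) k)" by simp
  then show ?thesis unfolding mob_reflect by (simp add: filterlim_int_uminus)
qed

section \<open>Speed of a path from its hitting times\<close>

abbreviation has_speed :: "(nat \<Rightarrow> int) \<Rightarrow> real \<Rightarrow> bool" (infix "has'_speed" 50) where
  "s has_speed v \<equiv> (\<lambda>n. real_of_int (s n) / real n) \<longlonglongrightarrow> v"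

abbreviation slow_right :: "(nat \<Rightarrow> int) \<Rightarrow> bool" where
  "slow_right s \<equiv> \<forall>e>0. eventually (\<lambda>n. real_of_int (s n) \<le> e * real n) sequentially"

abbreviation slow_left :: "(nat \<Rightarrow> int) \<Rightarrow> bool" where
  "slow_left s \<equiv> \<forall>e>0. eventually (\<lambda>n. - e * real n \<le> real_of_int (s n)) sequentially"

text \<open>At time \<open>n\<close> the maximum so far is the number \<open>m n\<close> with \<open>T (m n) \<le> n < T (m n + 1)\<close>. Since \<open>T N / N\<close>
  converges to a finite limit, successive hitting times differ by \<open>o(N)\<close>, and the path cannot have
  retreated from its maximum by more than such a difference.\<close>

lemma speed_of_hitting_times:
  fixes s :: "nat \<Rightarrow> int" and V :: real
  assumes nn: "nn_path s" and s0: "s 0 = 0" and top: "to_right s"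
    and T: "\<And>N. s (T N) = int N" "\<And>N t. t < T N \<Longrightarrow> s t < int N"
    and lim: "(\<lambda>N. real (T N) / real N) \<longlonglongrightarrow> V"
  shows "s has_speed 1 / V"
proof -
  have T_mono: "T N < T (Suc N)" for N
  proof (rule ccontr)
    assume "\<not> T N < T (Suc N)"
    then have "T (Suc N) < T N \<or> T (Suc N) = T N" by auto
    then show False using T(1)[of N] T(1)[of "Suc N"] T(2)[of "T (Suc N)" N] by auto
  qed
  have T_ge: "N \<le> T N" for N
    using nn_path_bound[OF nn, of 0 "T N"] T(1)[of N] s0 by auto
  have T0: "T 0 = 0" using T(2)[of 0 0] s0 by (cases "T 0") auto
  define m where "m n = (GREATEST N. T N \<le> n)" for n
  have m: "T (m n) \<le> n" "n < T (Suc (m n))" for n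
  proof -
    have *: "T N \<le> n \<Longrightarrow> N \<le> n" for N using T_ge[of N] by simp
    show "T (m n) \<le> n" unfolding m_def
      by (rule GreatestI_nat[of "\<lambda>N. T N \<le> n" 0 n]) (use * T0 in auto)
    have "\<not> T (Suc (m n)) \<le> n"
    proof
      assume "T (Suc (m n)) \<le> n"
      then have "Suc (m n) \<le> m n" unfolding m_def
        by (rule Greatest_le_nat[of "\<lambda>N. T N \<le> n" _ n]) (use * in auto)
      then show False by simp
    qed
    then show "n < T (Suc (m n))" by simp
  qed
  have m_top: "filterlim m at_top sequentially"
    unfolding filterlim_at_top
  proof
    fix Z
    have "Z \<le> m n" if "T Z \<le> n" for n
      unfolding m_def by (rule Greatest_le_nat[of "\<lambda>N. T N \<le> n" _ n]) (use that T_ge order_trans in blast)+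
    then show "eventually (\<lambda>n. Z \<le> m n) sequentially" unfolding eventually_sequentially by blast
  qed
  have V1: "1 \<le> V"
  proof (rule LIMSEQ_le_const[OF lim])
    have "1 \<le> real (T N) / real N" if "N \<ge> 1" for N
      using T_ge[of N] that by (simp add: field_simps)
    then show "\<exists>N. \<forall>n\<ge>N. 1 \<le> real (T n) / real n" by blast
  qed
  have limS: "(\<lambda>N. real (T (Suc N)) / real N) \<longlonglongrightarrow> V"
  proof -
    have "(\<lambda>N. real (T (Suc N)) / real (Suc N) * (real (Suc N) / real N)) \<longlonglongrightarrow> V * 1"
      by (intro tendsto_mult LIMSEQ_Suc[OF lim] LIMSEQ_Suc_n_over_n)
    moreover have "eventually (\<lambda>N. real (T (Suc N)) / real (Suc N) * (real (Suc N) / real N) = real (T (Suc N)) / real N) sequentially"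
      using eventually_gt_at_top[of 0] by eventually_elim auto
    ultimately show ?thesis by (simp add: filterlim_cong[OF refl refl])
  qed
  have m_pos: "eventually (\<lambda>n. m n > 0) sequentially"
    using eventually_compose_filterlim[OF eventually_gt_at_top[of 0] m_top] .
  have L1: "(\<lambda>n. real (T (m n)) / real (m n)) \<longlonglongrightarrow> V"
    and L2: "(\<lambda>n. real (T (Suc (m n))) / real (m n)) \<longlonglongrightarrow> V"
    using filterlim_compose[OF lim m_top] filterlim_compose[OF limS m_top] by simp_all
  have nm: "(\<lambda>n. real n / real (m n)) \<longlonglongrightarrow> V"
  proof (rule tendsto_sandwich[OF _ _ L1 L2])
    show "eventually (\<lambda>n. real (T (m n)) / real (m n) \<le> real n / real (m n)) sequentially"
      using m(1) by (intro always_eventually) (auto intro!: divide_right_mono)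
    show "eventually (\<lambda>n. real n / real (m n) \<le> real (T (Suc (m n))) / real (m n)) sequentially"
      using m(2) by (intro always_eventually allI divide_right_mono) (simp_all add: less_imp_le)
  qed
  have close: "\<bar>real_of_int (s n) - real (m n)\<bar> \<le> real (T (Suc (m n))) - real (T (m n))" for n
  proof -
    have "\<bar>s (T (m n) + (n - T (m n))) - s (T (m n))\<bar> \<le> int (n - T (m n))"
      by (rule nn_path_bound[OF nn])
    then have "\<bar>s n - int (m n)\<bar> \<le> int (n - T (m n))" using m(1)[of n] T(1)[of "m n"] by simp
    also have "\<dots> \<le> int (T (Suc (m n))) - int (T (m n))" using m[of n] by simp
    finally have "real_of_int \<bar>s n - int (m n)\<bar> \<le> real_of_int (int (T (Suc (m n))) - int (T (m n)))"
      by (simp only: of_int_le_iff)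
    then show ?thesis by simp
  qed
  have "(\<lambda>n. real_of_int (s n) / real (m n) - 1) \<longlonglongrightarrow> 0"
  proof (rule Lim_null_comparison)
    show "(\<lambda>n. real (T (Suc (m n))) / real (m n) - real (T (m n)) / real (m n)) \<longlonglongrightarrow> 0"
      using tendsto_diff[OF L2 L1] by simp
    show "eventually (\<lambda>n. norm (real_of_int (s n) / real (m n) - 1) \<le>
        real (T (Suc (m n))) / real (m n) - real (T (m n)) / real (m n)) sequentially"
      using m_pos
    proof eventually_elim
      case (elim n)
      have "real_of_int (s n) / real (m n) - 1 = (real_of_int (s n) - real (m n)) / real (m n)"
        using elim by (simp add: field_simps)
      then have "norm (real_of_int (s n) / real (m n) - 1) = \<bar>real_of_int (s n) - real (m n)\<bar> / real (m n)"
        by (simp add: abs_divide)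
      also have "\<dots> \<le> (real (T (Suc (m n))) - real (T (m n))) / real (m n)"
        using close[of n] by (rule divide_right_mono) simp
      finally show ?case by (simp add: diff_divide_distrib)
    qed
  qed
  then have sm: "(\<lambda>n. real_of_int (s n) / real (m n)) \<longlonglongrightarrow> 1"
    using tendsto_add[of _ 0 sequentially "\<lambda>_. 1" 1] by fastforce
  have "(\<lambda>n. (real_of_int (s n) / real (m n)) / (real n / real (m n))) \<longlonglongrightarrow> 1 / V"
    using V1 by (intro tendsto_divide sm nm) auto
  moreover have "eventually (\<lambda>n. (real_of_int (s n) / real (m n)) / (real n / real (m n)) = real_of_int (s n) / real n) sequentially"
    using m_pos by eventually_elim auto
  ultimately show ?thesis by (rule Lim_transform_eventually)
qed

section \<open>Time spent in front of the starting point\<close>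

text \<open>This is \<open>need a (Suc r) 0 - need a r 0\<close>, computed in a window of size \<open>K\<close> and cut off at \<open>K\<close>: a bounded
  approximation from below that makes sense even if the difference is infinite.\<close>

definition excess :: "nat \<Rightarrow> nat \<Rightarrow> arrows \<Rightarrow> nat" where
  "excess r K a = card {i. i < K \<and> \<not> suffices a (Suc r) K 0 (need a r 0 + i)}"

lemma excess_le: "excess r K a \<le> K"
  unfolding excess_def using card_mono[of "{..<K}" "{i. i < K \<and> \<not> suffices a (Suc r) K 0 (need a r 0 + i)}"] by auto

lemma excess_mono: "excess r K a \<le> excess r (Suc K) a"
  unfolding excess_def by (intro card_mono) (auto simp del: suffices.simps dest: suffices_Suc)

lemma excess_shift:
  "excess r K ((translate ^^ d) a) = card {i. i < K \<and> \<not> suffices a (Suc r) K (int d) (need a r (int d) + i)}"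
  unfolding excess_def suffices_shift need_shift by simp

lemma finite_need_if_excess_bounded:
  assumes "\<And>K. excess r K a \<le> b"
  shows "finite_need a (Suc r) 0"
proof (rule finite_needI)
  fix K
  let ?K = "max K (Suc b)"
  have "suffices a (Suc r) ?K 0 (need a r 0 + b)"
  proof (rule ccontr)
    assume "\<not> suffices a (Suc r) ?K 0 (need a r 0 + b)"
    then have "{..b} \<subseteq> {i. i < ?K \<and> \<not> suffices a (Suc r) ?K 0 (need a r 0 + i)}"
      using suffices_up[of a "Suc r" ?K 0] by (auto simp del: suffices.simps simp: less_max_iff_disj)
    then have "card {..b} \<le> excess r ?K a" unfolding excess_def by (intro card_mono) auto
    then show False using assms[of ?K] by simp
  qed
  then show "suffices a (Suc r) K 0 (need a r 0 + b)" by (rule suffices_window) simp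
qed

lemma excess_eventually:
  assumes fin: "finite_need a (Suc r) 0"
  shows "eventually (\<lambda>K. excess r K a = need a (Suc r) 0 - need a r 0) sequentially"
proof -
  let ?b = "need a (Suc r) 0"
  have "\<exists>K. \<not> suffices a (Suc r) K 0 (?b - 1)" if "0 < ?b"
    using need_le[of a "Suc r" 0 "?b - 1"] that by fastforce
  then obtain K0 where K0: "0 < ?b \<longrightarrow> \<not> suffices a (Suc r) K0 0 (?b - 1)" by (cases "0 < ?b") auto
  have "excess r K a = ?b - need a r 0" if K: "K \<ge> max K0 ?b" for K
  proof -
    have "{i. i < K \<and> \<not> suffices a (Suc r) K 0 (need a r 0 + i)} = {..< ?b - need a r 0}"
    proof (intro set_eqI iffI)
      fix i assume "i \<in> {i. i < K \<and> \<not> suffices a (Suc r) K 0 (need a r 0 + i)}"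
      then have "\<not> ?b \<le> need a r 0 + i" using suffices_up[OF need_suffices[OF fin]] by auto
      then show "i \<in> {..< ?b - need a r 0}" by auto
    next
      fix i assume "i \<in> {..< ?b - need a r 0}"
      then have i: "need a r 0 + i \<le> ?b - 1" "0 < ?b" "i < K" using K by auto
      then have "\<not> suffices a (Suc r) K 0 (need a r 0 + i)"
        using K0 suffices_up[of a "Suc r" K 0 "need a r 0 + i" "?b - 1"] suffices_window[of a "Suc r" K 0 "?b - 1" K0] K by auto
      then show "i \<in> {i. i < K \<and> \<not> suffices a (Suc r) K 0 (need a r 0 + i)}" using i by auto
    qed
    then show ?thesis unfolding excess_def by simp
  qed
  then show ?thesis unfolding eventually_sequentially by blast
qed

lemma sum_visits:
  assumes "finite F"
  shows "(\<Sum>x\<in>F. cnt a c z n x - c x) = card {t. t < n \<and> pos a c z t \<in> F}"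
proof -
  have "{t. t < n \<and> pos a c z t \<in> F} = (\<Union>x\<in>F. {t. t < n \<and> pos a c z t = x})" by auto
  also have "card \<dots> = (\<Sum>x\<in>F. card {t. t < n \<and> pos a c z t = x})"
    using assms by (intro card_UN_disjoint) auto
  finally show ?thesis by (simp add: cnt_visits)
qed

text \<open>The time is at least the number of visits of the sites in \<open>[m, N - K)\<close>, and each of them has been
  visited at least \<open>excess\<close> times, because its count suffices in a window that does not reach beyond \<open>N\<close>.\<close>

lemma hitting_time_lower:
  assumes F: "frontier a c 0 r (int m)" and n: "pos a c 0 n = int N"
  shows "(\<Sum>x=m..<N - K. excess r K ((translate ^^ x) a)) \<le> n"
proof -
  have "excess r K ((translate ^^ x) a) \<le> cnt a c 0 n (int x) - c (int x)" if x: "x \<in> {m..<N - K}" for x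
  proof -
    have "suffices a (Suc r) K (int x) (cnt a c 0 n (int x))"
      using x n by (intro frontier_lower[OF F]) auto
    moreover have "c (int x) = need a r (int x)" using frontierD(2)[OF F] x by auto
    ultimately have "{i. i < K \<and> \<not> suffices a (Suc r) K (int x) (need a r (int x) + i)} \<subseteq> {..< cnt a c 0 n (int x) - c (int x)}"
      using suffices_up by (fastforce simp: not_le[symmetric])
    then have "card {i. i < K \<and> \<not> suffices a (Suc r) K (int x) (need a r (int x) + i)} \<le> card {..< cnt a c 0 n (int x) - c (int x)}"
      by (intro card_mono) auto
    then show ?thesis by (simp add: excess_shift)
  qed
  then have "(\<Sum>x=m..<N - K. excess r K ((translate ^^ x) a)) \<le> (\<Sum>x=m..<N - K. cnt a c 0 n (int x) - c (int x))"
    by (rule sum_mono)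
  also have "\<dots> = (\<Sum>x\<in>int ` {m..<N - K}. cnt a c 0 n x - c x)"
    by (simp add: sum.reindex)
  also have "\<dots> \<le> card {..<n}" unfolding sum_visits[OF finite_imageI[OF finite_atLeastLessThan]]
    by (intro card_mono) auto
  finally show ?thesis by simp
qed

text \<open>The time is the number of visits of all sites below \<open>N\<close>; those below \<open>m\<close> contribute at most a constant.\<close>

lemma hitting_time_upper:
  assumes F: "frontier a c 0 r (int m)" and n: "pos a c 0 n = int N" "\<And>t. t < n \<Longrightarrow> pos a c 0 t < int N"
    and fin: "\<And>x. int m \<le> x \<Longrightarrow> finite_need a (Suc r) x" and left: "finite {t. pos a c 0 t < int m}"
  shows "n \<le> card {t. pos a c 0 t < int m} + (\<Sum>x<N. need a (Suc r) (int x) - need a r (int x))"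
proof -
  let ?s = "pos a c 0"
  have "{..<n} \<subseteq> {t. ?s t < int m} \<union> {t. t < n \<and> ?s t \<in> int ` {m..<N}}"
  proof
    fix t assume "t \<in> {..<n}"
    then have "?s t < int N" "t < n" using n(2) by auto
    then show "t \<in> {t. ?s t < int m} \<union> {t. t < n \<and> ?s t \<in> int ` {m..<N}}"
      by (cases "?s t < int m") (auto intro!: image_eqI[of _ _ "nat (?s t)"])
  qed
  then have "n \<le> card ({t. ?s t < int m} \<union> {t. t < n \<and> ?s t \<in> int ` {m..<N}})"
    using left card_mono[of "{t. ?s t < int m} \<union> {t. t < n \<and> ?s t \<in> int ` {m..<N}}" "{..<n}"] by auto
  also have "\<dots> \<le> card {t. ?s t < int m} + card {t. t < n \<and> ?s t \<in> int ` {m..<N}}"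
    by (rule card_Un_le)
  also have "card {t. t < n \<and> ?s t \<in> int ` {m..<N}} = (\<Sum>x=m..<N. cnt a c 0 n (int x) - c (int x))"
    by (subst sum_visits[symmetric]) (auto simp: sum.reindex)
  also have "\<dots> \<le> (\<Sum>x=m..<N. need a (Suc r) (int x) - need a r (int x))"
  proof (rule sum_mono)
    fix x assume x: "x \<in> {m..<N}"
    have "cnt a c 0 n (int x) \<le> need a (Suc r) (int x)"
    proof (rule frontier_upper[OF F fin])
      show "?s t \<noteq> ?s n" if "t < n" for t using n(2)[OF that] n(1) by auto
    qed (use x n in auto)
    moreover have "c (int x) = need a r (int x)" using frontierD(2)[OF F] x by auto
    ultimately show "cnt a c 0 n (int x) - c (int x) \<le> need a (Suc r) (int x) - need a r (int x)" by simp
  qed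
  also have "\<dots> \<le> (\<Sum>x<N. need a (Suc r) (int x) - need a r (int x))"
    by (intro sum_mono2) auto
  finally show ?thesis by simp
qed

section \<open>Random arrows\<close>

definition arrow_space :: "arrows measure" where
  "arrow_space = Pi\<^sub>M UNIV (\<lambda>_. count_space UNIV)"

lemma space_arrow_space [simp]: "space arrow_space = UNIV"
  by (simp add: arrow_space_def space_PiM)

lemma measurable_arrow [measurable]: "(\<lambda>a. a e) \<in> arrow_space \<rightarrow>\<^sub>M count_space UNIV"
  unfolding arrow_space_def by (rule measurable_component_singleton) simp

lemma measurable_into_arrow_space:
  assumes "\<And>e. (\<lambda>x. f x e) \<in> M \<rightarrow>\<^sub>M count_space UNIV"
  shows "f \<in> M \<rightarrow>\<^sub>M arrow_space"
  unfolding arrow_space_def by (rule measurable_PiM_single') (use assms in auto)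

lemma measurable_translate [measurable]: "translate \<in> arrow_space \<rightarrow>\<^sub>M arrow_space"
  by (rule measurable_into_arrow_space) (auto simp: translate_def split_def)

lemma measurable_reflect_arrows [measurable]: "reflect_arrows \<in> arrow_space \<rightarrow>\<^sub>M arrow_space"
  by (rule measurable_into_arrow_space) (auto simp: reflect_arrows_def split_def)

lemma measurable_rts [measurable]: "(\<lambda>a. rts a x n) \<in> arrow_space \<rightarrow>\<^sub>M count_space UNIV"
  by (induction n) simp_all

lemma measurable_lfs [measurable]: "(\<lambda>a. lfs a x n) \<in> arrow_space \<rightarrow>\<^sub>M count_space UNIV"
  by (induction n) simp_all

lemma measurable_walk:
  assumes [measurable]: "\<And>x. (\<lambda>a. c a x) \<in> arrow_space \<rightarrow>\<^sub>M count_space UNIV"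
  shows "(\<lambda>a. pos a (c a) z n) \<in> arrow_space \<rightarrow>\<^sub>M count_space UNIV \<and>
    (\<forall>x. (\<lambda>a. cnt a (c a) z n x) \<in> arrow_space \<rightarrow>\<^sub>M count_space UNIV)"
proof (induction n)
  case (Suc n)
  then have [measurable]: "(\<lambda>a. pos a (c a) z n) \<in> arrow_space \<rightarrow>\<^sub>M count_space UNIV"
    "\<And>x. (\<lambda>a. cnt a (c a) z n x) \<in> arrow_space \<rightarrow>\<^sub>M count_space UNIV" by auto
  have 1: "(\<lambda>a. a (x, cnt a (c a) z n x)) \<in> arrow_space \<rightarrow>\<^sub>M count_space UNIV" for x
    by (rule measurable_compose_countable[where f="\<lambda>i a. a (x, i)"]) measurable
  have [measurable]: "(\<lambda>a. cnt a (c a) z n (pos a (c a) z n)) \<in> arrow_space \<rightarrow>\<^sub>M count_space UNIV"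
    by (rule measurable_compose_countable[where f="\<lambda>x a. cnt a (c a) z n x"]) measurable
  have [measurable]: "(\<lambda>a. a (pos a (c a) z n, cnt a (c a) z n (pos a (c a) z n))) \<in> arrow_space \<rightarrow>\<^sub>M count_space UNIV"
    by (rule measurable_compose_countable[where f="\<lambda>x a. a (x, cnt a (c a) z n x)", OF 1]) measurable
  show ?case unfolding pos_Suc cnt_Suc fun_upd_def by measurable
qed simp

lemma measurable_odo [measurable]: "(\<lambda>a. odo a z j x) \<in> arrow_space \<rightarrow>\<^sub>M count_space UNIV"
proof (induction j arbitrary: x)
  case (Suc j)
  note [measurable] = Suc measurable_walk[OF Suc, THEN conjunct1]
  show ?case by simp
qed simp

lemma measurable_mob [measurable]: "(\<lambda>a. mob a z j n) \<in> arrow_space \<rightarrow>\<^sub>M count_space UNIV"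
  and measurable_mob_cnt [measurable]: "(\<lambda>a. cnt a (odo a z j) z n x) \<in> arrow_space \<rightarrow>\<^sub>M count_space UNIV"
  unfolding mob_def using measurable_walk[OF measurable_odo] by auto

lemma measurable_mob_top [measurable]: "Measurable.pred arrow_space (\<lambda>a. to_right (mob a z j))"
  unfolding filterlim_at_top eventually_sequentially by measurable

lemma measurable_mob_bot [measurable]: "Measurable.pred arrow_space (\<lambda>a. to_left (mob a z j))"
  unfolding filterlim_at_bot eventually_sequentially by measurable

lemma measurable_directed [measurable]: "Measurable.pred arrow_space (\<lambda>a. directed a z k s)"
proof -
  have "directed a z k s \<longleftrightarrow> (\<forall>j. j < k \<longrightarrow> (if s j then to_right (mob a z j)
      else to_left (mob a z j)))" for a
    by (auto simp: directed_def)
  then show ?thesis by simp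
qed

lemma transient_mob_iff:
  "transient_path (mob a z j) \<longleftrightarrow>
    to_right (mob a z j) \<or> to_left (mob a z j)"
  using transient_path_cases[OF nn_path_mob] transient_pathI_top transient_pathI_bot by blast

lemma measurable_transient_mob [measurable]: "Measurable.pred arrow_space (\<lambda>a. transient_path (mob a z j))"
  unfolding transient_mob_iff by measurable

lemma measurable_suffices [measurable]: "Measurable.pred arrow_space (\<lambda>a. suffices a r K x n)"
  by (induction K arbitrary: x n) simp_all

lemma measurable_need [measurable]: "(\<lambda>a. need a r x) \<in> arrow_space \<rightarrow>\<^sub>M count_space UNIV"
  unfolding need_def by measurable

lemma measurable_finite_need [measurable]: "Measurable.pred arrow_space (\<lambda>a. finite_need a r x)"
  unfolding finite_need_def by measurable

lemma measurable_excess [measurable]: "(\<lambda>a. excess r K a) \<in> arrow_space \<rightarrow>\<^sub>M count_space UNIV"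
proof -
  have "Measurable.pred arrow_space (\<lambda>a. suffices a (Suc r) K 0 (need a r 0 + i))" for i
    by (rule measurable_compose_countable[where f="\<lambda>n a. suffices a (Suc r) K 0 (n + i)" and g="\<lambda>a. need a r 0"]) measurable
  then show ?thesis unfolding excess_def by measurable
qed

text \<open>Leaving out boundedly many terms at both ends does not affect the averages.\<close>

lemma window_average:
  fixes f :: "nat \<Rightarrow> real"
  assumes lim: "(\<lambda>N. (\<Sum>x<N. f x) / real N) \<longlonglongrightarrow> v"
  shows "(\<lambda>N. (\<Sum>x=m..<N - K. f x) / real N) \<longlonglongrightarrow> v"
proof (rule LIMSEQ_offset[of _ K])
  have "(\<lambda>N. ((\<Sum>x<N. f x) / real N - (\<Sum>x<m. f x) / real N) * (real N / real (N + K))) \<longlonglongrightarrow> (v - 0) * 1"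
  proof (intro tendsto_mult tendsto_diff lim lim_const_over_n)
    have "(\<lambda>N. 1 / (1 + real K / real N)) \<longlonglongrightarrow> 1 / (1 + 0)"
      by (intro tendsto_divide tendsto_add tendsto_const lim_const_over_n) auto
    moreover have "eventually (\<lambda>N. 1 / (1 + real K / real N) = real N / real (N + K)) sequentially"
      using eventually_gt_at_top[of 0] by eventually_elim (simp add: field_simps)
    ultimately show "(\<lambda>N. real N / real (N + K)) \<longlonglongrightarrow> 1"
      using Lim_transform_eventually by fastforce
  qed
  moreover have "eventually (\<lambda>N. ((\<Sum>x<N. f x) / real N - (\<Sum>x<m. f x) / real N) * (real N / real (N + K)) =
      (\<Sum>x=m..<N + K - K. f x) / real (N + K)) sequentially"
    using eventually_ge_at_top[of "Suc m"]
  proof eventually_elim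
    case (elim N)
    have "(\<Sum>x<N. f x) = (\<Sum>x<m. f x) + (\<Sum>x=m..<N. f x)"
      using elim by (simp add: lessThan_atLeast0 sum.atLeastLessThan_concat)
    then have "(\<Sum>x<N. f x) / real N - (\<Sum>x<m. f x) / real N = (\<Sum>x=m..<N. f x) / real N"
      by (simp add: diff_divide_distrib[symmetric])
    then show ?case using elim by simp
  qed
  ultimately show "(\<lambda>N. (\<Sum>x=m..<N + K - K. f x) / real (N + K)) \<longlonglongrightarrow> v"
    using Lim_transform_eventually by fastforce
qed

locale arrow_law = ergodic_system \<mu> translate for \<mu> :: "arrows measure" +
  assumes sets_law [measurable_cong]: "sets \<mu> = sets arrow_space"
begin

lemma space_law [simp]: "space \<mu> = UNIV"
  using sets_eq_imp_space_eq[OF sets_law] by simp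

lemma arrow_law_reflect: "arrow_law (distr \<mu> arrow_space reflect_arrows)"
proof -
  interpret R: prob_space "distr \<mu> arrow_space reflect_arrows"
    by (rule prob_space_distr) measurable
  \<comment> \<open>Reflection conjugates the shift to its inverse.\<close>
  have conj: "translate (reflect_arrows (translate a)) = reflect_arrows a" for a
    by (auto simp: translate_def reflect_arrows_def fun_eq_iff)
  show ?thesis
  proof
    let ?D = "distr \<mu> arrow_space reflect_arrows"
    show "translate \<in> ?D \<rightarrow>\<^sub>M ?D" by measurable
    have "distr ?D arrow_space translate = distr \<mu> arrow_space (\<lambda>a. translate (reflect_arrows a))"
      by (subst distr_distr) (auto simp: o_def)
    also have "\<dots> = distr (distr \<mu> \<mu> translate) arrow_space (\<lambda>a. translate (reflect_arrows a))"
      by (simp add: distr_T)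
    also have "\<dots> = distr \<mu> arrow_space (\<lambda>a. translate (reflect_arrows (translate a)))"
      by (subst distr_distr) (auto simp: o_def)
    also have "\<dots> = ?D" by (simp add: conj)
    finally show "distr ?D ?D translate = ?D" by (simp cong: distr_cong)
    show "sets ?D = sets arrow_space" by simp
    fix A assume "A \<in> sets ?D" "translate -` A \<inter> space ?D = A"
    then have A [measurable]: "A \<in> sets arrow_space" and inv: "translate a \<in> A \<longleftrightarrow> a \<in> A" for a
      by auto
    have "measure \<mu> (reflect_arrows -` A) = 0 \<or> measure \<mu> (reflect_arrows -` A) = 1"
    proof (rule ergodic)
      show "reflect_arrows -` A \<in> sets \<mu>"
        using measurable_sets[of reflect_arrows \<mu> arrow_space A] by simp
      show "translate -` reflect_arrows -` A \<inter> space \<mu> = reflect_arrows -` A"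
        using conj inv by (auto; metis)
    qed
    then show "measure ?D A = 0 \<or> measure ?D A = 1" by (simp add: measure_distr)
  qed
qed

lemma integrable_excess: "integrable \<mu> (\<lambda>a. real (excess r K a))"
proof (rule integrable_const_bound[where B="real K"])
  show "AE a in \<mu>. norm (real (excess r K a)) \<le> real K" by (simp add: excess_le)
qed measurable

text \<open>The mean of \<open>excess\<close> bounds the inverse speed from below, however large the window is.\<close>

lemma right_speed_infinite:
  assumes dir: "AE a in \<mu>. directed a 0 k s"
    and unb: "\<And>B. \<exists>K. B < (\<integral>a. real (excess (rights s k) K a) \<partial>\<mu>)"
  shows "AE a in \<mu>. slow_right (mob a 0 k)"
proof -
  let ?r = "rights s k"
  define v where "v K = (\<integral>a. real (excess ?r K a) \<partial>\<mu>)" for K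
  have "AE a in \<mu>. \<forall>K. (\<lambda>N. (\<Sum>x<N. real (excess ?r K ((translate ^^ x) a))) / real N) \<longlonglongrightarrow> v K"
    unfolding AE_all_countable v_def by (intro allI birkhoff integrable_excess)
  with dir show ?thesis
  proof eventually_elim
    case (elim a)
    obtain m0 where "frontier a (odo a 0 k) 0 ?r m0" using directed_odo_eq_need[OF elim(1)] by blast
    moreover have "0 \<le> m0" using calculation by (simp add: frontier_def)
    ultimately obtain m where m: "frontier a (odo a 0 k) 0 ?r (int m)" using nonneg_int_cases by metis
    show ?case
    proof (intro allI impI)
      fix e :: real assume e: "e > 0"
      obtain K where K: "1 / e < v K" using unb unfolding v_def by blast
      have "eventually (\<lambda>N. 1 / e < (\<Sum>x=m..<N - K. real (excess ?r K ((translate ^^ x) a))) / real N) sequentially"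
        using window_average[OF elim(2)[rule_format, of K], of m K] K by (rule order_tendstoD)
      then obtain N0 where N0: "\<And>N. N \<ge> N0 \<Longrightarrow> 1 / e < (\<Sum>x=m..<N - K. real (excess ?r K ((translate ^^ x) a))) / real N"
        unfolding eventually_sequentially by blast
      have "real_of_int (mob a 0 k n) \<le> e * real n" if n: "n \<ge> nat \<lceil>real (Suc N0) / e\<rceil>" for n
      proof (cases "mob a 0 k n \<le> int (Suc N0)")
        case True
        then have "real_of_int (mob a 0 k n) \<le> real (Suc N0)" by linarith
        also have "real (Suc N0) / e \<le> real n" using n by linarith
        then have "real (Suc N0) \<le> e * real n" using e by (simp add: field_simps)
        finally show ?thesis .
      next
        case False
        define N where "N = nat (mob a 0 k n)"
        have N: "mob a 0 k n = int N" "N \<ge> N0" "N > 0" using False by (auto simp: N_def)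
        have "(\<Sum>x=m..<N - K. excess ?r K ((translate ^^ x) a)) \<le> n"
          using hitting_time_lower[OF m] N(1) by (simp add: mob_def)
        then have "(\<Sum>x=m..<N - K. real (excess ?r K ((translate ^^ x) a))) \<le> real n"
          by (simp only: of_nat_sum[symmetric] of_nat_le_iff)
        then have "(\<Sum>x=m..<N - K. real (excess ?r K ((translate ^^ x) a))) / real N \<le> real n / real N"
          by (rule divide_right_mono) simp
        then have "1 / e < real n / real N" using N0[OF N(2)] by linarith
        then show ?thesis using N e by (simp add: field_simps)
      qed
      then show "eventually (\<lambda>n. real_of_int (mob a 0 k n) \<le> e * real n) sequentially"
        unfolding eventually_sequentially by blast
    qed
  qed
qed

text \<open>If the means of \<open>excess\<close> are bounded, then by monotone convergence \<open>need\<close> is finite and the increments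
  \<open>G\<close> are integrable with mean \<open>V\<close>; the ergodic averages of \<open>excess\<close> and \<open>G\<close> enclose \<open>T N / N\<close>. A walker
  that is unbounded on the right then has to go off to the right.\<close>

lemma right_speed_finite:
  assumes dir: "AE a in \<mu>. directed a 0 k s"
    and bdd: "\<And>K. (\<integral>a. real (excess (rights s k) K a) \<partial>\<mu>) \<le> B"
  shows "\<exists>V. AE a in \<mu>. if to_right (mob a 0 k)
      then mob a 0 k has_speed 1 / V
      else slow_right (mob a 0 k)"
proof -
  let ?r = "rights s k"
  define v where "v K = (\<integral>a. real (excess ?r K a) \<partial>\<mu>)" for K
  have v_mono: "v K \<le> v (Suc K)" for K
    unfolding v_def using excess_mono by (intro integral_mono integrable_excess) simp
  have e_mono: "incseq (\<lambda>K. excess ?r K a)" for a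
    using excess_mono by (rule incseq_SucI)
  have fin0: "AE a in \<mu>. finite_need a (Suc ?r) 0"
  proof -
    have "(\<integral>\<^sup>+a. (SUP K. ennreal (real (excess ?r K a))) \<partial>\<mu>) = (SUP K. \<integral>\<^sup>+a. ennreal (real (excess ?r K a)) \<partial>\<mu>)"
      using excess_mono by (intro nn_integral_monotone_convergence_SUP) (auto simp: incseq_Suc_iff le_fun_def)
    also have "\<dots> = (SUP K. ennreal (v K))"
      unfolding v_def by (intro SUP_cong refl nn_integral_eq_integral integrable_excess) auto
    also have "\<dots> \<le> ennreal B" using bdd by (intro SUP_least ennreal_leI) (simp add: v_def)
    also have "\<dots> < \<infinity>" by simp
    finally have "AE a in \<mu>. (SUP K. ennreal (real (excess ?r K a))) \<noteq> \<infinity>"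
      by (intro nn_integral_PInf_AE) auto
    then show ?thesis
    proof eventually_elim
      case (elim a)
      then obtain q where q: "q \<ge> 0" "(SUP K. ennreal (real (excess ?r K a))) = ennreal q"
        by (cases "SUP K. ennreal (real (excess ?r K a))") auto
      have "excess ?r K a \<le> nat \<lceil>q\<rceil>" for K
      proof -
        have "ennreal (real (excess ?r K a)) \<le> ennreal q"
          unfolding q(2)[symmetric] by (rule SUP_upper) simp
        then have "real (excess ?r K a) \<le> q" using q(1) by simp
        then show ?thesis by linarith
      qed
      then show ?case by (rule finite_need_if_excess_bounded)
    qed
  qed
  have fin: "AE a in \<mu>. \<forall>d. finite_need a (Suc ?r) (int d)"
    using AE_T_iter_all[OF fin0] by (simp add: finite_need_shift)
  define G where "G a = real (need a (Suc ?r) 0 - need a ?r 0)" for a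
  have [measurable]: "G \<in> borel_measurable \<mu>" unfolding G_def by measurable
  have G_lim: "AE a in \<mu>. (\<lambda>K. real (excess ?r K a)) \<longlonglongrightarrow> G a"
    using fin0
  proof eventually_elim
    case (elim a)
    then have "eventually (\<lambda>K. real (excess ?r K a) = G a) sequentially"
      using excess_eventually[OF elim] unfolding G_def by (auto elim: eventually_mono)
    then show ?case by (rule tendsto_eventually)
  qed
  have v_conv: "v \<longlonglongrightarrow> (SUP K. v K)"
  proof (rule LIMSEQ_incseq_SUP)
    show "bdd_above (range v)" using bdd unfolding v_def by (intro bdd_aboveI[of _ B]) auto
    show "incseq v" using v_mono by (rule incseq_SucI)
  qed
  define V where "V = (SUP K. v K)"
  have AEm: "AE a in \<mu>. mono (\<lambda>K. real (excess ?r K a))"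
    using e_mono by (auto simp: mono_def)
  have G_int: "integrable \<mu> G" and GV: "(\<integral>a. G a \<partial>\<mu>) = V"
    using integrable_monotone_convergence[OF integrable_excess AEm G_lim v_conv[unfolded v_def]]
      integral_monotone_convergence[OF integrable_excess AEm G_lim v_conv[unfolded v_def]]
    by (simp_all add: V_def v_def)
  have birk: "AE a in \<mu>. \<forall>K. (\<lambda>N. (\<Sum>x<N. real (excess ?r K ((translate ^^ x) a))) / real N) \<longlonglongrightarrow> v K"
    unfolding AE_all_countable v_def by (intro allI birkhoff integrable_excess)
  have birkG: "AE a in \<mu>. (\<lambda>N. (\<Sum>x<N. G ((translate ^^ x) a)) / real N) \<longlonglongrightarrow> V"
    using birkhoff[OF G_int] GV by simp
  have "AE a in \<mu>. if to_right (mob a 0 k)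
      then mob a 0 k has_speed 1 / V
      else slow_right (mob a 0 k)"
    using dir fin birk birkG
  proof eventually_elim
    case (elim a)
    let ?s = "mob a 0 k" and ?c = "odo a 0 k"
    obtain m0 where "frontier a ?c 0 ?r m0" using directed_odo_eq_need[OF elim(1)] by blast
    moreover have "0 \<le> m0" using calculation by (simp add: frontier_def)
    ultimately obtain m where m: "frontier a ?c 0 ?r (int m)" using nonneg_int_cases by metis
    have fina: "finite_need a (Suc ?r) x" if "int m \<le> x" for x
      using elim(2)[rule_format, of "nat x"] that by simp
    show ?case
    proof (cases "to_right ?s")
      case top: True
      have s0: "?s 0 = 0" by (simp add: mob_def)
      have "\<exists>n. ?s n = int N \<and> (\<forall>t<n. ?s t < int N)" for N
      proof -
        have "eventually (\<lambda>n. int N \<le> ?s n) sequentially" using top by (simp add: filterlim_at_top)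
        then obtain n where "int N \<le> ?s n" using eventually_happens'[OF sequentially_bot] by blast
        then show ?thesis using first_hit[OF nn_path_mob, of a 0 k "int N" n] s0 by auto
      qed
      then obtain T where T: "\<And>N. ?s (T N) = int N" "\<And>N t. t < T N \<Longrightarrow> ?s t < int N" by metis
      have lower: "(\<Sum>x=m..<N - K. real (excess ?r K ((translate ^^ x) a))) / real N \<le> real (T N) / real N" for K N
      proof -
        have "(\<Sum>x=m..<N - K. excess ?r K ((translate ^^ x) a)) \<le> T N"
          using hitting_time_lower[OF m] T(1) by (simp add: mob_def)
        then have "(\<Sum>x=m..<N - K. real (excess ?r K ((translate ^^ x) a))) \<le> real (T N)"
          by (simp only: of_nat_sum[symmetric] of_nat_le_iff)
        then show ?thesis by (rule divide_right_mono) simp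
      qed
      define C where "C = card {t. ?s t < int m}"
      have left: "finite {t. ?s t < int m}"
      proof -
        have "eventually (\<lambda>n. int m \<le> ?s n) sequentially" using top by (simp add: filterlim_at_top)
        then obtain n0 where "\<And>n. n \<ge> n0 \<Longrightarrow> int m \<le> ?s n" unfolding eventually_sequentially by blast
        then have "{t. ?s t < int m} \<subseteq> {..<n0}" by (force simp: not_le[symmetric])
        then show ?thesis using finite_subset by blast
      qed
      have upper: "real (T N) / real N \<le> real C / real N + (\<Sum>x<N. G ((translate ^^ x) a)) / real N" for N
      proof -
        have "T N \<le> C + (\<Sum>x<N. need a (Suc ?r) (int x) - need a ?r (int x))"
          unfolding C_def mob_def
          by (rule hitting_time_upper[OF m _ _ fina]) (use T left in \<open>auto simp: mob_def\<close>)
        then have "real (T N) \<le> real (C + (\<Sum>x<N. need a (Suc ?r) (int x) - need a ?r (int x)))"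
          by (simp only: of_nat_le_iff)
        also have "\<dots> = real C + (\<Sum>x<N. G ((translate ^^ x) a))"
          by (simp add: G_def need_shift)
        finally have "real (T N) / real N \<le> (real C + (\<Sum>x<N. G ((translate ^^ x) a))) / real N"
          by (rule divide_right_mono) simp
        then show ?thesis by (simp add: add_divide_distrib)
      qed
      have "(\<lambda>N. real (T N) / real N) \<longlonglongrightarrow> V"
      proof (rule order_tendstoI)
        fix y assume "y < V"
        then obtain K where K: "y < v K"
          using order_tendstoD(1)[OF v_conv[folded V_def]] eventually_happens'[OF sequentially_bot] by blast
        show "eventually (\<lambda>N. y < real (T N) / real N) sequentially"
          using order_tendstoD(1)[OF window_average[OF elim(3)[rule_format, of K], of m K] K]
          by eventually_elim (use lower in \<open>blast intro: less_le_trans\<close>)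
      next
        fix y assume y: "V < y"
        have "(\<lambda>N. real C / real N + (\<Sum>x<N. G ((translate ^^ x) a)) / real N) \<longlonglongrightarrow> 0 + V"
          by (intro tendsto_add lim_const_over_n elim(4))
        then have "(\<lambda>N. real C / real N + (\<Sum>x<N. G ((translate ^^ x) a)) / real N) \<longlonglongrightarrow> V" by simp
        from order_tendstoD(2)[OF this y]
        show "eventually (\<lambda>N. real (T N) / real N < y) sequentially"
          by eventually_elim (use upper in \<open>blast intro: le_less_trans\<close>)
      qed
      then show ?thesis using top speed_of_hitting_times[OF nn_path_mob s0 top T] by simp
    next
      case False
      then have "\<not> (\<forall>N. \<exists>n. N \<le> ?s n)"
        using unbounded_imp_top[OF m fina] by (auto simp: mob_def)
      then obtain N where N: "\<And>n. ?s n < N" by (auto simp: not_le)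
      have "eventually (\<lambda>n. real_of_int (?s n) \<le> e * real n) sequentially" if e: "e > 0" for e
      proof -
        have "eventually (\<lambda>n. real_of_int N / real n < e) sequentially"
          using lim_const_over_n e by (rule order_tendstoD)
        then show ?thesis using eventually_gt_at_top[of 0]
        proof eventually_elim
          case (elim n)
          have "real_of_int (?s n) \<le> real_of_int N" using N[of n] by simp
          also have "\<dots> \<le> e * real n" using elim by (simp add: field_simps)
          finally show ?case .
        qed
      qed
      then show ?thesis using False by simp
    qed
  qed
  then show ?thesis by blast
qed

lemma right_speed:
  assumes dir: "AE a in \<mu>. directed a 0 k s"
  shows "\<exists>u. AE a in \<mu>. if to_right (mob a 0 k)
      then mob a 0 k has_speed u
      else slow_right (mob a 0 k)"
proof (cases "\<exists>B. \<forall>K. (\<integral>a. real (excess (rights s k) K a) \<partial>\<mu>) \<le> B")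
  case True
  then show ?thesis using right_speed_finite[OF dir] by blast
next
  case False
  then have "\<And>B. \<exists>K. B < (\<integral>a. real (excess (rights s k) K a) \<partial>\<mu>)" by (auto simp: not_le)
  from right_speed_infinite[OF dir this]
  have "AE a in \<mu>. if to_right (mob a 0 k)
      then mob a 0 k has_speed 0
      else slow_right (mob a 0 k)"
  proof eventually_elim
    case (elim a)
    show ?case
    proof (cases "to_right (mob a 0 k)")
      case True
      then have nonneg: "eventually (\<lambda>n. 0 \<le> mob a 0 k n) sequentially"
        by (simp add: filterlim_at_top)
      have "mob a 0 k has_speed 0"
      proof (rule order_tendstoI)
        fix y :: real assume "y < 0"
        show "eventually (\<lambda>n. y < real_of_int (mob a 0 k n) / real n) sequentially"
          using nonneg by eventually_elim (use \<open>y < 0\<close> in \<open>auto intro: less_le_trans[of _ 0]\<close>)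
      next
        fix y :: real assume y: "0 < y"
        then have "y / 2 > 0" by simp
        from elim[rule_format, OF this]
        show "eventually (\<lambda>n. real_of_int (mob a 0 k n) / real n < y) sequentially"
          using eventually_gt_at_top[of 0]
        proof eventually_elim
          case (elim n)
          then have "real_of_int (mob a 0 k n) / real n \<le> y / 2" by (simp add: field_simps)
          then show ?case using y by linarith
        qed
      qed
      then show ?thesis using True by simp
    qed (use elim in simp)
  qed
  then show ?thesis by blast
qed

lemma AE_reflect: "AE a in distr \<mu> arrow_space reflect_arrows. Q a \<Longrightarrow> AE a in \<mu>. Q (reflect_arrows a)"
  by (rule AE_distrD[of _ _ arrow_space]) auto

lemma left_speed:
  assumes dir: "AE a in \<mu>. directed a 0 k s"
  shows "\<exists>u. AE a in \<mu>. if to_left (mob a 0 k)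
      then mob a 0 k has_speed u
      else slow_left (mob a 0 k)"
proof -
  interpret R: arrow_law "distr \<mu> arrow_space reflect_arrows" by (rule arrow_law_reflect)
  have mob: "mob (reflect_arrows a) 0 j = (\<lambda>n. - mob a 0 j n)" for a j
    using mob_reflect[of a 0] by simp
  have "AE a in distr \<mu> arrow_space reflect_arrows. directed a 0 k (\<lambda>j. \<not> s j)"
  proof (subst AE_distr_iff)
    show "{a \<in> space arrow_space. directed a 0 k (\<lambda>j. \<not> s j)} \<in> sets arrow_space" by measurable
    show "AE a in \<mu>. directed (reflect_arrows a) 0 k (\<lambda>j. \<not> s j)"
      using dir by (eventually_elim) (use directed_reflect[of _ 0] in simp)
  qed auto
  from R.right_speed[OF this] obtain u where
    "AE a in distr \<mu> arrow_space reflect_arrows. if to_right (mob a 0 k)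
      then mob a 0 k has_speed u
      else slow_right (mob a 0 k)" by blast
  from AE_reflect[OF this]
  have "AE a in \<mu>. if to_left (mob a 0 k)
      then mob a 0 k has_speed - u
      else slow_left (mob a 0 k)"
  proof eventually_elim
    case (elim a)
    have "mob a 0 k has_speed - u" if "(\<lambda>n. real_of_int (- mob a 0 k n) / real n) \<longlonglongrightarrow> u"
      using tendsto_minus[OF that] by simp
    moreover have "- e * real n \<le> real_of_int (mob a 0 k n) \<longleftrightarrow> real_of_int (- mob a 0 k n) \<le> e * real n" for e n
      by auto
    ultimately show ?case using elim unfolding mob filterlim_int_uminus by (simp split: if_splits)
  qed
  then show ?thesis by blast
qed

text \<open>Walkers from \<open>1\<close> among the arrows \<open>a\<close> are walkers from \<open>0\<close> among the translated arrows, so monotonicity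
  in the starting point makes the event invariant in one direction.\<close>

lemma right_zero_one:
  assumes dir: "AE a in \<mu>. directed a 0 k s"
  shows "(AE a in \<mu>. to_right (mob a 0 k)) \<or>
    (AE a in \<mu>. \<not> to_right (mob a 0 k))"
proof -
  let ?W = "{a \<in> space \<mu>. to_right (mob a 0 k)}"
  have W [measurable]: "?W \<in> sets \<mu>" by measurable
  have "AE a in \<mu>. directed (translate a) 0 k s"
    using AE_T_iter[OF dir, of 1] by simp
  with dir have "AE a in \<mu>. a \<in> ?W \<longrightarrow> translate a \<in> ?W"
  proof eventually_elim
    case (elim a)
    let ?s = "s(k := True)"
    have "directed a 0 k ?s" using elim(1) directed_cong[of k s ?s] by auto
    moreover have "directed a (0 + 1) k ?s"
      using elim(2) directed_cong[of k s ?s a 1] unfolding directed_shift by auto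
    ultimately have "to_right (mob a (0 + 1) k)" if "to_right (mob a 0 k)"
      using that by (intro right_walker_shift[of a 0 k ?s]) (auto simp: directed_Suc)
    then show ?case by (auto simp: mob_shift filterlim_int_minus_1)
  qed
  from zero_one_forward[OF W this] show ?thesis
    using prob_eq_0[OF W] prob_eq_1[OF W] by auto
qed

lemma left_zero_one:
  assumes dir: "AE a in \<mu>. directed a 0 k s"
  shows "(AE a in \<mu>. to_left (mob a 0 k)) \<or>
    (AE a in \<mu>. \<not> to_left (mob a 0 k))"
proof -
  let ?W = "{a \<in> space \<mu>. to_left (mob a 0 k)}"
  have W [measurable]: "?W \<in> sets \<mu>" by measurable
  have "AE a in \<mu>. directed (translate a) 0 k s"
    using AE_T_iter[OF dir, of 1] by simp
  with dir have "AE a in \<mu>. translate a \<in> ?W \<longrightarrow> a \<in> ?W"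
  proof eventually_elim
    case (elim a)
    let ?s = "s(k := False)"
    have "directed a 0 k ?s" using elim(1) directed_cong[of k s ?s] by auto
    moreover have "directed a (0 + 1) k ?s"
      using elim(2) directed_cong[of k s ?s a 1] unfolding directed_shift by auto
    ultimately have "to_left (mob a 0 k)" if "to_left (mob a (0 + 1) k)"
      using that by (intro left_walker_shift[of a 0 k ?s]) (auto simp: directed_Suc)
    then show ?case by (auto simp: mob_shift filterlim_int_minus_1)
  qed
  from zero_one_backward[OF W this] show ?thesis
    using prob_eq_0[OF W] prob_eq_1[OF W] by auto
qed

text \<open>As long as the directions of the previous walkers are deterministic, those of the next one are subject
  to the zero-one laws.\<close>

lemma directed_or_stopped:
  "(\<exists>s. AE a in \<mu>. directed a 0 k s) \<or> (AE a in \<mu>. \<exists>j<k. \<not> transient_path (mob a 0 j))"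
proof (induction k)
  case 0
  then show ?case by (simp add: directed_def)
next
  case (Suc k)
  then show ?case
  proof
    assume "\<exists>s. AE a in \<mu>. directed a 0 k s"
    then obtain s where s: "AE a in \<mu>. directed a 0 k s" by blast
    have ext: "\<exists>s. AE a in \<mu>. directed a 0 (Suc k) s"
      if "AE a in \<mu>. filterlim (mob a 0 k) (if b then at_top else at_bot) sequentially" for b
      using that s
      by (intro exI[of _ "s(k := b)"], eventually_elim)
        (auto simp: directed_Suc directed_cong[of k s "s(k := b)"])
    consider "AE a in \<mu>. to_right (mob a 0 k)"
      | "AE a in \<mu>. to_left (mob a 0 k)"
      | "AE a in \<mu>. \<not> to_right (mob a 0 k)" "AE a in \<mu>. \<not> to_left (mob a 0 k)"
      using right_zero_one[OF s] left_zero_one[OF s] by blast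
    then show ?thesis
    proof cases
      case 1 then show ?thesis using ext[of True] by simp
    next
      case 2 then show ?thesis using ext[of False] by simp
    next
      case 3
      then have "AE a in \<mu>. \<exists>j<Suc k. \<not> transient_path (mob a 0 j)"
        by eventually_elim (auto simp: transient_mob_iff)
      then show ?thesis by blast
    qed
  next
    assume "AE a in \<mu>. \<exists>j<k. \<not> transient_path (mob a 0 j)"
    then have "AE a in \<mu>. \<exists>j<Suc k. \<not> transient_path (mob a 0 j)"
      by eventually_elim (use less_Suc_eq in blast)
    then show ?thesis by blast
  qed
qed

theorem mob_speed:
  "\<exists>v. ((AE a in \<mu>. \<forall>j<k. transient_path (mob a 0 j)) \<and>
        (AE a in \<mu>. mob a 0 k has_speed v)) \<or>
      (AE a in \<mu>. \<exists>j<k. \<not> transient_path (mob a 0 j))"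
proof (cases "AE a in \<mu>. \<exists>j<k. \<not> transient_path (mob a 0 j)")
  case False
  then obtain s where s: "AE a in \<mu>. directed a 0 k s" using directed_or_stopped by blast
  have alive: "AE a in \<mu>. \<forall>j<k. transient_path (mob a 0 j)"
    using s by eventually_elim (auto intro: directed_transient)
  obtain u where u: "AE a in \<mu>. if to_right (mob a 0 k)
      then mob a 0 k has_speed u
      else slow_right (mob a 0 k)"
    using right_speed[OF s] by blast
  obtain w where w: "AE a in \<mu>. if to_left (mob a 0 k)
      then mob a 0 k has_speed w
      else slow_left (mob a 0 k)"
    using left_speed[OF s] by blast
  consider "AE a in \<mu>. to_right (mob a 0 k)"
    | "AE a in \<mu>. to_left (mob a 0 k)"
    | "AE a in \<mu>. \<not> to_right (mob a 0 k)" "AE a in \<mu>. \<not> to_left (mob a 0 k)"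
    using right_zero_one[OF s] left_zero_one[OF s] by blast
  then have "\<exists>v. AE a in \<mu>. mob a 0 k has_speed v"
  proof cases
    case 1
    then have "AE a in \<mu>. mob a 0 k has_speed u"
      using u by eventually_elim simp
    then show ?thesis by blast
  next
    case 2
    then have "AE a in \<mu>. mob a 0 k has_speed w"
      using w by eventually_elim simp
    then show ?thesis by blast
  next
    case 3
    then have "AE a in \<mu>. mob a 0 k has_speed 0"
      using u w
    proof eventually_elim
      case (elim a)
      show ?case
      proof (rule tendstoI)
        fix e :: real assume e: "e > 0"
        have h: "e / 2 > 0" using e by simp
        have "slow_right (mob a 0 k)"
          "slow_left (mob a 0 k)"
          using elim by auto
        from this[rule_format, OF h]
        show "eventually (\<lambda>n. dist (real_of_int (mob a 0 k n) / real n) 0 < e) sequentially"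
          using eventually_gt_at_top[of 0]
        proof eventually_elim
          case (elim n)
          then have "real_of_int (mob a 0 k n) / real n \<le> e / 2" "- (e / 2) \<le> real_of_int (mob a 0 k n) / real n"
            by (simp_all add: field_simps)
          then show ?case using e unfolding dist_real_def by linarith
        qed
      qed
    qed
    then show ?thesis by blast
  qed
  then show ?thesis using alive by blast
qed blast

end

section \<open>Independent seeds\<close>

lemma (in finite_measure) measure_diff_le_sym_diff:
  assumes "A \<in> sets M" "B \<in> sets M"
  shows "\<bar>measure M A - measure M B\<bar> \<le> measure M (sym_diff A B)"
proof -
  have "measure M A \<le> measure M (B \<union> sym_diff A B)" "measure M B \<le> measure M (A \<union> sym_diff A B)"
    using assms by (auto intro!: finite_measure_mono)
  then show ?thesis
    using measure_Un_le[of B M "sym_diff A B"] measure_Un_le[of A M "sym_diff A B"] assms by auto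
qed

text \<open>A class of sets generates a \<open>\<sigma>\<close>-algebra as soon as it makes the identity measurable; for product
  spaces this only has to be checked for the coordinates.\<close>

lemma sets_eq_sigma_setsI:
  assumes L: "L \<subseteq> sets M" and id: "(\<lambda>x. x) \<in> sigma (space M) L \<rightarrow>\<^sub>M M"
  shows "sets M = sigma_sets (space M) L"
proof
  show "sigma_sets (space M) L \<subseteq> sets M" using L by (rule sets.sigma_sets_subset)
  have Lp: "L \<subseteq> Pow (space M)" using L sets.space_closed by blast
  show "sets M \<subseteq> sigma_sets (space M) L"
  proof
    fix A assume A: "A \<in> sets M"
    then show "A \<in> sigma_sets (space M) L"
      using measurable_sets[OF id A] sets.sets_into_space[OF A]
      by (simp add: sets_measure_of[OF Lp] space_measure_of[OF Lp] Int_absorb2)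
  qed
qed

definition seeds :: "'b measure \<Rightarrow> ('i \<Rightarrow> 'b) measure" where
  "seeds N = Pi\<^sub>M UNIV (\<lambda>_. N)"

definition splice :: "'i set \<Rightarrow> ('i \<Rightarrow> 'b) \<Rightarrow> ('i \<Rightarrow> 'b) \<Rightarrow> 'i \<Rightarrow> 'b" where
  "splice I u u' = (\<lambda>i. if i \<in> I then u i else u' i)"

locale seed = prob_space N for N :: "'b measure" +
  assumes space_N [simp]: "space N = UNIV"
begin

lemma space_seeds [simp]: "space (seeds N) = UNIV"
  by (simp add: seeds_def space_PiM)

lemma prob_space_seeds: "prob_space (seeds N :: ('i \<Rightarrow> 'b) measure)"
  unfolding seeds_def by (rule prob_space_PiM) (rule prob_space_axioms)

lemma measurable_seed [measurable]: "(\<lambda>u. u i) \<in> seeds N \<rightarrow>\<^sub>M N"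
  unfolding seeds_def by (rule measurable_component_singleton) simp

lemma measurable_into_seeds: "(\<And>i. (\<lambda>x. f x i) \<in> M \<rightarrow>\<^sub>M N) \<Longrightarrow> f \<in> M \<rightarrow>\<^sub>M seeds N"
  unfolding seeds_def by (rule measurable_PiM_single') auto

lemma measurable_splice: "(\<lambda>(u, u'). splice I u u') \<in> seeds N \<Otimes>\<^sub>M seeds N \<rightarrow>\<^sub>M seeds N"
  by (rule measurable_into_seeds) (auto simp: splice_def split_def)

lemma emeasure_seeds_cylinder:
  assumes "finite J" "\<And>i. i \<in> J \<Longrightarrow> A i \<in> sets N"
  shows "emeasure (seeds N) {u. \<forall>i\<in>J. u i \<in> A i} = (\<Prod>i\<in>J. emeasure N (A i))"
proof -
  have "{u. \<forall>i\<in>J. u i \<in> A i} = prod_emb UNIV (\<lambda>_. N) J (Pi\<^sub>E J A)"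
    by (auto simp: prod_emb_def PiE_iff extensional_def)
  then show ?thesis unfolding seeds_def
    using assms emeasure_PiM_emb[of UNIV "\<lambda>_. N" J A] prob_space_axioms by simp
qed

text \<open>Replacing the seeds outside \<open>I\<close> by an independent copy does not change the law.\<close>

lemma distr_splice:
  "distr (seeds N \<Otimes>\<^sub>M seeds N) (seeds N) (\<lambda>(u, u'). splice I u u') = (seeds N :: ('i \<Rightarrow> 'b) measure)"
proof -
  interpret U: prob_space "seeds N :: ('i \<Rightarrow> 'b) measure" by (rule prob_space_seeds)
  interpret UU: pair_prob_space "seeds N :: ('i \<Rightarrow> 'b) measure" "seeds N :: ('i \<Rightarrow> 'b) measure" ..
  note measurable_splice [measurable]
  show ?thesis unfolding seeds_def
  proof (rule measure_eqI_PiM_infinite[symmetric])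
    show "finite_measure (Pi\<^sub>M UNIV (\<lambda>_::'i. N))" using U.finite_measure_axioms by (simp add: seeds_def)
    fix A :: "'i \<Rightarrow> 'b set" and J :: "'i set" assume J: "finite J" "J \<subseteq> UNIV" and A: "\<And>i. i \<in> J \<Longrightarrow> A i \<in> sets N"
    let ?X = "prod_emb UNIV (\<lambda>_. N) J (Pi\<^sub>E J A)"
    have X: "?X = {u. \<forall>i\<in>J. u i \<in> A i}"
      by (auto simp: prod_emb_def PiE_iff extensional_def)
    have Xs: "?X \<in> sets (seeds N)" unfolding seeds_def using J A by (intro sets_PiM_I) auto
    have cyl: "{u. \<forall>i\<in>K. u i \<in> A i} \<in> sets (seeds N)" if "K \<subseteq> J" for K
    proof -
      have "finite K" using that J finite_subset by blast
      moreover have "{u \<in> space (seeds N). u i \<in> A i} \<in> sets (seeds N :: ('i \<Rightarrow> 'b) measure)" if "i \<in> K" for i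
        using measurable_sets[OF measurable_seed, of "A i" i] A that \<open>K \<subseteq> J\<close> by (auto simp: vimage_def)
      ultimately have "{u \<in> space (seeds N). \<forall>i\<in>K. u i \<in> A i} \<in> sets (seeds N)"
        by (intro sets.sets_Collect_finite_All) auto
      then show ?thesis by simp
    qed
    have "(\<lambda>(u, u'). splice I u u') -` ?X \<inter> space (seeds N \<Otimes>\<^sub>M seeds N) =
        {u. \<forall>i\<in>J \<inter> I. u i \<in> A i} \<times> {u. \<forall>i\<in>J - I. u i \<in> A i}"
      unfolding X by (auto simp: splice_def space_pair_measure split: if_splits)
    then have "emeasure (distr (seeds N \<Otimes>\<^sub>M seeds N) (seeds N) (\<lambda>(u, u'). splice I u u')) ?X =
        emeasure (seeds N \<Otimes>\<^sub>M seeds N) ({u. \<forall>i\<in>J \<inter> I. u i \<in> A i} \<times> {u. \<forall>i\<in>J - I. u i \<in> A i})"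
      using Xs by (subst emeasure_distr) auto
    also have "\<dots> = (\<Prod>i\<in>J \<inter> I. emeasure N (A i)) * (\<Prod>i\<in>J - I. emeasure N (A i))"
    proof -
      have "emeasure (seeds N) {u. \<forall>i\<in>J \<inter> I. u i \<in> A i} = (\<Prod>i\<in>J \<inter> I. emeasure N (A i))"
        "emeasure (seeds N) {u. \<forall>i\<in>J - I. u i \<in> A i} = (\<Prod>i\<in>J - I. emeasure N (A i))"
        by (rule emeasure_seeds_cylinder; use J A in auto)+
      then show ?thesis by (subst U.emeasure_pair_measure_Times) (auto intro: cyl)
    qed
    also have "\<dots> = (\<Prod>i\<in>J. emeasure N (A i))"
      using J by (subst prod.Int_Diff[of J _ I]) auto
    also have "\<dots> = emeasure (seeds N) ?X"
      unfolding X using J A by (simp add: emeasure_seeds_cylinder)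
    finally show "emeasure (Pi\<^sub>M UNIV (\<lambda>_. N)) ?X =
      emeasure (distr (Pi\<^sub>M UNIV (\<lambda>_. N) \<Otimes>\<^sub>M Pi\<^sub>M UNIV (\<lambda>_. N)) (Pi\<^sub>M UNIV (\<lambda>_. N)) (\<lambda>(u, u'). splice I u u')) ?X"
      by (simp add: seeds_def)
  qed simp_all
qed

lemma seeds_independent:
  assumes B [measurable]: "B \<in> sets (seeds N)" and D [measurable]: "D \<in> sets (seeds N)"
    and Bdep: "\<And>u u'. (\<And>i. i \<in> I \<Longrightarrow> u i = u' i) \<Longrightarrow> u \<in> B \<longleftrightarrow> u' \<in> B"
    and Ddep: "\<And>u u'. (\<And>i. i \<notin> I \<Longrightarrow> u i = u' i) \<Longrightarrow> u \<in> D \<longleftrightarrow> u' \<in> D"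
  shows "measure (seeds N) (B \<inter> D) = measure (seeds N) B * measure (seeds N) (D :: ('i \<Rightarrow> 'b) set)"
proof -
  interpret U: prob_space "seeds N :: ('i \<Rightarrow> 'b) measure" by (rule prob_space_seeds)
  interpret UU: pair_prob_space "seeds N :: ('i \<Rightarrow> 'b) measure" "seeds N :: ('i \<Rightarrow> 'b) measure" ..
  note measurable_splice [measurable]
  have "measure (seeds N) (B \<inter> D) = measure (distr (seeds N \<Otimes>\<^sub>M seeds N) (seeds N) (\<lambda>(u, u'). splice I u u')) (B \<inter> D)"
    by (simp add: distr_splice)
  also have "\<dots> = measure (seeds N \<Otimes>\<^sub>M seeds N) ((\<lambda>(u, u'). splice I u u') -` (B \<inter> D) \<inter> space (seeds N \<Otimes>\<^sub>M seeds N))"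
    by (subst measure_distr) auto
  also have "(\<lambda>(u, u'). splice I u u') -` (B \<inter> D) \<inter> space (seeds N \<Otimes>\<^sub>M seeds N) = B \<times> D"
  proof -
    have "splice I u u' \<in> B \<longleftrightarrow> u \<in> B" for u u' by (rule Bdep) (simp add: splice_def)
    moreover have "splice I u u' \<in> D \<longleftrightarrow> u' \<in> D" for u u' by (rule Ddep) (simp add: splice_def)
    ultimately show ?thesis by (auto simp: space_pair_measure)
  qed
  also have "measure (seeds N \<Otimes>\<^sub>M seeds N) (B \<times> D) = measure (seeds N) B * measure (seeds N) D"
    by (simp add: measure_def U.emeasure_pair_measure_Times enn2real_mult)
  finally show ?thesis .
qed

lemma measurable_translate_seeds [measurable]:
  "translate \<in> (seeds N :: (int \<times> 'e \<Rightarrow> 'b) measure) \<rightarrow>\<^sub>M seeds N"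
  by (rule measurable_into_seeds) (auto simp: translate_def split_def)

lemma distr_translate_seeds:
  "distr (seeds N) (seeds N) translate = (seeds N :: (int \<times> 'e \<Rightarrow> 'b) measure)"
proof -
  let ?f = "\<lambda>(x, e). (x + 1, e) :: int \<times> 'e"
  have "distr (Pi\<^sub>M UNIV (\<lambda>_. N)) (Pi\<^sub>M UNIV (\<lambda>i. N)) (\<lambda>u. \<lambda>i\<in>UNIV. u (?f i)) = Pi\<^sub>M UNIV (\<lambda>i. N)"
    by (rule distr_PiM_reindex[of UNIV "\<lambda>_. N" ?f UNIV]) (auto simp: prob_space_axioms inj_on_def)
  moreover have "translate = (\<lambda>u::int \<times> 'e \<Rightarrow> 'b. \<lambda>x. u (fst x + 1, snd x))"
    by (simp add: fun_eq_iff translate_def split_def)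
  ultimately show ?thesis by (simp add: seeds_def split_def restrict_def)
qed

lemma distr_translate_iter_seeds:
  "distr (seeds N) (seeds N) (translate ^^ n) = (seeds N :: (int \<times> 'e \<Rightarrow> 'b) measure)"
proof (induction n)
  case 0
  show ?case by (simp add: distr_id2 eq_id_iff)
next
  case (Suc n)
  have [measurable]: "(translate ^^ n) \<in> (seeds N :: (int \<times> 'e \<Rightarrow> 'b) measure) \<rightarrow>\<^sub>M seeds N"
    by (induction n) (auto intro: measurable_comp measurable_translate_seeds)
  have "distr (seeds N :: (int \<times> 'e \<Rightarrow> 'b) measure) (seeds N) (translate ^^ Suc n) =
      distr (distr (seeds N) (seeds N) (translate ^^ n)) (seeds N) translate"
    by (subst distr_distr) auto
  then show ?case by (simp only: Suc distr_translate_seeds)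
qed

end

locale driven_seeds = P: ergodic_system P S + seed N for P :: "'a measure" and S and N :: "'b measure"
begin

abbreviation U :: "(int \<times> 'e \<Rightarrow> 'b) measure" where "U \<equiv> seeds N"

abbreviation PU :: "('a \<times> (int \<times> 'e \<Rightarrow> 'b)) measure" where "PU \<equiv> P \<Otimes>\<^sub>M U"

definition skew :: "'a \<times> (int \<times> 'e \<Rightarrow> 'b) \<Rightarrow> 'a \<times> (int \<times> 'e \<Rightarrow> 'b)" where
  "skew = (\<lambda>(\<omega>, u). (S \<omega>, translate u))"

text \<open>These sets form an algebra that generates the product \<open>\<sigma>\<close>-algebra, and distant translates of them are
  conditionally independent.\<close>

definition local_set :: "('a \<times> (int \<times> 'e \<Rightarrow> 'b)) set \<Rightarrow> int \<Rightarrow> bool" where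
  "local_set B m \<longleftrightarrow> B \<in> sets PU \<and>
    (\<forall>\<omega> u u'. (\<forall>x e. \<bar>x\<bar> \<le> m \<longrightarrow> u (x, e) = u' (x, e)) \<longrightarrow> (\<omega>, u) \<in> B \<longleftrightarrow> (\<omega>, u') \<in> B)"

lemma local_set_sets: "local_set B m \<Longrightarrow> B \<in> sets PU"
  by (simp add: local_set_def)

lemma local_set_mono: "local_set B m \<Longrightarrow> m \<le> m' \<Longrightarrow> local_set B m'"
  unfolding local_set_def by (meson order_trans)

lemma local_set_empty: "local_set {} m"
  by (simp add: local_set_def)

lemma local_set_Compl: "local_set B m \<Longrightarrow> local_set (space PU - B) m"
  unfolding local_set_def using sets.compl_sets[of B PU] by (auto simp: space_pair_measure)

lemma local_setD:
  "local_set B m \<Longrightarrow> \<forall>x e. \<bar>x\<bar> \<le> m \<longrightarrow> u (x, e) = u' (x, e) \<Longrightarrow> (\<omega>, u) \<in> B \<longleftrightarrow> (\<omega>, u') \<in> B"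
  unfolding local_set_def by blast

lemma local_set_Un:
  fixes B B' :: "('a \<times> (int \<times> 'e \<Rightarrow> 'b)) set"
  assumes "local_set B m" "local_set B' m"
  shows "local_set (B \<union> B') m"
  unfolding local_set_def
proof (intro conjI allI impI)
  show "B \<union> B' \<in> sets PU" using assms by (auto intro: local_set_sets)
  fix \<omega> and u u' :: "int \<times> 'e \<Rightarrow> 'b" assume eq: "\<forall>x e. \<bar>x\<bar> \<le> m \<longrightarrow> u (x, e) = u' (x, e)"
  show "(\<omega>, u) \<in> B \<union> B' \<longleftrightarrow> (\<omega>, u') \<in> B \<union> B'"
    using local_setD[OF assms(1) eq] local_setD[OF assms(2) eq] by simp
qed

lemma local_set_UN:
  assumes "\<And>i. i < (n::nat) \<Longrightarrow> \<exists>m. local_set (B i) m"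
  shows "\<exists>m. local_set (\<Union>i<n. B i) m"
  using assms
proof (induction n)
  case (Suc n)
  then obtain m m' where "local_set (\<Union>i<n. B i) m" "local_set (B n) m'" by fastforce
  then have "local_set ((\<Union>i<n. B i) \<union> B n) (max m m')"
    by (auto intro!: local_set_Un intro: local_set_mono)
  then show ?case by (auto simp: lessThan_Suc Un_commute)
qed (auto intro: local_set_empty)

lemma sets_generated_by_local:
  "sets (PU :: ('a \<times> (int \<times> 'e \<Rightarrow> 'b)) measure) = sigma_sets (space PU) {B. \<exists>m. local_set B m}"
  (is "_ = sigma_sets ?sp ?L")
proof (rule sets_eq_sigma_setsI)
  let ?G = "sigma ?sp ?L"
  show L: "?L \<subseteq> sets PU" by (auto simp: local_set_def)
  then have Lp: "?L \<subseteq> Pow (space PU)" using sets.space_closed by blast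
  have G: "sets ?G = sigma_sets (space PU) ?L" "space ?G = space PU"
    using sets_measure_of[OF Lp] space_measure_of[OF Lp] by auto
  have "fst \<in> ?G \<rightarrow>\<^sub>M P"
  proof (rule measurableI)
    fix A assume A: "A \<in> sets P"
    have "fst -` A \<inter> space PU \<in> sets PU"
      using measurable_sets[OF measurable_fst A] .
    then have "local_set (fst -` A \<inter> space PU) 0"
      unfolding local_set_def by (simp add: space_pair_measure)
    then show "fst -` A \<inter> space ?G \<in> sets ?G" unfolding G by (intro sigma_sets.Basic) auto
  next
    fix z assume "z \<in> space ?G"
    then show "fst z \<in> space P" unfolding G(2) by (auto simp: space_pair_measure)
  qed
  moreover have "(\<lambda>z. snd z (x, e)) \<in> ?G \<rightarrow>\<^sub>M N" for x and e :: 'e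
  proof (rule measurableI)
    fix A assume A: "A \<in> sets N"
    have "(\<lambda>z. snd z (x, e)) \<in> PU \<rightarrow>\<^sub>M N"
      by (rule measurable_compose[OF measurable_snd measurable_seed])
    from measurable_sets[OF this A]
    have "local_set ((\<lambda>z. snd z (x, e)) -` A \<inter> space PU) \<bar>x\<bar>"
      unfolding local_set_def by (simp add: space_pair_measure)
    then show "(\<lambda>z. snd z (x, e)) -` A \<inter> space ?G \<in> sets ?G" unfolding G by (intro sigma_sets.Basic) auto
  qed simp
  then have "snd \<in> ?G \<rightarrow>\<^sub>M U" by (intro measurable_into_seeds) auto
  ultimately have "(\<lambda>z. (fst z, snd z)) \<in> ?G \<rightarrow>\<^sub>M PU" by (rule measurable_Pair)
  then show "(\<lambda>z. z) \<in> ?G \<rightarrow>\<^sub>M PU" by simp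
qed

lemma prob_space_driven: "prob_space (PU :: ('a \<times> (int \<times> 'e \<Rightarrow> 'b)) measure)"
proof -
  interpret U: prob_space "U :: (int \<times> 'e \<Rightarrow> 'b) measure" by (rule prob_space_seeds)
  interpret PUi: pair_prob_space P "U :: (int \<times> 'e \<Rightarrow> 'b) measure" ..
  show ?thesis by (rule PUi.prob_space_axioms)
qed

text \<open>The sets that can be approximated form a \<open>\<sigma>\<close>-algebra, and the local sets are an algebra that
  generates everything.\<close>

lemma local_approximation:
  assumes "A \<in> sets (PU :: ('a \<times> (int \<times> 'e \<Rightarrow> 'b)) measure)" "\<epsilon> > 0"
  shows "\<exists>B m. local_set B m \<and> measure PU (sym_diff A B) < \<epsilon>"
proof -
  interpret Q: prob_space "PU :: ('a \<times> (int \<times> 'e \<Rightarrow> 'b)) measure" by (rule prob_space_driven)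
  from assms(1) have "A \<in> sigma_sets (space PU) {B. \<exists>m. local_set B m}"
    by (simp add: sets_generated_by_local)
  then have "A \<in> sets PU \<and>
    (\<forall>\<epsilon>>0. \<exists>B. (\<exists>m. local_set B m) \<and> measure PU (sym_diff A B) < \<epsilon>)"
  proof (induction rule: sigma_sets.induct)
    case (Basic A)
    then show ?case using local_set_sets by (auto intro!: exI[of _ A])
  next
    case Empty
    then show ?case using local_set_empty by (auto intro!: exI[of _ "{}"])
  next
    case (Compl A)
    then have A: "A \<subseteq> space PU" using sets.sets_into_space by blast
    show ?case
    proof (intro conjI allI impI)
      fix \<epsilon> :: real assume "\<epsilon> > 0"
      with Compl obtain B m where B: "local_set B m" "measure PU (sym_diff A B) < \<epsilon>" by blast
      have "B \<subseteq> space PU" using local_set_sets[OF B(1)] sets.sets_into_space by blast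
      then have "(space PU - A - (space PU - B)) \<union> (space PU - B - (space PU - A)) = sym_diff A B"
        using A by blast
      then show "\<exists>B. (\<exists>m. local_set B m) \<and>
          measure PU ((space PU - A - B) \<union> (B - (space PU - A))) < \<epsilon>"
        using B local_set_Compl by metis
    qed (use Compl in auto)
  next
    case (Union A)
    then have A [measurable]: "A i \<in> sets PU" for i by blast
    show ?case
    proof (intro conjI allI impI)
      fix \<epsilon> :: real assume e: "\<epsilon> > 0"
      have "(\<lambda>n. measure PU (\<Union>i<n. A i)) \<longlonglongrightarrow> measure PU (\<Union>n. \<Union>i<n. A i)"
        by (rule Q.finite_Lim_measure_incseq) (auto simp: incseq_def, fastforce)
      moreover have "(\<Union>n. \<Union>i<n. A i) = (\<Union>i. A i)" by auto
      ultimately have "eventually (\<lambda>n. measure PU (\<Union>i. A i) - \<epsilon> / 2 < measure PU (\<Union>i<n. A i)) sequentially"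
        using e by (intro order_tendstoD(1)) auto
      then obtain n where n: "measure PU (\<Union>i. A i) - \<epsilon> / 2 < measure PU (\<Union>i<n. A i)"
        using eventually_happens'[OF sequentially_bot] by blast
      define d where "d = \<epsilon> / (2 * (real n + 1))"
      have d: "d > 0" using e by (simp add: d_def)
      obtain B where B: "\<And>i. \<exists>m. local_set (B i) m" "\<And>i. measure PU (sym_diff (A i) (B i)) < d"
      proof -
        have "\<forall>i. \<exists>B. (\<exists>m. local_set B m) \<and> measure PU (sym_diff (A i) B) < d"
          using Union.IH d by blast
        from choice[OF this] show thesis using that by blast
      qed
      obtain m where m: "local_set (\<Union>i<n. B i) m" using local_set_UN[of n B] B(1) by blast
      have Bs [measurable]: "B i \<in> sets PU" for i using B(1) local_set_sets by blast
      let ?D = "(\<Union>i<n. sym_diff (A i) (B i))"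
      have "measure PU (sym_diff (\<Union>i. A i) (\<Union>i<n. B i))
          \<le> measure PU (((\<Union>i. A i) - (\<Union>i<n. A i)) \<union> ?D)"
      proof (rule Q.finite_measure_mono)
        show "sym_diff (\<Union>i. A i) (\<Union>i<n. B i) \<subseteq>
          ((\<Union>i. A i) - (\<Union>i<n. A i)) \<union> ?D" by blast
        show "((\<Union>i. A i) - (\<Union>i<n. A i)) \<union> ?D \<in> sets PU" by measurable
      qed
      also have "\<dots> \<le> measure PU ((\<Union>i. A i) - (\<Union>i<n. A i)) + measure PU ?D"
        by (rule measure_Un_le) auto
      also have "measure PU ((\<Union>i. A i) - (\<Union>i<n. A i)) = measure PU (\<Union>i. A i) - measure PU (\<Union>i<n. A i)"
        by (rule Q.finite_measure_Diff) auto
      also have "\<dots> < \<epsilon> / 2" using n by linarith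
      also have "measure PU ?D \<le> (\<Sum>i<n. measure PU (sym_diff (A i) (B i)))"
        by (rule Q.finite_measure_subadditive_finite) auto
      also have "\<dots> \<le> (\<Sum>i<n. d)" using B(2) by (intro sum_mono less_imp_le)
      also have "\<dots> \<le> \<epsilon> / 2" using e by (simp add: d_def field_simps)
      finally show "\<exists>B. (\<exists>m. local_set B m) \<and>
          measure PU (sym_diff (\<Union>i. A i) B) < \<epsilon>"
        using m by auto
    qed auto
  qed
  then show ?thesis using assms(2) by blast
qed

lemma measurable_skew: "skew \<in> PU \<rightarrow>\<^sub>M PU"
  unfolding skew_def split_def
  by (intro measurable_Pair measurable_compose[OF measurable_fst P.T_measurable]
      measurable_compose[OF measurable_snd measurable_translate_seeds])

lemma skew_iter: "(skew ^^ n) (\<omega>, u) = ((S ^^ n) \<omega>, (translate ^^ n) u)"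
  by (induction n) (auto simp: skew_def)

lemma distr_skew: "distr PU PU skew = (PU :: ('a \<times> (int \<times> 'e \<Rightarrow> 'b)) measure)"
proof -
  interpret U: prob_space "U :: (int \<times> 'e \<Rightarrow> 'b) measure" by (rule prob_space_seeds)
  have "distr P P S \<Otimes>\<^sub>M distr U (U :: (int \<times> 'e \<Rightarrow> 'b) measure) translate = distr PU PU (\<lambda>(\<omega>, u). (S \<omega>, translate u))"
    by (rule pair_measure_distr) (simp_all add: distr_translate_seeds U.sigma_finite_measure_axioms)
  then show ?thesis by (simp add: P.distr_T distr_translate_seeds skew_def)
qed

text \<open>Two copies of a window, moved far apart, use disjoint sets of seeds, so they are
  independent given \<open>\<omega>\<close>. An invariant set is approximated by a window set together with each of
  its translates, and its conditional probability given \<open>\<omega>\<close> is an invariant function of \<open>\<omega>\<close>, hence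
  a constant \<open>c\<close>; comparing with two distant windows yields \<open>c = c\<^sup>2\<close>.\<close>

theorem ergodic_skew: "ergodic_system (PU :: ('a \<times> (int \<times> 'e \<Rightarrow> 'b)) measure) skew"
proof -
  let ?U = "U :: (int \<times> 'e \<Rightarrow> 'b) measure"
  let ?Q = "P \<Otimes>\<^sub>M ?U"
  interpret U: prob_space ?U by (rule prob_space_seeds)
  interpret Q: prob_space ?Q by (rule prob_space_driven)
  note [measurable] = measurable_skew
  have meas_iter [measurable]: "(skew ^^ n) \<in> ?Q \<rightarrow>\<^sub>M ?Q" for n
    by (induction n) (auto intro: measurable_comp measurable_skew)
  have distr_iter: "distr ?Q ?Q (skew ^^ n) = ?Q" for n
  proof (induction n)
    case (Suc n)
    have "distr ?Q ?Q (skew ^^ Suc n) = distr (distr ?Q ?Q (skew ^^ n)) ?Q skew"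
      by (subst distr_distr) auto
    then show ?case by (simp only: Suc distr_skew)
  qed (simp add: distr_id2 eq_id_iff)
  show ?thesis
  proof
    show "skew \<in> ?Q \<rightarrow>\<^sub>M ?Q" by (rule measurable_skew)
    show "distr ?Q ?Q skew = ?Q" by (rule distr_skew)
    fix A assume A [measurable]: "A \<in> sets ?Q" and inv: "skew -` A \<inter> space ?Q = A"
    define p where "p B \<omega> = measure ?U (Pair \<omega> -` B)" for B :: "('a \<times> (int \<times> 'e \<Rightarrow> 'b)) set" and \<omega>
    have p_meas [measurable]: "p B \<in> borel_measurable P" if [measurable]: "B \<in> sets ?Q" for B
      unfolding p_def measure_def by measurable
    have p01: "0 \<le> p B \<omega>" "p B \<omega> \<le> 1" for B \<omega> unfolding p_def by auto
    have p_int: "integrable P (p B)" if "B \<in> sets ?Q" for B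
      using p01 that by (intro P.integrable_const_bound[of _ 1]) auto
    have sect: "Pair \<omega> -` B \<in> sets ?U" if "B \<in> sets ?Q" for B \<omega>
      using that by (rule sets_Pair1)
    have Q_eq: "measure ?Q B = (\<integral>\<omega>. p B \<omega> \<partial>P)" if B: "B \<in> sets ?Q" for B
    proof -
      have "emeasure ?Q B = (\<integral>\<^sup>+\<omega>. emeasure ?U (Pair \<omega> -` B) \<partial>P)"
        using B by (rule U.emeasure_pair_measure_alt)
      also have "\<dots> = (\<integral>\<^sup>+\<omega>. ennreal (p B \<omega>) \<partial>P)"
        unfolding p_def by (simp add: U.emeasure_eq_measure)
      also have "\<dots> = ennreal (\<integral>\<omega>. p B \<omega> \<partial>P)"
        using p_int[OF B] p01 by (intro nn_integral_eq_integral) auto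
      finally show ?thesis using p01 by (simp add: measure_def integral_nonneg_AE)
    qed
    have inv_iff: "skew z \<in> A \<longleftrightarrow> z \<in> A" if "z \<in> space ?Q" for z using inv that by blast
    have inv_iter: "(skew ^^ n) z \<in> A \<longleftrightarrow> z \<in> A" if z: "z \<in> space ?Q" for n z
    proof (induction n)
      case (Suc n)
      have "(skew ^^ n) z \<in> space ?Q" using measurable_space[OF meas_iter z] .
      then show ?case using Suc inv_iff by simp
    qed simp
    define c where "c = measure ?Q A"
    have "AE \<omega> in P. p A \<omega> = (\<integral>\<omega>. p A \<omega> \<partial>P)"
    proof (rule P.invariant_const[OF p_int[OF A]])
      fix \<omega> assume w: "\<omega> \<in> space P"
      have "Pair \<omega> -` A = translate -` (Pair (S \<omega>) -` A) \<inter> space ?U"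
        using inv_iff[of "(\<omega>, u)" for u] w by (auto simp: skew_def space_pair_measure)
      then have "p A \<omega> = measure (distr ?U ?U translate) (Pair (S \<omega>) -` A)"
        unfolding p_def by (subst measure_distr) (auto simp: sect[OF A])
      then show "p A (S \<omega>) = p A \<omega>" by (simp add: distr_translate_seeds p_def)
    qed
    then have p_c: "AE \<omega> in P. p A \<omega> = c" unfolding c_def Q_eq[OF A] .
    have bound: "\<bar>c - c * c\<bar> \<le> 4 * \<epsilon>" if e: "\<epsilon> > 0" for \<epsilon>
    proof -
      obtain B m where loc: "local_set B m" and BA: "measure ?Q (sym_diff A B) < \<epsilon>"
        using local_approximation[OF A e] by blast
      have B [measurable]: "B \<in> sets ?Q" using local_set_sets[OF loc] .
      define n where "n = nat (2 * m + 1)"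
      have n: "2 * m < int n" by (simp add: n_def)
      define D where "D = (skew ^^ n) -` B \<inter> space ?Q"
      have D [measurable]: "D \<in> sets ?Q" unfolding D_def by measurable
      have AD: "measure ?Q (sym_diff A D) < \<epsilon>"
      proof -
        have "sym_diff A D = (skew ^^ n) -` (sym_diff A B) \<inter> space ?Q"
          using inv_iter sets.sets_into_space[OF A] unfolding D_def by blast
        also have "measure ?Q \<dots> = measure (distr ?Q ?Q (skew ^^ n)) (sym_diff A B)"
          by (subst measure_distr) auto
        finally show ?thesis using BA by (simp add: distr_iter)
      qed
      have 1: "\<bar>c - measure ?Q (B \<inter> D)\<bar> \<le> 2 * \<epsilon>"
      proof -
        have "\<bar>c - measure ?Q (B \<inter> D)\<bar> \<le> measure ?Q (sym_diff A (B \<inter> D))"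
          unfolding c_def by (rule Q.measure_diff_le_sym_diff) auto
        also have "\<dots> \<le> measure ?Q (sym_diff A B \<union> sym_diff A D)"
          by (rule Q.finite_measure_mono) auto
        also have "\<dots> \<le> measure ?Q (sym_diff A B) + measure ?Q (sym_diff A D)"
          by (rule measure_Un_le) auto
        finally show ?thesis using BA AD by simp
      qed
      have pD: "p D \<omega> = p B ((S ^^ n) \<omega>)" if w: "\<omega> \<in> space P" for \<omega>
      proof -
        have "Pair \<omega> -` D = (translate ^^ n) -` (Pair ((S ^^ n) \<omega>) -` B) \<inter> space ?U"
          using w by (auto simp: D_def skew_iter space_pair_measure)
        moreover have "(translate ^^ n) \<in> ?U \<rightarrow>\<^sub>M ?U"
          by (induction n) (auto intro: measurable_comp measurable_translate_seeds)
        ultimately have "p D \<omega> = measure (distr ?U ?U (translate ^^ n)) (Pair ((S ^^ n) \<omega>) -` B)"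
          unfolding p_def by (subst measure_distr) (auto simp: sect[OF B])
        then show ?thesis by (simp add: distr_translate_iter_seeds p_def)
      qed
      have indep: "p (B \<inter> D) \<omega> = p B \<omega> * p D \<omega>" if w: "\<omega> \<in> space P" for \<omega>
      proof -
        let ?I = "{z :: int \<times> 'e. \<bar>fst z\<bar> \<le> m}"
        have "measure ?U (Pair \<omega> -` B \<inter> Pair \<omega> -` D) = measure ?U (Pair \<omega> -` B) * measure ?U (Pair \<omega> -` D)"
        proof (rule seeds_independent[where I="?I"])
          fix u u' :: "int \<times> 'e \<Rightarrow> 'b"
          assume eq: "\<And>z. z \<in> ?I \<Longrightarrow> u z = u' z"
          then have "\<forall>x e. \<bar>x\<bar> \<le> m \<longrightarrow> u (x, e) = u' (x, e)" by auto
          then have "(\<omega>, u) \<in> B \<longleftrightarrow> (\<omega>, u') \<in> B" by (rule local_setD[OF loc])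
          then show "u \<in> Pair \<omega> -` B \<longleftrightarrow> u' \<in> Pair \<omega> -` B" by simp
        next
          fix u u' :: "int \<times> 'e \<Rightarrow> 'b"
          assume eq: "\<And>z. z \<notin> ?I \<Longrightarrow> u z = u' z"
          have "\<forall>x e. \<bar>x\<bar> \<le> m \<longrightarrow> (translate ^^ n) u (x, e) = (translate ^^ n) u' (x, e)"
            using n unfolding translate_iter by (auto intro!: eq)
          then have "((S ^^ n) \<omega>, (translate ^^ n) u) \<in> B \<longleftrightarrow> ((S ^^ n) \<omega>, (translate ^^ n) u') \<in> B"
            by (rule local_setD[OF loc])
          then show "u \<in> Pair \<omega> -` D \<longleftrightarrow> u' \<in> Pair \<omega> -` D"
            using w by (simp add: D_def skew_iter space_pair_measure)
        qed (auto simp: sect)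
        then show ?thesis by (simp add: p_def vimage_Int)
      qed
      have dist_B: "(\<integral>\<omega>. \<bar>p B \<omega> - c\<bar> \<partial>P) \<le> \<epsilon>"
      proof -
        have "(\<integral>\<omega>. \<bar>p B \<omega> - c\<bar> \<partial>P) = (\<integral>\<omega>. \<bar>p B \<omega> - p A \<omega>\<bar> \<partial>P)"
          using p_c by (intro integral_cong_AE) auto
        also have "\<dots> \<le> (\<integral>\<omega>. p (sym_diff A B) \<omega> \<partial>P)"
        proof (rule integral_mono)
          show "integrable P (\<lambda>\<omega>. \<bar>p B \<omega> - p A \<omega>\<bar>)" using p_int[OF A] p_int[OF B] by auto
          show "integrable P (p (sym_diff A B))" by (rule p_int) auto
          fix \<omega>
          have "sym_diff (Pair \<omega> -` A) (Pair \<omega> -` B) = Pair \<omega> -` sym_diff A B" by auto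
          then show "\<bar>p B \<omega> - p A \<omega>\<bar> \<le> p (sym_diff A B) \<omega>"
            using U.measure_diff_le_sym_diff[OF sect[OF A, of \<omega>] sect[OF B, of \<omega>]] unfolding p_def
            by (simp add: abs_minus_commute)
        qed
        also have "\<dots> = measure ?Q (sym_diff A B)" by (rule Q_eq[symmetric]) auto
        finally show ?thesis using BA by simp
      qed
      have dist_B': "(\<integral>\<omega>. \<bar>p B ((S ^^ n) \<omega>) - c\<bar> \<partial>P) \<le> \<epsilon>"
      proof -
        have "(\<integral>\<omega>. \<bar>p B ((S ^^ n) \<omega>) - c\<bar> \<partial>P) = (\<integral>\<omega>. \<bar>p B \<omega> - c\<bar> \<partial>(distr P P (S ^^ n)))"
          by (subst integral_distr) auto
        then show ?thesis using dist_B by (simp add: P.distr_T_iter)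
      qed
      have int': "integrable P (\<lambda>\<omega>. p B ((S ^^ n) \<omega>))"
        using p01 by (intro P.integrable_const_bound[of _ 1]) auto
      have "measure ?Q (B \<inter> D) - c * c = (\<integral>\<omega>. p B \<omega> * p B ((S ^^ n) \<omega>) - c * c \<partial>P)"
      proof -
        have "measure ?Q (B \<inter> D) = (\<integral>\<omega>. p (B \<inter> D) \<omega> \<partial>P)" by (rule Q_eq) auto
        also have "\<dots> = (\<integral>\<omega>. p B \<omega> * p B ((S ^^ n) \<omega>) \<partial>P)"
          by (rule Bochner_Integration.integral_cong) (auto simp: indep pD)
        finally have eq: "measure ?Q (B \<inter> D) = (\<integral>\<omega>. p B \<omega> * p B ((S ^^ n) \<omega>) \<partial>P)" .
        have "integrable P (\<lambda>\<omega>. p B \<omega> * p B ((S ^^ n) \<omega>))"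
          using p01 by (intro P.integrable_const_bound[of _ 1]) (auto simp: abs_mult mult_le_one)
        then show ?thesis unfolding eq by (simp add: P.prob_space)
      qed
      then have "\<bar>measure ?Q (B \<inter> D) - c * c\<bar> \<le> (\<integral>\<omega>. \<bar>p B \<omega> * p B ((S ^^ n) \<omega>) - c * c\<bar> \<partial>P)"
        by simp
      also have "\<dots> \<le> (\<integral>\<omega>. \<bar>p B \<omega> - c\<bar> + \<bar>p B ((S ^^ n) \<omega>) - c\<bar> \<partial>P)"
      proof (rule integral_mono)
        have "integrable P (\<lambda>\<omega>. p B \<omega> * p B ((S ^^ n) \<omega>))"
          using p01 by (intro P.integrable_const_bound[of _ 1]) (auto simp: abs_mult mult_le_one)
        then show "integrable P (\<lambda>\<omega>. \<bar>p B \<omega> * p B ((S ^^ n) \<omega>) - c * c\<bar>)" by auto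
        show "integrable P (\<lambda>\<omega>. \<bar>p B \<omega> - c\<bar> + \<bar>p B ((S ^^ n) \<omega>) - c\<bar>)" using p_int[OF B] int' by auto
        fix \<omega>
        let ?x = "p B \<omega>" and ?y = "p B ((S ^^ n) \<omega>)"
        have c01: "0 \<le> c" "c \<le> 1" unfolding c_def by auto
        have "?x * ?y - c * c = ?x * (?y - c) + c * (?x - c)" by (simp add: algebra_simps)
        also have "\<bar>\<dots>\<bar> \<le> \<bar>?x\<bar> * \<bar>?y - c\<bar> + \<bar>c\<bar> * \<bar>?x - c\<bar>"
          by (rule order_trans[OF abs_triangle_ineq]) (simp add: abs_mult)
        also have "\<dots> \<le> 1 * \<bar>?y - c\<bar> + 1 * \<bar>?x - c\<bar>"
          using p01[of B \<omega>] c01 by (intro add_mono mult_right_mono) auto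
        finally show "\<bar>?x * ?y - c * c\<bar> \<le> \<bar>?x - c\<bar> + \<bar>?y - c\<bar>" by simp
      qed
      also have "\<dots> \<le> 2 * \<epsilon>"
        using dist_B dist_B' p_int[OF B] int' by (subst Bochner_Integration.integral_add) auto
      finally show ?thesis using 1 by linarith
    qed
    have "c = c * c"
    proof (rule ccontr)
      assume "c \<noteq> c * c"
      then have "0 < \<bar>c - c * c\<bar>" by simp
      then show False using bound[of "\<bar>c - c * c\<bar> / 8"] by simp
    qed
    then show "measure ?Q A = 0 \<or> measure ?Q A = 1" unfolding c_def by auto
  qed
qed

end

section \<open>The law of the walks is determined\<close>

definition path_space :: "(nat \<times> nat \<Rightarrow> int) measure" where
  "path_space = Pi\<^sub>M UNIV (\<lambda>_. count_space UNIV)"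

abbreviation record_space :: "(cookie_env \<times> (nat \<times> nat \<Rightarrow> int)) measure" where
  "record_space \<equiv> cookie_space \<Otimes>\<^sub>M path_space"

lemma space_path_space [simp]: "space path_space = UNIV"
  by (simp add: path_space_def space_PiM)

lemma measurable_path [measurable]: "(\<lambda>q. q p) \<in> path_space \<rightarrow>\<^sub>M count_space UNIV"
  unfolding path_space_def by (rule measurable_component_singleton) simp

lemma measurable_into_path_space:
  assumes "\<And>p. (\<lambda>x. f x p) \<in> M \<rightarrow>\<^sub>M count_space UNIV"
  shows "f \<in> M \<rightarrow>\<^sub>M path_space"
  unfolding path_space_def by (rule measurable_PiM_single') (use assms in auto)

lemma measurable_cookie [measurable]: "(\<lambda>\<omega>. \<omega> (x, v)) \<in> borel_measurable cookie_space"
proof (cases "v = 0")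
  case True
  then have "(\<lambda>\<omega>. \<omega> (x, v)) \<in> borel_measurable cookie_space \<longleftrightarrow>
      (\<lambda>\<omega>. undefined :: real) \<in> borel_measurable cookie_space"
    by (intro measurable_cong) (auto simp: cookie_space_def space_PiM PiE_def extensional_def)
  then show ?thesis by simp
next
  case False
  then have "(\<lambda>\<omega>. \<omega> (x, v)) \<in> cookie_space \<rightarrow>\<^sub>M restrict_space borel {0..1}"
    unfolding cookie_space_def by (intro measurable_component_singleton) auto
  then show ?thesis by (rule measurable_restrict_space2_iff[THEN iffD1, THEN conjunct1])
qed

lemma cookie_in_unit:
  assumes "\<omega> \<in> space cookie_space" "v \<ge> 1"
  shows "0 \<le> \<omega> (x, v)" "\<omega> (x, v) \<le> 1"
proof -
  have "\<omega> (x, v) \<in> space (restrict_space borel {0..1})"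
    using assms unfolding cookie_space_def space_PiM by (intro PiE_mem[of \<omega> "UNIV \<times> {1..}"]) auto
  then show "0 \<le> \<omega> (x, v)" "\<omega> (x, v) \<le> 1" by (auto simp: space_restrict_space)
qed

text \<open>The probability of a step to the right prescribed for walker \<open>j\<close> at time \<open>n\<close>, as a function of the
  complete record; it depends on the entries in \<open>seen j n\<close> only.\<close>

definition step_prob :: "nat \<Rightarrow> nat \<Rightarrow> cookie_env \<times> (nat \<times> nat \<Rightarrow> int) \<Rightarrow> real" where
  "step_prob j n z = leftover_env (fst z) (\<lambda>i m. snd z (i, m)) (j - 1)
     (snd z (j, n), visits (\<lambda>m. snd z (j, m)) n (snd z (j, n)))"

lemma transient_path_iff: "transient_path s \<longleftrightarrow> (\<forall>y. \<exists>N. \<forall>m. s m = y \<longrightarrow> m < N)"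
  by (simp add: transient_path_def finite_nat_set_iff_bounded)

lemma measurable_leftover_env [measurable]:
  "(\<lambda>z. leftover_env (fst z) (\<lambda>i m. snd z (i, m)) k (x, v)) \<in> borel_measurable record_space"
proof (induction k arbitrary: v)
  case (Suc k)
  note [measurable] = Suc
  have [measurable]: "Measurable.pred record_space (\<lambda>z. transient_path (\<lambda>m. snd z (Suc k, m)))"
    unfolding transient_path_iff by measurable
  have [measurable]: "(\<lambda>z. leftover_env (fst z) (\<lambda>i m. snd z (i, m)) k
      (x, v + card {m. snd z (Suc k, m) = x})) \<in> borel_measurable record_space"
    by (rule measurable_compose_countable[where g="\<lambda>z. card {m. snd z (Suc k, m) = x}"
          and f="\<lambda>c z. leftover_env (fst z) (\<lambda>i m. snd z (i, m)) k (x, v + c)"]) measurable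
  have eq: "leftover_env (fst z) (\<lambda>i m. snd z (i, m)) (Suc k) (x, v) =
      (if transient_path (\<lambda>m. snd z (Suc k, m))
       then leftover_env (fst z) (\<lambda>i m. snd z (i, m)) k (x, v + card {m. snd z (Suc k, m) = x}) else 1 / 2)" for z
    by (simp add: leftover_def)
  show ?case unfolding eq by measurable
qed simp

lemma measurable_step_prob [measurable]: "step_prob j n \<in> borel_measurable record_space"
proof -
  have 1: "(\<lambda>z. leftover_env (fst z) (\<lambda>i m. snd z (i, m)) (j - 1)
      (x, visits (\<lambda>m. snd z (j, m)) n x)) \<in> borel_measurable record_space" for x
    unfolding visits_def
    by (rule measurable_compose_countable[where g="\<lambda>z. card {m. m \<le> n \<and> snd z (j, m) = x}"
          and f="\<lambda>c z. leftover_env (fst z) (\<lambda>i m. snd z (i, m)) (j - 1) (x, c)"]) measurable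
  show ?thesis unfolding step_prob_def
    by (rule measurable_compose_countable[where g="\<lambda>z. snd z (j, n)"
          and f="\<lambda>x z. leftover_env (fst z) (\<lambda>i m. snd z (i, m)) (j - 1)
            (x, visits (\<lambda>m. snd z (j, m)) n x)", OF 1]) measurable
qed

lemma leftover_env_cong:
  "(\<And>i m. 1 \<le> i \<Longrightarrow> i \<le> k \<Longrightarrow> X i m = X' i m) \<Longrightarrow> leftover_env \<omega> X k = leftover_env \<omega> X' k"
proof (induction k)
  case (Suc k)
  then have "leftover_env \<omega> X k = leftover_env \<omega> X' k" "X (Suc k) = X' (Suc k)" by (auto simp: fun_eq_iff)
  then show ?case by simp
qed simp

text \<open>The entries \<open>(walker, time)\<close> that are known when walker \<open>j\<close> has made \<open>n\<close> steps.\<close>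

definition seen :: "nat \<Rightarrow> nat \<Rightarrow> (nat \<times> nat) set" where
  "seen j n = {(i, m). 1 \<le> i \<and> (i < j \<or> i = j \<and> m \<le> n)}"

text \<open>Entries outside \<open>I\<close> are set to 0, so that partial and complete records live in the same space.\<close>

definition transcript :: "('a \<Rightarrow> cookie_env) \<Rightarrow> (nat \<Rightarrow> nat \<Rightarrow> 'a \<Rightarrow> int) \<Rightarrow> (nat \<times> nat) set \<Rightarrow> 'a
    \<Rightarrow> cookie_env \<times> (nat \<times> nat \<Rightarrow> int)" where
  "transcript \<eta> X I w = (\<eta> w, \<lambda>p. if p \<in> I then X (fst p) (snd p) w else 0)"

lemma step_prob_transcript:
  assumes "j \<ge> 1"
  shows "step_prob j n (transcript \<eta> X (seen j n) w) =
    leftover_env (\<eta> w) (\<lambda>i m. X i m w) (j - 1) (X j n w, visits (\<lambda>m. X j m w) n (X j n w))"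
proof -
  have v: "visits (\<lambda>m. snd (transcript \<eta> X (seen j n) w) (j, m)) n y = visits (\<lambda>m. X j m w) n y" for y
    using assms unfolding visits_def by (intro arg_cong[where f=card]) (auto simp: transcript_def seen_def)
  have l: "leftover_env (\<eta> w) (\<lambda>i m. snd (transcript \<eta> X (seen j n) w) (i, m)) (j - 1) =
      leftover_env (\<eta> w) (\<lambda>i m. X i m w) (j - 1)"
    using assms by (intro leftover_env_cong) (auto simp: transcript_def seen_def)
  have "snd (transcript \<eta> X (seen j n) w) (j, n) = X j n w" "fst (transcript \<eta> X (seen j n) w) = \<eta> w"
    using assms by (auto simp: transcript_def seen_def)
  then show ?thesis unfolding step_prob_def using v l by simp
qed

lemma space_history [simp]: "space (history M \<eta> X j n) = space M"
  by (auto simp: history_def space_measure_of_conv)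

lemma sets_history: "sets (history M \<eta> X j n) = sigma_sets (space M)
     ({\<eta> -` A \<inter> space M | A. A \<in> sets cookie_space} \<union>
      {X i m -` B \<inter> space M | i m B. 1 \<le> i \<and> (i < j \<or> i = j \<and> m \<le> n)})"
  unfolding history_def by (rule sets_measure_of) auto

lemma subalgebra_history:
  assumes \<eta>: "\<eta> \<in> M \<rightarrow>\<^sub>M cookie_space" and X: "\<And>j n. j \<ge> 1 \<Longrightarrow> X j n \<in> M \<rightarrow>\<^sub>M count_space UNIV"
  shows "subalgebra M (history M \<eta> X j n)"
  unfolding subalgebra_def sets_history
proof
  show "sigma_sets (space M)
     ({\<eta> -` A \<inter> space M | A. A \<in> sets cookie_space} \<union>
      {X i m -` B \<inter> space M | i m B. 1 \<le> i \<and> (i < j \<or> i = j \<and> m \<le> n)}) \<subseteq> sets M"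
    using \<eta> X by (intro sets.sigma_sets_subset) (auto intro!: measurable_sets[of _ M])
qed simp

lemma measurable_transcript:
  assumes \<eta>: "\<eta> \<in> M \<rightarrow>\<^sub>M cookie_space" and X: "\<And>p. p \<in> I \<Longrightarrow> X (fst p) (snd p) \<in> M \<rightarrow>\<^sub>M count_space UNIV"
  shows "transcript \<eta> X I \<in> M \<rightarrow>\<^sub>M record_space"
  unfolding transcript_def
proof (intro measurable_Pair \<eta> measurable_into_path_space)
  fix p show "(\<lambda>w. if p \<in> I then X (fst p) (snd p) w else 0) \<in> M \<rightarrow>\<^sub>M count_space UNIV"
    using X[of p] by (cases "p \<in> I") auto
qed

lemma measurable_transcript_history:
  assumes \<eta>: "\<eta> \<in> M \<rightarrow>\<^sub>M cookie_space"
  shows "transcript \<eta> X (seen j n) \<in> history M \<eta> X j n \<rightarrow>\<^sub>M record_space"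
proof (rule measurable_transcript)
  show "\<eta> \<in> history M \<eta> X j n \<rightarrow>\<^sub>M cookie_space"
  proof (rule measurableI)
    fix A assume "A \<in> sets cookie_space"
    then show "\<eta> -` A \<inter> space (history M \<eta> X j n) \<in> sets (history M \<eta> X j n)"
      unfolding space_history sets_history by (intro sigma_sets.Basic) auto
  qed (use measurable_space[OF \<eta>] in simp)
  fix p assume p: "p \<in> seen j n"
  show "X (fst p) (snd p) \<in> history M \<eta> X j n \<rightarrow>\<^sub>M count_space UNIV"
  proof (rule measurableI)
    fix B :: "int set"
    obtain i m where im: "p = (i, m)" "1 \<le> i \<and> (i < j \<or> i = j \<and> m \<le> n)" using p by (auto simp: seen_def)
    then have "X (fst p) (snd p) -` B \<inter> space M \<in>
        {X i m -` B \<inter> space M | i m B. 1 \<le> i \<and> (i < j \<or> i = j \<and> m \<le> n)}"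
      unfolding im fst_conv snd_conv by blast
    then show "X (fst p) (snd p) -` B \<inter> space (history M \<eta> X j n) \<in> sets (history M \<eta> X j n)"
      unfolding space_history sets_history by (intro sigma_sets.Basic UnI2)
  qed simp
qed

text \<open>Products with events that depend on finitely many entries form an intersection-stable generator.\<close>

lemma record_measure_eqI:
  assumes sets: "sets K = sets record_space" "sets L = sets record_space"
    and fin: "finite_measure K"
    and eq: "\<And>A B J. A \<in> sets cookie_space \<Longrightarrow> B \<in> sets path_space \<Longrightarrow> finite J \<Longrightarrow>
      (\<And>q q'. (\<And>p. p \<in> J \<Longrightarrow> q p = q' p) \<Longrightarrow> q \<in> B \<longleftrightarrow> q' \<in> B) \<Longrightarrow> emeasure K (A \<times> B) = emeasure L (A \<times> B)"
  shows "K = L"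
proof -
  define dep where "dep J B \<longleftrightarrow> (\<forall>q q'. (\<forall>p\<in>J. q p = q' p) \<longrightarrow> (q \<in> B \<longleftrightarrow> q' \<in> B))"
    for J and B :: "(nat \<times> nat \<Rightarrow> int) set"
  define E where "E = {A \<times> B | A B. A \<in> sets cookie_space \<and> B \<in> sets path_space \<and> (\<exists>J. finite J \<and> dep J B)}"
  let ?\<Omega> = "space record_space"
  have E_sets: "E \<subseteq> sets record_space" unfolding E_def by auto
  have E_I: "A \<in> sets cookie_space \<Longrightarrow> B \<in> sets path_space \<Longrightarrow> finite J \<Longrightarrow> dep J B \<Longrightarrow> A \<times> B \<in> E" for A B J
    unfolding E_def by blast
  have dep_UNIV: "dep {} UNIV" by (simp add: dep_def)
  have UNIV_sets: "UNIV \<in> sets path_space" using sets.top[of path_space] by simp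
  from E_sets have E_Pow: "E \<subseteq> Pow ?\<Omega>" using sets.space_closed by blast
  have top: "?\<Omega> \<in> E"
  proof -
    have "?\<Omega> = space cookie_space \<times> UNIV" by (simp add: space_pair_measure)
    then show ?thesis using E_I[OF sets.top UNIV_sets finite.emptyI dep_UNIV] by simp
  qed
  have gen: "sets record_space = sigma_sets ?\<Omega> E"
  proof (rule sets_eq_sigma_setsI[OF E_sets])
    let ?G = "sigma ?\<Omega> E"
    have G: "sets ?G = sigma_sets ?\<Omega> E" "space ?G = ?\<Omega>"
      using sets_measure_of[OF E_Pow] space_measure_of[OF E_Pow] by auto
    have "fst \<in> ?G \<rightarrow>\<^sub>M cookie_space"
    proof (rule measurableI)
      fix A assume A: "A \<in> sets cookie_space"
      have "fst -` A \<inter> ?\<Omega> = A \<times> UNIV" using sets.sets_into_space[OF A] by (auto simp: space_pair_measure)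
      then have "fst -` A \<inter> ?\<Omega> \<in> E" using E_I[OF A UNIV_sets finite.emptyI dep_UNIV] by simp
      then show "fst -` A \<inter> space ?G \<in> sets ?G" unfolding G by (rule sigma_sets.Basic)
    next
      fix z assume "z \<in> space ?G" then show "fst z \<in> space cookie_space" unfolding G(2) by (auto simp: space_pair_measure)
    qed
    moreover have "(\<lambda>z. snd z p) \<in> ?G \<rightarrow>\<^sub>M count_space UNIV" for p
    proof (rule measurableI)
      fix D :: "int set"
      have "(\<lambda>z. snd z p) -` D \<inter> ?\<Omega> = space cookie_space \<times> {q. q p \<in> D}" by (auto simp: space_pair_measure)
      moreover have "{q. q p \<in> D} \<in> sets path_space"
        using measurable_sets[OF measurable_path, of D p] by (simp add: vimage_def)
      moreover have "dep {p} {q. q p \<in> D}" by (simp add: dep_def)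
      ultimately have "(\<lambda>z. snd z p) -` D \<inter> ?\<Omega> \<in> E" using E_I[OF sets.top, of "{q. q p \<in> D}" "{p}"] by simp
      then show "(\<lambda>z. snd z p) -` D \<inter> space ?G \<in> sets ?G" unfolding G by (rule sigma_sets.Basic)
    qed simp
    then have "snd \<in> ?G \<rightarrow>\<^sub>M path_space" by (rule measurable_into_path_space)
    ultimately have "(\<lambda>z. (fst z, snd z)) \<in> ?G \<rightarrow>\<^sub>M record_space" by (rule measurable_Pair)
    then show "(\<lambda>z. z) \<in> ?G \<rightarrow>\<^sub>M record_space" by simp
  qed
  have stable: "Int_stable E"
  proof (rule Int_stableI)
    fix a b assume "a \<in> E" "b \<in> E"
    then obtain A B J A' B' J' where *: "a = A \<times> B" "b = A' \<times> B'" "A \<in> sets cookie_space" "A' \<in> sets cookie_space"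
      "B \<in> sets path_space" "B' \<in> sets path_space" "finite J" "finite J'" "dep J B" "dep J' B'"
      unfolding E_def by blast
    have "dep (J \<union> J') (B \<inter> B')" using *(9,10) unfolding dep_def by (metis IntD1 IntD2 IntI UnCI)
    then have "(A \<inter> A') \<times> (B \<inter> B') \<in> E" using * by (intro E_I) auto
    moreover have "a \<inter> b = (A \<inter> A') \<times> (B \<inter> B')" using * by auto
    ultimately show "a \<inter> b \<in> E" by simp
  qed
  interpret K: finite_measure K by fact
  show ?thesis
  proof (rule measure_eqI_generator_eq[OF stable E_Pow, where A="\<lambda>_. ?\<Omega>"])
    fix C assume "C \<in> E"
    then obtain A B J where "C = A \<times> B" "A \<in> sets cookie_space" "B \<in> sets path_space" "finite J" "dep J B"
      unfolding E_def by blast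
    then show "emeasure K C = emeasure L C" using eq[of A B J] unfolding dep_def by blast
  qed (use sets gen top in auto)
qed

abbreviation law :: "'a measure \<Rightarrow> ('a \<Rightarrow> cookie_env) \<Rightarrow> (nat \<Rightarrow> nat \<Rightarrow> 'a \<Rightarrow> int) \<Rightarrow> (nat \<times> nat) set
    \<Rightarrow> (cookie_env \<times> (nat \<times> nat \<Rightarrow> int)) measure" where
  "law M \<eta> X I \<equiv> distr M record_space (transcript \<eta> X I)"

text \<open>Records on an increasing sequence of index sets determine the record on the union, since
  an event that depends on finitely many entries sees a finite part of the union.\<close>

lemma distr_transcript_limit:
  assumes M: "prob_space M" "\<And>p. p \<in> (\<Union>n. I n) \<Longrightarrow> X (fst p) (snd p) \<in> M \<rightarrow>\<^sub>M count_space UNIV" "\<eta> \<in> M \<rightarrow>\<^sub>M cookie_space"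
    and M': "prob_space M'" "\<And>p. p \<in> (\<Union>n. I n) \<Longrightarrow> X' (fst p) (snd p) \<in> M' \<rightarrow>\<^sub>M count_space UNIV" "\<eta>' \<in> M' \<rightarrow>\<^sub>M cookie_space"
    and inc: "incseq I"
    and eq: "\<And>n. law M \<eta> X (I n) = law M' \<eta>' X' (I n)"
  shows "law M \<eta> X (\<Union>n. I n) = law M' \<eta>' X' (\<Union>n. I n)"
proof (rule record_measure_eqI)
  have r: "transcript \<eta> X (I n) \<in> M \<rightarrow>\<^sub>M record_space" "transcript \<eta>' X' (I n) \<in> M' \<rightarrow>\<^sub>M record_space" for n
    by (rule measurable_transcript[OF M(3)], rule M(2), blast) (rule measurable_transcript[OF M'(3)], rule M'(2), blast)
  have R: "transcript \<eta> X (\<Union>n. I n) \<in> M \<rightarrow>\<^sub>M record_space" "transcript \<eta>' X' (\<Union>n. I n) \<in> M' \<rightarrow>\<^sub>M record_space"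
    by (rule measurable_transcript[OF M(3)], erule M(2)) (rule measurable_transcript[OF M'(3)], erule M'(2))
  interpret M: prob_space M by fact
  interpret D: prob_space "law M \<eta> X (\<Union>n. I n)" by (rule M.prob_space_distr[OF R(1)])
  show "finite_measure (law M \<eta> X (\<Union>n. I n))" by (rule D.finite_measure_axioms)
  fix A B and J :: "(nat \<times> nat) set"
  assume A: "A \<in> sets cookie_space" and B: "B \<in> sets path_space" and J: "finite J"
    and dep: "\<And>q q'. (\<And>p. p \<in> J \<Longrightarrow> q p = q' p) \<Longrightarrow> q \<in> B \<longleftrightarrow> q' \<in> B"
  have "\<exists>n. K \<subseteq> I n" if "finite K" "K \<subseteq> (\<Union>n. I n)" for K
    using that
  proof (induction K rule: finite_induct)
    case (insert p K)
    then obtain n m where nm: "K \<subseteq> I n" "p \<in> I m" by blast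
    have "I n \<subseteq> I (max n m)" "I m \<subseteq> I (max n m)" using inc by (auto simp: incseq_def)
    then show ?case using nm by blast
  qed simp
  from this[of "J \<inter> (\<Union>n. I n)"] J have "\<exists>n. J \<inter> (\<Union>n. I n) \<subseteq> I n" by simp
  then obtain n where n: "p \<in> J \<Longrightarrow> p \<in> (\<Union>n. I n) \<longleftrightarrow> p \<in> I n" for p by blast
  have AB: "A \<times> B \<in> sets record_space" using A B by auto
  have iff: "transcript \<eta> X (\<Union>n. I n) w \<in> A \<times> B \<longleftrightarrow> transcript \<eta> X (I n) w \<in> A \<times> B" for w
    unfolding transcript_def mem_Times_iff fst_conv snd_conv
    by (intro conj_cong refl dep) (use n in auto)
  have iff': "transcript \<eta>' X' (\<Union>n. I n) w \<in> A \<times> B \<longleftrightarrow> transcript \<eta>' X' (I n) w \<in> A \<times> B" for w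
    unfolding transcript_def mem_Times_iff fst_conv snd_conv
    by (intro conj_cong refl dep) (use n in auto)
  have "emeasure (law M \<eta> X (\<Union>n. I n)) (A \<times> B) = emeasure (law M \<eta> X (I n)) (A \<times> B)"
    using iff by (simp add: emeasure_distr[OF R(1) AB] emeasure_distr[OF r(1) AB] vimage_def del: mem_Sigma_iff)
  also have "\<dots> = emeasure (law M' \<eta>' X' (I n)) (A \<times> B)" by (simp add: eq)
  also have "\<dots> = emeasure (law M' \<eta>' X' (\<Union>n. I n)) (A \<times> B)"
    using iff' by (simp add: emeasure_distr[OF R(2) AB] emeasure_distr[OF r(2) AB] vimage_def del: mem_Sigma_iff)
  finally show "emeasure (law M \<eta> X (\<Union>n. I n)) (A \<times> B) =
      emeasure (law M' \<eta>' X' (\<Union>n. I n)) (A \<times> B)" .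
qed simp_all

lemma leftover_erwD:
  assumes "leftover_erw P M \<eta> X"
  shows "prob_space M" "\<eta> \<in> M \<rightarrow>\<^sub>M cookie_space" "distr M cookie_space \<eta> = P"
    and "j \<ge> 1 \<Longrightarrow> X j n \<in> M \<rightarrow>\<^sub>M count_space UNIV"
    and "j \<ge> 1 \<Longrightarrow> AE w in M. X j 0 w = 0"
    and "j \<ge> 1 \<Longrightarrow> AE w in M. X j (Suc n) w = X j n w + 1 \<or> X j (Suc n) w = X j n w - 1"
    and "j \<ge> 1 \<Longrightarrow> AE w in M.
        real_cond_exp M (history M \<eta> X j n)
          (indicator {u \<in> space M. X j (Suc n) u = X j n u + 1}) w
        = step_prob j n (transcript \<eta> X (seen j n) w)"
  using assms unfolding leftover_erw_def by (auto simp: step_prob_transcript)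

definition extend :: "nat \<Rightarrow> nat \<Rightarrow> int \<Rightarrow> cookie_env \<times> (nat \<times> nat \<Rightarrow> int) \<Rightarrow> cookie_env \<times> (nat \<times> nat \<Rightarrow> int)" where
  "extend j n d z = (fst z, (snd z)((j, Suc n) := snd z (j, n) + d))"

lemma measurable_extend [measurable]: "extend j n d \<in> record_space \<rightarrow>\<^sub>M record_space"
  unfolding extend_def
proof (intro measurable_Pair measurable_fst measurable_into_path_space)
  fix p
  show "(\<lambda>z. ((snd z)((j, Suc n) := snd z (j, n) + d)) p) \<in> record_space \<rightarrow>\<^sub>M count_space UNIV"
    by (cases "p = (j, Suc n)") simp_all
qed

lemma transcript_Suc:
  assumes "j \<ge> 1"
  shows "transcript \<eta> X (seen j (Suc n)) w = extend j n (X j (Suc n) w - X j n w) (transcript \<eta> X (seen j n) w)"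
  using assms by (auto simp: transcript_def extend_def seen_def fun_eq_iff le_Suc_eq)

text \<open>Given the record so far, the next entry is one of two values with probabilities that are functions of
  the record; this expresses the law of the longer record through the law of the shorter one.\<close>

lemma erw_one_step:
  assumes E: "leftover_erw P M \<eta> X" and j: "j \<ge> 1" and C [measurable]: "C \<in> sets record_space"
  shows "measure (law M \<eta> X (seen j (Suc n))) C =
    (\<integral>z. indicator C (extend j n 1 z) * step_prob j n z
        + indicator C (extend j n (- 1) z) * (1 - step_prob j n z)
      \<partial>(law M \<eta> X (seen j n)))"
proof -
  note D = leftover_erwD[OF E]
  interpret M: prob_space M by (rule D(1))
  let ?F = "history M \<eta> X j n" and ?R = "transcript \<eta> X (seen j n)"
  have sub: "subalgebra M ?F" by (rule subalgebra_history[OF D(2)]) (rule D(4))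
  interpret F: finite_measure_subalgebra M ?F by unfold_locales (rule sub)
  have [measurable]: "X j n \<in> M \<rightarrow>\<^sub>M count_space UNIV" for n by (rule D(4)[OF j])
  have R [measurable]: "transcript \<eta> X (seen j n) \<in> M \<rightarrow>\<^sub>M record_space" for n
    by (rule measurable_transcript[OF D(2)], rule D(4)) (auto simp: seen_def)
  have RF [measurable]: "?R \<in> ?F \<rightarrow>\<^sub>M record_space" by (rule measurable_transcript_history[OF D(2)])
  define A where "A = {u \<in> space M. X j (Suc n) u = X j n u + 1}"
  have A [measurable]: "A \<in> sets M" unfolding A_def by measurable
  define f :: "int \<Rightarrow> 'a \<Rightarrow> real" where "f d w = indicator C (extend j n d (?R w))" for d w
  have fF [measurable]: "f d \<in> borel_measurable ?F" for d unfolding f_def by measurable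
  have fM [measurable]: "f d \<in> borel_measurable M" for d unfolding f_def by measurable
  have int_f: "integrable M (f d)" for d
    by (rule M.integrable_const_bound[of _ 1]) (auto simp: f_def indicator_def)
  have int_fA: "integrable M (\<lambda>w. f d w * indicator A w)" for d
    by (rule M.integrable_const_bound[of _ 1]) (auto simp: f_def indicator_def)
  define q where "q w = step_prob j n (?R w)" for w
  have q [measurable]: "q \<in> borel_measurable M" unfolding q_def by measurable
  have ae: "AE w in M. real_cond_exp M ?F (indicator A) w = q w"
    using D(7)[OF j, of n] unfolding A_def q_def .
  have cond: "(\<integral>w. f d w * indicator A w \<partial>M) = (\<integral>w. f d w * q w \<partial>M)" and int_fq: "integrable M (\<lambda>w. f d w * q w)" for d
  proof -
    have "(\<integral>w. f d w * real_cond_exp M ?F (indicator A) w \<partial>M) = (\<integral>w. f d w * indicator A w \<partial>M)"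
      by (rule F.real_cond_exp_intg(2)[OF int_fA]) measurable
    moreover have "(\<integral>w. f d w * real_cond_exp M ?F (indicator A) w \<partial>M) = (\<integral>w. f d w * q w \<partial>M)"
      using ae by (intro integral_cong_AE) auto
    ultimately show "(\<integral>w. f d w * indicator A w \<partial>M) = (\<integral>w. f d w * q w \<partial>M)" by simp
    have "integrable M (\<lambda>w. f d w * real_cond_exp M ?F (indicator A) w)"
      by (rule F.real_cond_exp_intg(1)[OF int_fA]) measurable
    then show "integrable M (\<lambda>w. f d w * q w)"
      by (rule integrable_cong_AE_imp) (use ae in auto)
  qed
  have "measure (law M \<eta> X (seen j (Suc n))) C =
      (\<integral>w. indicator C (transcript \<eta> X (seen j (Suc n)) w) \<partial>M)"
  proof -
    have "measure (law M \<eta> X (seen j (Suc n))) C =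
        (\<integral>z. indicator C z \<partial>(law M \<eta> X (seen j (Suc n))))"
      by simp
    also have "\<dots> = (\<integral>w. indicator C (transcript \<eta> X (seen j (Suc n)) w) \<partial>M)"
      by (rule integral_distr) auto
    finally show ?thesis .
  qed
  also have "\<dots> = (\<integral>w. f 1 w * indicator A w + (f (- 1) w - f (- 1) w * indicator A w) \<partial>M)"
  proof (rule integral_cong_AE)
    show "AE w in M. indicator C (transcript \<eta> X (seen j (Suc n)) w) = f 1 w * indicator A w + (f (- 1) w - f (- 1) w * indicator A w)"
      using D(6)[OF j, of n] AE_space
    proof eventually_elim
      case (elim w)
      then show ?case unfolding transcript_Suc[OF j] f_def A_def by (auto simp: indicator_def)
    qed
  qed measurable
  also have "\<dots> = (\<integral>w. f 1 w * indicator A w \<partial>M) + ((\<integral>w. f (- 1) w \<partial>M) - (\<integral>w. f (- 1) w * indicator A w \<partial>M))"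
    using int_f int_fA by simp
  also have "\<dots> = (\<integral>w. f 1 w * q w + (f (- 1) w - f (- 1) w * q w) \<partial>M)"
    unfolding cond using int_f int_fq by simp
  also have "\<dots> = (\<integral>w. indicator C (extend j n 1 (?R w)) * step_prob j n (?R w)
        + indicator C (extend j n (- 1) (?R w)) * (1 - step_prob j n (?R w)) \<partial>M)"
    unfolding f_def q_def by (simp add: algebra_simps)
  also have "\<dots> = (\<integral>z. indicator C (extend j n 1 z) * step_prob j n z
        + indicator C (extend j n (- 1) z) * (1 - step_prob j n z) \<partial>distr M record_space ?R)"
    by (rule integral_distr[symmetric]) auto
  finally show ?thesis .
qed

definition earlier :: "nat \<Rightarrow> (nat \<times> nat) set" where
  "earlier j = {(i, m). 1 \<le> i \<and> i < j}"

text \<open>Induction over the entries in the order in which they are revealed: walker by walker, and step by step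
  for each walker, with a passage to the limit at the end of every walk and after all walkers.\<close>

theorem erw_law_unique:
  assumes E: "leftover_erw P M \<eta> X" and E': "leftover_erw P M' \<eta>' X'"
  shows "law M \<eta> X {(i, m). 1 \<le> i} = law M' \<eta>' X' {(i, m). 1 \<le> i}"
proof -
  note D = leftover_erwD[OF E] and D' = leftover_erwD[OF E']
  interpret M: prob_space M by (rule D(1))
  interpret M': prob_space M' by (rule D'(1))
  have mX: "X (fst p) (snd p) \<in> M \<rightarrow>\<^sub>M count_space UNIV" "X' (fst p) (snd p) \<in> M' \<rightarrow>\<^sub>M count_space UNIV"
    if "1 \<le> fst p" for p using D(4)[OF that] D'(4)[OF that] by auto
  have R: "transcript \<eta> X I \<in> M \<rightarrow>\<^sub>M record_space" "transcript \<eta>' X' I \<in> M' \<rightarrow>\<^sub>M record_space"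
    if "\<And>p. p \<in> I \<Longrightarrow> 1 \<le> fst p" for I
    using that by (auto intro!: measurable_transcript D(2) D'(2) mX)
  have limit: "law M \<eta> X (\<Union>n. I n) = law M' \<eta>' X' (\<Union>n. I n)"
    if "incseq I" "\<And>n p. p \<in> I n \<Longrightarrow> 1 \<le> fst p"
      "\<And>n. law M \<eta> X (I n) = law M' \<eta>' X' (I n)" for I :: "nat \<Rightarrow> (nat \<times> nat) set"
    by (rule distr_transcript_limit[OF D(1) _ D(2) D'(1) _ D'(2) that(1,3)]) (use mX that(2) in auto)
  have base: "law M \<eta> X {} = law M' \<eta>' X' {}"
  proof -
    have m: "(\<lambda>\<omega>. (\<omega>, \<lambda>_. 0)) \<in> cookie_space \<rightarrow>\<^sub>M record_space"
      by (intro measurable_Pair measurable_ident measurable_into_path_space) auto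
    have "law M \<eta> X {} = distr (distr M cookie_space \<eta>) record_space (\<lambda>\<omega>. (\<omega>, \<lambda>_. 0))"
    proof -
      have "transcript \<eta> X {} = (\<lambda>\<omega>. (\<omega>, \<lambda>_. 0)) \<circ> \<eta>" by (simp add: transcript_def fun_eq_iff)
      then show ?thesis by (simp add: distr_distr[OF m D(2)])
    qed
    also have "\<dots> = distr (distr M' cookie_space \<eta>') record_space (\<lambda>\<omega>. (\<omega>, \<lambda>_. 0))"
      by (simp only: D(3) D'(3))
    also have "\<dots> = law M' \<eta>' X' {}"
    proof -
      have "transcript \<eta>' X' {} = (\<lambda>\<omega>. (\<omega>, \<lambda>_. 0)) \<circ> \<eta>'" by (simp add: transcript_def fun_eq_iff)
      then show ?thesis by (simp add: distr_distr[OF m D'(2)])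
    qed
    finally show ?thesis .
  qed
  have start: "law M \<eta> X (seen j 0) = law M' \<eta>' X' (seen j 0)"
    if j: "j \<ge> 1" and eq: "law M \<eta> X (earlier j) = law M' \<eta>' X' (earlier j)" for j
  proof -
    have "law M \<eta> X (seen j 0) = law M \<eta> X (earlier j)"
    proof (rule distr_cong_AE[OF refl refl])
      show "AE w in M. transcript \<eta> X (seen j 0) w = transcript \<eta> X (earlier j) w"
        using D(5)[OF j] by eventually_elim (auto simp: transcript_def seen_def earlier_def fun_eq_iff)
    qed (auto intro!: R simp: seen_def earlier_def)
    also note eq
    also have "law M' \<eta>' X' (earlier j) = law M' \<eta>' X' (seen j 0)"
    proof (rule distr_cong_AE[OF refl refl])
      show "AE w in M'. transcript \<eta>' X' (earlier j) w = transcript \<eta>' X' (seen j 0) w"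
        using D'(5)[OF j] by eventually_elim (auto simp: transcript_def seen_def earlier_def fun_eq_iff)
    qed (auto intro!: R simp: seen_def earlier_def)
    finally show ?thesis .
  qed
  have step: "law M \<eta> X (seen j (Suc n)) = law M' \<eta>' X' (seen j (Suc n))"
    if j: "j \<ge> 1" and eq: "law M \<eta> X (seen j n) = law M' \<eta>' X' (seen j n)" for j n
  proof -
    interpret L: prob_space "law M \<eta> X (seen j (Suc n))"
      by (rule M.prob_space_distr) (auto intro!: R simp: seen_def)
    interpret L': prob_space "law M' \<eta>' X' (seen j (Suc n))"
      by (rule M'.prob_space_distr) (auto intro!: R simp: seen_def)
    show ?thesis
    proof (rule measure_eqI)
      fix C assume "C \<in> sets (law M \<eta> X (seen j (Suc n)))"
      then have C: "C \<in> sets record_space" by simp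
      show "emeasure (law M \<eta> X (seen j (Suc n))) C =
          emeasure (law M' \<eta>' X' (seen j (Suc n))) C"
        unfolding L.emeasure_eq_measure L'.emeasure_eq_measure
          erw_one_step[OF E j C] erw_one_step[OF E' j C] eq ..
    qed simp
  qed
  have earlier: "law M \<eta> X (earlier (Suc j)) = law M' \<eta>' X' (earlier (Suc j))" for j
  proof (induction j)
    case 0
    have "earlier (Suc 0) = {}" by (auto simp: earlier_def)
    then show ?case using base by simp
  next
    case (Suc j)
    have "law M \<eta> X (seen (Suc j) n) = law M' \<eta>' X' (seen (Suc j) n)" for n
      by (induction n) (auto intro!: start step Suc)
    then have "law M \<eta> X (\<Union>n. seen (Suc j) n) = law M' \<eta>' X' (\<Union>n. seen (Suc j) n)"
      by (intro limit) (auto simp: seen_def incseq_def)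
    moreover have "(\<Union>n. seen (Suc j) n) = earlier (Suc (Suc j))" by (auto simp: seen_def earlier_def)
    ultimately show ?case by simp
  qed
  then have "law M \<eta> X (\<Union>j. earlier (Suc j)) = law M' \<eta>' X' (\<Union>j. earlier (Suc j))"
    by (intro limit) (auto simp: earlier_def incseq_def)
  moreover have "(\<Union>j. earlier (Suc j)) = {(i, m). 1 \<le> i}" by (auto simp: earlier_def)
  ultimately show ?thesis by simp
qed

section \<open>A realization driven by seeds\<close>

definition unif :: "real measure" where
  "unif = uniform_measure lborel {0..1}"

lemma sets_unif [measurable_cong, simp]: "sets unif = sets borel"
  by (simp add: unif_def)

interpretation unif: seed unif
proof -
  have "prob_space unif" unfolding unif_def by (rule prob_space_uniform_measure) auto
  then show "seed unif" by (simp add: seed_def seed_axioms_def unif_def)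
qed

lemma measure_unif_less: "0 \<le> t \<Longrightarrow> t \<le> 1 \<Longrightarrow> measure unif {u. u < t} = t"
proof -
  assume t: "0 \<le> t" "t \<le> 1"
  have "measure unif {u. u < t} = measure lborel ({0..1} \<inter> {u. u < t}) / measure lborel {0..1::real}"
    unfolding unif_def by (subst measure_uniform_measure) auto
  also have "{0..1} \<inter> {u. u < t} = {0..<t}" using t by auto
  finally show ?thesis using t by simp
qed

type_synonym bitmap = "int \<times> (nat + nat) \<Rightarrow> bool"

text \<open>The index \<open>(x, Inl i)\<close> stands for cookie \<open>i + 1\<close> at \<open>x\<close>. The coins used by walker \<open>j\<close> once a predecessor
  has been recurrent have the indices \<open>(n, Inr j)\<close>: the time \<open>n\<close> takes the place of a site, so that
  the shift of sites is also the shift of time for these coins.\<close>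

fun threshold :: "cookie_env \<Rightarrow> int \<times> (nat + nat) \<Rightarrow> real" where
  "threshold \<omega> (x, Inl i) = \<omega> (x, Suc i)"
| "threshold \<omega> (x, Inr j) = 1 / 2"

text \<open>A cookie of strength \<open>p\<close> sends the walker to the right if its uniform seed is less than \<open>p\<close>.\<close>

definition bits :: "cookie_env \<times> (int \<times> (nat + nat) \<Rightarrow> real) \<Rightarrow> bitmap" where
  "bits z e \<longleftrightarrow> snd z e < threshold (fst z) e"

definition arrows_of :: "bitmap \<Rightarrow> arrows" where
  "arrows_of b = (\<lambda>(x, i). b (x, Inl i))"

definition alive :: "arrows \<Rightarrow> nat \<Rightarrow> bool" where
  "alive a k \<longleftrightarrow> (\<forall>j<k. transient_path (mob a 0 j))"

definition srw :: "bitmap \<Rightarrow> nat \<Rightarrow> nat \<Rightarrow> int" where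
  "srw b j n = (\<Sum>i<n. if b (int i, Inr j) then 1 else - 1)"

definition model_walk :: "bitmap \<Rightarrow> nat \<Rightarrow> nat \<Rightarrow> int" where
  "model_walk b j n = (if alive (arrows_of b) (j - 1) then mob (arrows_of b) 0 (j - 1) n else srw b j n)"

text \<open>The index of the bit that decides the step of walker \<open>j\<close> from time \<open>n\<close> to \<open>n + 1\<close>.\<close>

definition next_index :: "bitmap \<Rightarrow> nat \<Rightarrow> nat \<Rightarrow> int \<times> (nat + nat)" where
  "next_index b j n = (if alive (arrows_of b) (j - 1)
     then (mob (arrows_of b) 0 (j - 1) n,
       Inl (cnt (arrows_of b) (odo (arrows_of b) 0 (j - 1)) 0 n (mob (arrows_of b) 0 (j - 1) n)))
     else (int n, Inr j))"

lemma model_walk_0: "model_walk b j 0 = 0"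
  by (simp add: model_walk_def mob_def srw_def)

lemma model_walk_Suc: "model_walk b j (Suc n) = model_walk b j n + (if b (next_index b j n) then 1 else - 1)"
  by (auto simp: model_walk_def next_index_def mob_def srw_def pos_Suc arrows_of_def)

lemma leftover_model_walk:
  "leftover_env \<omega> (model_walk b) k =
    (if alive (arrows_of b) k then (\<lambda>(x, n). \<omega> (x, n + odo (arrows_of b) 0 k x)) else (\<lambda>_. 1 / 2))"
proof (induction k)
  case (Suc k)
  have alive_Suc: "alive a (Suc k) \<longleftrightarrow> alive a k \<and> transient_path (mob a 0 k)" for a
    by (auto simp: alive_def less_Suc_eq)
  show ?case
  proof (cases "alive (arrows_of b) k")
    case True
    then have w: "model_walk b (Suc k) = mob (arrows_of b) 0 k" by (simp add: model_walk_def fun_eq_iff)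
    show ?thesis using True
      by (auto simp: Suc leftover_def alive_Suc w mob_def add_ac)
  next
    case False
    then show ?thesis by (auto simp: Suc leftover_def alive_Suc)
  qed
qed (auto simp: alive_def)

lemma leftover_prob:
  "leftover_env \<omega> (model_walk b) (j - 1) (model_walk b j n, visits (model_walk b j) n (model_walk b j n)) = threshold \<omega> (next_index b j n)"
proof (cases "alive (arrows_of b) (j - 1)")
  case True
  let ?a = "arrows_of b" and ?c = "odo (arrows_of b) 0 (j - 1)"
  have w: "model_walk b j = pos ?a ?c 0" using True by (simp add: model_walk_def fun_eq_iff mob_def)
  have "{m. m \<le> n \<and> pos ?a ?c 0 m = pos ?a ?c 0 n} = insert n {m. m < n \<and> pos ?a ?c 0 m = pos ?a ?c 0 n}"
    by auto
  then have "visits (model_walk b j) n (model_walk b j n) = Suc (card {m. m < n \<and> pos ?a ?c 0 m = pos ?a ?c 0 n})"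
    unfolding visits_def w by simp
  then show ?thesis using True by (simp add: leftover_model_walk w next_index_def mob_def cnt_visits add_ac)
qed (simp add: leftover_model_walk next_index_def)

lemma walk_unread:
  assumes "\<And>q. q \<noteq> p \<Longrightarrow> a' q = a q"
    and "\<And>l. l < m \<Longrightarrow> pos a c z l = fst p \<Longrightarrow> cnt a c z l (fst p) \<noteq> snd p"
  shows "pos a' c z m = pos a c z m \<and> cnt a' c z m = cnt a c z m"
  using assms(2)
proof (induction m)
  case (Suc m)
  have "pos a' c z m = pos a c z m \<and> cnt a' c z m = cnt a c z m"
    by (rule Suc.IH) (use Suc.prems in \<open>blast intro: less_SucI\<close>)
  then have eq: "pos a' c z m = pos a c z m" "cnt a' c z m = cnt a c z m" by blast+
  have "(pos a c z m, cnt a c z m (pos a c z m)) \<noteq> p" using Suc.prems[of m] by auto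
  then have "a' (pos a c z m, cnt a c z m (pos a c z m)) = a (pos a c z m, cnt a c z m (pos a c z m))"
    by (rule assms(1))
  then show ?case unfolding pos_Suc cnt_Suc eq by simp
qed simp

lemma odo_mono: "i \<le> j \<Longrightarrow> odo a z i x \<le> odo a z j x"
  by (rule lift_Suc_mono_le) auto

text \<open>A walker never takes an arrow that a predecessor has taken, and it takes its own arrows at a site in
  order; so the arrow to be taken next has had no influence so far.\<close>

lemma mob_unread:
  assumes alive: "alive a k" and p: "p = (mob a 0 k n, cnt a (odo a 0 k) 0 n (mob a 0 k n))"
    and off: "\<And>q. q \<noteq> p \<Longrightarrow> a' q = a q"
  shows "i \<le> k \<Longrightarrow> odo a' 0 i = odo a 0 i"
    and "i < k \<Longrightarrow> mob a' 0 i = mob a 0 i"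
    and "m \<le> n \<Longrightarrow> mob a' 0 k m = mob a 0 k m"
    and "cnt a' (odo a' 0 k) 0 n = cnt a (odo a 0 k) 0 n"
proof -
  have unread: "cnt a (odo a 0 i) 0 l (fst p) \<noteq> snd p"
    if "pos a (odo a 0 i) 0 l = fst p" "i < k \<or> i = k \<and> l < n" for i l
  proof -
    have "cnt a (odo a 0 i) 0 l (fst p) < cnt a (odo a 0 i) 0 (Suc l) (fst p)"
      using that(1) by (simp add: cnt_Suc)
    also have "\<dots> \<le> snd p"
    proof (cases "i < k")
      case True
      then have "transient_path (pos a (odo a 0 i) 0)" using alive by (simp add: alive_def mob_def)
      then have "cnt a (odo a 0 i) 0 (Suc l) (fst p) \<le> odo a 0 (Suc i) (fst p)"
        using transient_cnt_le by simp
      also have "\<dots> \<le> odo a 0 k (fst p)" using True by (intro odo_mono) auto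
      also have "\<dots> \<le> cnt a (odo a 0 k) 0 n (fst p)" by (rule cnt_ge)
      finally show ?thesis by (simp add: p)
    next
      case False
      then have "i = k" "Suc l \<le> n" using that(2) by auto
      then show ?thesis using cnt_mono[of "Suc l" n a "odo a 0 k" 0 "fst p"] by (simp add: p)
    qed
    finally show ?thesis by simp
  qed
  note W = walk_unread[where p=p and a=a and a'=a', OF off]
  have odo: "i \<le> k \<Longrightarrow> odo a' 0 i = odo a 0 i" for i
  proof (induction i)
    case (Suc i)
    then have IH: "odo a' 0 i = odo a 0 i" using Suc_leD by blast
    have "pos a' (odo a 0 i) 0 m = pos a (odo a 0 i) 0 m" for m
      using W[where m=m and c="odo a 0 i" and z=0] unread[of i] Suc.prems by auto
    then show ?case by (simp add: IH)
  qed simp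
  then show "i \<le> k \<Longrightarrow> odo a' 0 i = odo a 0 i" .
  show "mob a' 0 i = mob a 0 i" if "i < k"
  proof -
    have "pos a' (odo a 0 i) 0 m = pos a (odo a 0 i) 0 m" for m
      using W[where c="odo a 0 i" and z=0] unread[of i] that by auto
    then show ?thesis unfolding mob_def odo[OF less_imp_le[OF that]] by (simp add: fun_eq_iff)
  qed
  show "mob a' 0 k m = mob a 0 k m" if "m \<le> n"
    using W[where m=m and c="odo a 0 k" and z=0] unread[of k] that odo[of k]
    by (auto simp: mob_def)
  show "cnt a' (odo a' 0 k) 0 n = cnt a (odo a 0 k) 0 n"
    using W[where m=n and c="odo a 0 k" and z=0] unread[of k] odo[of k] by auto
qed

lemma model_walk_unread:
  fixes b b' :: bitmap
  assumes j: "j \<ge> 1" and off: "\<And>e. e \<noteq> next_index b j n \<Longrightarrow> b' e = b e"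
  shows "next_index b' j n = next_index b j n"
    and "1 \<le> i \<Longrightarrow> i < j \<or> i = j \<and> m \<le> n \<Longrightarrow> model_walk b' i m = model_walk b i m"
proof -
  have "next_index b' j n = next_index b j n \<and>
    (\<forall>i m. 1 \<le> i \<and> (i < j \<or> i = j \<and> m \<le> n) \<longrightarrow> model_walk b' i m = model_walk b i m)"
  proof (cases "alive (arrows_of b) (j - 1)")
    case True
    let ?a = "arrows_of b" and ?a' = "arrows_of b'" and ?k = "j - 1"
    define p where "p = (mob ?a 0 ?k n, cnt ?a (odo ?a 0 ?k) 0 n (mob ?a 0 ?k n))"
    have e: "next_index b j n = (fst p, Inl (snd p))" using True by (simp add: next_index_def p_def)
    have a': "?a' q = ?a q" if "q \<noteq> p" for q
      using off[of "(fst q, Inl (snd q))"] that by (auto simp: arrows_of_def e split_def prod_eq_iff)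
    note U = mob_unread[OF True p_def a']
    have alive: "alive ?a' i \<longleftrightarrow> alive ?a i" if "i \<le> ?k" for i
      using that U(2) by (simp add: alive_def)
    have alive_i: "alive ?a i" if "i \<le> ?k" for i using True that by (simp add: alive_def)
    have "next_index b' j n = next_index b j n"
      unfolding next_index_def using alive[of ?k] True U(3)[of n] U(4) by simp
    moreover have "model_walk b' i m = model_walk b i m" if "1 \<le> i" "i < j \<or> i = j \<and> m \<le> n" for i m
    proof -
      have "i - 1 \<le> ?k" "i - 1 < ?k \<or> i - 1 = ?k \<and> m \<le> n" using that by auto
      then show ?thesis unfolding model_walk_def using alive[of "i - 1"] alive_i[of "i - 1"] U(2)[of "i - 1"] U(3)[of m] by auto
    qed
    ultimately show ?thesis by blast
  next
    case False
    have e: "next_index b j n = (int n, Inr j)" using False by (simp add: next_index_def)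
    have a': "arrows_of b' = arrows_of b"
      using off by (auto simp: arrows_of_def e fun_eq_iff)
    have "srw b' i m = srw b i m" if "i < j \<or> i = j \<and> m \<le> n" for i m
      unfolding srw_def using that by (intro sum.cong refl if_cong off) (auto simp: e)
    then show ?thesis unfolding next_index_def model_walk_def a' using False by simp
  qed
  then show "next_index b' j n = next_index b j n"
    and "1 \<le> i \<Longrightarrow> i < j \<or> i = j \<and> m \<le> n \<Longrightarrow> model_walk b' i m = model_walk b i m" by blast+
qed

subsection \<open>The realization has the prescribed conditional probabilities\<close>

locale cookie_law = ergodic_system P site_shift for P +
  assumes sets_P [measurable_cong]: "sets P = sets cookie_space"
begin

sublocale driven: driven_seeds P site_shift unif
  by unfold_locales

abbreviation US :: "(int \<times> (nat + nat) \<Rightarrow> real) measure" where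
  "US \<equiv> seeds unif"

abbreviation Q :: "(cookie_env \<times> (int \<times> (nat + nat) \<Rightarrow> real)) measure" where
  "Q \<equiv> P \<Otimes>\<^sub>M US"

sublocale QE: ergodic_system Q driven.skew
  by (rule driven.ergodic_skew)

sublocale US: prob_space US
  by (rule unif.prob_space_seeds)

lemma space_P: "space P = space cookie_space"
  using sets_eq_imp_space_eq[OF sets_P] .

lemma space_Q: "space Q = space cookie_space \<times> UNIV"
  by (simp add: space_pair_measure space_P)

lemma threshold_unit: "\<omega> \<in> space cookie_space \<Longrightarrow> 0 \<le> threshold \<omega> e" "\<omega> \<in> space cookie_space \<Longrightarrow> threshold \<omega> e \<le> 1"
  using cookie_in_unit[of \<omega>] by (cases "(\<omega>, e)" rule: threshold.cases; simp)+

lemma measurable_threshold [measurable]: "(\<lambda>\<omega>. threshold \<omega> e) \<in> borel_measurable P"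
proof -
  have "(\<lambda>\<omega>. threshold \<omega> e) \<in> borel_measurable cookie_space"
    by (cases "(undefined :: cookie_env, e)" rule: threshold.cases) simp_all
  then show ?thesis by measurable
qed

lemma measurable_seed_borel [measurable]: "(\<lambda>u. u e) \<in> borel_measurable US"
  using unif.measurable_seed[of e] measurable_cong_sets[OF refl sets_unif] by blast

lemma measurable_bits [measurable]: "(\<lambda>z. bits z e) \<in> Q \<rightarrow>\<^sub>M count_space UNIV"
  unfolding bits_def by measurable

lemma measurable_arrows_of [measurable]: "(\<lambda>z. arrows_of (bits z)) \<in> Q \<rightarrow>\<^sub>M arrow_space"
  by (rule measurable_into_arrow_space) (simp add: arrows_of_def split_def)

lemma measurable_alive [measurable]: "Measurable.pred arrow_space (\<lambda>a. alive a k)"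
  unfolding alive_def by measurable

lemma measurable_model_walk [measurable]: "(\<lambda>z. model_walk (bits z) j n) \<in> Q \<rightarrow>\<^sub>M count_space UNIV"
proof -
  have [measurable]: "(\<lambda>z. mob (arrows_of (bits z)) 0 k n) \<in> Q \<rightarrow>\<^sub>M count_space UNIV" for k
    by (rule measurable_compose[OF measurable_arrows_of measurable_mob])
  have [measurable]: "(\<lambda>z. srw (bits z) j n) \<in> Q \<rightarrow>\<^sub>M count_space UNIV"
    unfolding srw_def by (induction n) simp_all
  show ?thesis unfolding model_walk_def by measurable
qed

lemma measurable_next_index [measurable]: "(\<lambda>z. next_index (bits z) j n) \<in> Q \<rightarrow>\<^sub>M count_space UNIV"
proof -
  have "(\<lambda>a. (mob a 0 (j - 1) n, cnt a (odo a 0 (j - 1)) 0 n (mob a 0 (j - 1) n))) \<in> arrow_space \<rightarrow>\<^sub>M count_space UNIV"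
    by (rule measurable_compose_countable[where g="\<lambda>a. mob a 0 (j - 1) n"
        and f="\<lambda>x a. (x, cnt a (odo a 0 (j - 1)) 0 n x)"]) measurable
  from measurable_compose[OF measurable_arrows_of this]
  have "(\<lambda>z. (\<lambda>(x, i). (x, Inl i :: nat + nat)) (mob (arrows_of (bits z)) 0 (j - 1) n,
      cnt (arrows_of (bits z)) (odo (arrows_of (bits z)) 0 (j - 1)) 0 n (mob (arrows_of (bits z)) 0 (j - 1) n))) \<in> Q \<rightarrow>\<^sub>M count_space UNIV"
    by (rule measurable_compose) simp
  then have [measurable]: "(\<lambda>z. (mob (arrows_of (bits z)) 0 (j - 1) n,
      Inl (cnt (arrows_of (bits z)) (odo (arrows_of (bits z)) 0 (j - 1)) 0 n (mob (arrows_of (bits z)) 0 (j - 1) n)) :: nat + nat)) \<in> Q \<rightarrow>\<^sub>M count_space UNIV"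
    by simp
  show ?thesis unfolding next_index_def by measurable
qed

text \<open>The property is inherited by complements and countable unions, so the generators of the history are
  enough.\<close>

lemma history_unread:
  assumes j: "j \<ge> 1" and H: "H \<in> sets (history Q fst (\<lambda>j n z. model_walk (bits z) j n) j n)"
    and off: "\<And>e. e \<noteq> next_index (bits (\<omega>, u)) j n \<Longrightarrow> u' e = u e"
  shows "(\<omega>, u) \<in> H \<longleftrightarrow> (\<omega>, u') \<in> H"
  using H[unfolded sets_history]
proof (induction rule: sigma_sets.induct)
  case (Basic G)
  then show ?case
  proof (elim UnE)
    assume "G \<in> {fst -` A \<inter> space Q |A. A \<in> sets cookie_space}"
    then show ?thesis by (auto simp: space_Q)
  next
    assume "G \<in> {(\<lambda>z. model_walk (bits z) i m) -` B \<inter> space Q |i m B. 1 \<le> i \<and> (i < j \<or> i = j \<and> m \<le> n)}"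
    then obtain i m B where G: "G = (\<lambda>z. model_walk (bits z) i m) -` B \<inter> space Q" "1 \<le> i" "i < j \<or> i = j \<and> m \<le> n"
      by blast
    have "model_walk (bits (\<omega>, u')) i m = model_walk (bits (\<omega>, u)) i m"
      by (rule model_walk_unread(2)[OF j _ G(2,3)]) (simp add: bits_def off)
    then show ?thesis by (auto simp: space_Q G(1))
  qed
next
  case (Compl G)
  then show ?case by (auto simp: space_Q)
next
  case (Union G)
  then show ?case by blast
qed simp

text \<open>For fixed environment, the event that the history is in \<open>H\<close> and \<open>e\<close> is the next index depends on the
  seeds other than \<open>e\<close> only, and is therefore independent of the bit at \<open>e\<close>.\<close>

lemma fresh_bit:
  assumes j: "j \<ge> 1" and H: "H \<in> sets (history Q fst (\<lambda>j n z. model_walk (bits z) j n) j n)" and HQ: "H \<in> sets Q"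
  shows "emeasure Q {z \<in> H. next_index (bits z) j n = e \<and> bits z e} =
    (\<integral>\<^sup>+z. ennreal (threshold (fst z) e) * indicator {z \<in> H. next_index (bits z) j n = e} z \<partial>Q)"
proof -
  let ?H = "{z \<in> H. next_index (bits z) j n = e}" and ?HB = "{z \<in> H. next_index (bits z) j n = e \<and> bits z e}"
  note [measurable] = HQ
  have "?H = H \<inter> {z \<in> space Q. next_index (bits z) j n = e}" "?HB = H \<inter> {z \<in> space Q. next_index (bits z) j n = e \<and> bits z e}"
    using sets.sets_into_space[OF HQ] by auto
  moreover have "{z \<in> space Q. next_index (bits z) j n = e} \<in> sets Q"
    "{z \<in> space Q. next_index (bits z) j n = e \<and> bits z e} \<in> sets Q" by measurable
  ultimately have meas [measurable]: "?H \<in> sets Q" "?HB \<in> sets Q" by auto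
  have sect: "emeasure US (Pair \<omega> -` ?HB) = ennreal (threshold \<omega> e) * emeasure US (Pair \<omega> -` ?H)"
    if w: "\<omega> \<in> space P" for \<omega>
  proof -
    let ?D = "{u. u e < threshold \<omega> e}"
    have w': "\<omega> \<in> space cookie_space" using w by (simp add: space_P)
    have D: "?D \<in> sets US"
      using measurable_sets[OF measurable_seed_borel, of "{..<threshold \<omega> e}" e] by (simp add: vimage_def lessThan_def)
    have HB: "Pair \<omega> -` ?HB = Pair \<omega> -` ?H \<inter> ?D" by (auto simp: bits_def)
    have "measure US (Pair \<omega> -` ?H \<inter> ?D) = measure US (Pair \<omega> -` ?H) * measure US ?D"
    proof (rule unif.seeds_independent[where I="- {e}"])
      fix u u' :: "int \<times> (nat + nat) \<Rightarrow> real" assume eq: "\<And>i. i \<in> - {e} \<Longrightarrow> u i = u' i"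
      have step: "(\<omega>, v') \<in> ?H" if v: "(\<omega>, v) \<in> ?H" and vv: "\<And>i. i \<noteq> e \<Longrightarrow> v' i = v i" for v v'
      proof -
        have off: "\<And>i. i \<noteq> next_index (bits (\<omega>, v)) j n \<Longrightarrow> v' i = v i" using v vv by auto
        have "(\<omega>, v') \<in> H" using v history_unread[OF j H, of \<omega> v v', OF off] by blast
        moreover have "next_index (bits (\<omega>, v')) j n = next_index (bits (\<omega>, v)) j n"
          by (rule model_walk_unread(1)[OF j]) (simp add: bits_def off)
        ultimately show ?thesis using v by simp
      qed
      show "u \<in> Pair \<omega> -` ?H \<longleftrightarrow> u' \<in> Pair \<omega> -` ?H"
      proof
        assume "u \<in> Pair \<omega> -` ?H"
        then have "(\<omega>, u) \<in> ?H" by (simp only: vimage_eq)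
        then have "(\<omega>, u') \<in> ?H" by (rule step) (use eq in simp)
        then show "u' \<in> Pair \<omega> -` ?H" by (simp only: vimage_eq)
      next
        assume "u' \<in> Pair \<omega> -` ?H"
        then have "(\<omega>, u') \<in> ?H" by (simp only: vimage_eq)
        then have "(\<omega>, u) \<in> ?H" by (rule step) (use eq in simp)
        then show "u \<in> Pair \<omega> -` ?H" by (simp only: vimage_eq)
      qed
    qed (use D sets_Pair1[OF meas(1)] in auto)
    also have "measure US ?D = threshold \<omega> e"
    proof -
      have "?D = {u. \<forall>i\<in>{e}. u i \<in> {..<threshold \<omega> e}}" by auto
      then have "emeasure US ?D = emeasure unif {..<threshold \<omega> e}"
        using unif.emeasure_seeds_cylinder[of "{e}" "\<lambda>_. {..<threshold \<omega> e}"] by simp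
      then show ?thesis using measure_unif_less[OF threshold_unit[OF w']] by (simp add: measure_def lessThan_def)
    qed
    finally show ?thesis unfolding HB US.emeasure_eq_measure
      using threshold_unit[OF w'] by (simp add: ennreal_mult' mult.commute)
  qed
  have "emeasure Q ?HB = (\<integral>\<^sup>+\<omega>. emeasure US (Pair \<omega> -` ?HB) \<partial>P)"
    by (rule US.emeasure_pair_measure_alt) measurable
  also have "\<dots> = (\<integral>\<^sup>+\<omega>. ennreal (threshold \<omega> e) * emeasure US (Pair \<omega> -` ?H) \<partial>P)"
    by (rule nn_integral_cong) (rule sect)
  also have "\<dots> = (\<integral>\<^sup>+\<omega>. \<integral>\<^sup>+u. ennreal (threshold \<omega> e) * indicator ?H (\<omega>, u) \<partial>US \<partial>P)"
  proof (rule nn_integral_cong)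
    fix \<omega> assume "\<omega> \<in> space P"
    have "(\<integral>\<^sup>+u. ennreal (threshold \<omega> e) * indicator ?H (\<omega>, u) \<partial>US) = (\<integral>\<^sup>+u. ennreal (threshold \<omega> e) * indicator (Pair \<omega> -` ?H) u \<partial>US)"
      by (intro nn_integral_cong) (auto simp: indicator_def)
    also have "\<dots> = ennreal (threshold \<omega> e) * emeasure US (Pair \<omega> -` ?H)"
      using sets_Pair1[OF meas(1)] by (rule nn_integral_cmult_indicator)
    finally show "ennreal (threshold \<omega> e) * emeasure US (Pair \<omega> -` ?H) = (\<integral>\<^sup>+u. ennreal (threshold \<omega> e) * indicator ?H (\<omega>, u) \<partial>US)" ..
  qed
  also have "\<dots> = (\<integral>\<^sup>+z. ennreal (threshold (fst z) e) * indicator ?H z \<partial>Q)"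
    by (subst US.nn_integral_fst[symmetric]) auto
  finally show ?thesis .
qed

text \<open>The event of a step to the right is split according to the next index, which has countably many
  values; on each piece the bit is fresh.\<close>

theorem model_erw: "leftover_erw P Q fst (\<lambda>j n z. model_walk (bits z) j n)"
  unfolding leftover_erw_def
proof (intro conjI allI impI)
  let ?X = "\<lambda>j n z. model_walk (bits z) j n"
  show "prob_space Q" by (rule QE.prob_space_axioms)
  show fst: "fst \<in> Q \<rightarrow>\<^sub>M cookie_space"
    using measurable_fst[of P US] measurable_cong_sets[OF refl sets_P] by blast
  have "distr Q cookie_space fst = distr Q P fst" by (rule distr_cong) (simp_all add: sets_P)
  also have "\<dots> = P" by (rule US.distr_pair_fst)
  finally show "distr Q cookie_space fst = P" .
  fix j n :: nat
  show "?X j n \<in> Q \<rightarrow>\<^sub>M count_space UNIV" by (rule measurable_model_walk)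
  show "AE z in Q. ?X j 0 z = 0" by (simp add: model_walk_0)
  show "AE z in Q. ?X j (Suc n) z = ?X j n z + 1 \<or> ?X j (Suc n) z = ?X j n z - 1" by (simp add: model_walk_Suc)
  assume j: "j \<ge> 1"
  let ?F = "history Q fst ?X j n"
  have sub: "subalgebra Q ?F" by (rule subalgebra_history[OF fst]) (rule measurable_model_walk)
  interpret F: finite_measure_subalgebra Q ?F by unfold_locales (rule sub)
  define g where "g z = threshold (fst z) (next_index (bits z) j n)" for z
  have g_eq: "leftover_env (fst z) (\<lambda>i m. ?X i m z) (j - 1) (?X j n z, visits (\<lambda>m. ?X j m z) n (?X j n z)) = g z" for z
    using leftover_prob[of "fst z" "bits z" j n] by (simp add: g_def)
  have g_rec: "g z = step_prob j n (transcript fst ?X (seen j n) z)" for z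
    using step_prob_transcript[OF j, of n fst ?X z] g_eq[of z] by simp
  have gF: "g \<in> borel_measurable ?F"
    unfolding g_rec[abs_def] by (rule measurable_compose[OF measurable_transcript_history[OF fst] measurable_step_prob])
  have gQ [measurable]: "g \<in> borel_measurable Q" by (rule measurable_from_subalg[OF sub gF])
  have g01: "0 \<le> g z" "g z \<le> 1" if "z \<in> space Q" for z
  proof -
    have "fst z \<in> space cookie_space" using that by (auto simp: space_Q)
    then show "0 \<le> g z" "g z \<le> 1" unfolding g_def by (rule threshold_unit)+
  qed
  define A where "A = {z \<in> space Q. ?X j (Suc n) z = ?X j n z + 1}"
  have A_alt: "A = {z \<in> space Q. bits z (next_index (bits z) j n)}"
    by (auto simp: A_def model_walk_Suc split: if_splits)
  have A [measurable]: "A \<in> sets Q" unfolding A_def by measurable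
  have "AE z in Q. real_cond_exp Q ?F (indicator A) z = g z"
  proof (rule F.real_cond_exp_charact)
    show "integrable Q (indicator A :: _ \<Rightarrow> real)"
      by (simp add: QE.emeasure_eq_measure)
    show "integrable Q g"
      by (rule QE.integrable_const_bound[of _ 1]) (use g01 in auto)
    show "g \<in> borel_measurable ?F" by (rule gF)
    fix H assume H: "H \<in> sets ?F"
    have HQ [measurable]: "H \<in> sets Q" using H sub by (auto simp: subalgebra_def)
    define K where "K i = {z \<in> H. to_nat (next_index (bits z) j n) = i}" for i
    have K_alt: "K i = H \<inter> {z \<in> space Q. to_nat (next_index (bits z) j n) = i}" for i
      using sets.sets_into_space[OF HQ] by (auto simp: K_def)
    have K [measurable]: "K i \<in> sets Q" for i unfolding K_alt by measurable
    have disj: "disjoint_family K" by (auto simp: disjoint_family_on_def K_def)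
    have UK: "(\<Union>i. K i) = H" by (auto simp: K_def)
    have piece: "emeasure Q (K i \<inter> A) = emeasure (density Q (\<lambda>z. ennreal (g z))) (K i)" for i
    proof (cases "\<exists>e :: int \<times> (nat + nat). to_nat e = i")
      case True
      then obtain e :: "int \<times> (nat + nat)" where e: "to_nat e = i" by blast
      have Ke: "K i = {z \<in> H. next_index (bits z) j n = e}" by (auto simp: K_def e[symmetric])
      have "K i \<inter> A = {z \<in> H. next_index (bits z) j n = e \<and> bits z e}"
        unfolding Ke A_alt using sets.sets_into_space[OF HQ] by auto
      then have "emeasure Q (K i \<inter> A) = (\<integral>\<^sup>+z. ennreal (threshold (fst z) e) * indicator (K i) z \<partial>Q)"
        using fresh_bit[OF j H HQ] by (simp add: Ke)
      also have "\<dots> = (\<integral>\<^sup>+z. ennreal (g z) * indicator (K i) z \<partial>Q)"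
        by (rule nn_integral_cong) (auto simp: Ke g_def indicator_def)
      also have "\<dots> = emeasure (density Q (\<lambda>z. ennreal (g z))) (K i)"
        by (rule emeasure_density[symmetric]) auto
      finally show ?thesis .
    next
      case False
      then have "K i = {}" unfolding K_def by blast
      then show ?thesis by simp
    qed
    have "emeasure Q (H \<inter> A) = emeasure Q (\<Union>i. K i \<inter> A)" using UK by (metis UN_extend_simps(4))
    also have "\<dots> = (\<Sum>i. emeasure Q (K i \<inter> A))"
      using disj by (intro suminf_emeasure[symmetric]) (auto simp: disjoint_family_on_def)
    also have "\<dots> = (\<Sum>i. emeasure (density Q (\<lambda>z. ennreal (g z))) (K i))" by (simp add: piece)
    also have "\<dots> = emeasure (density Q (\<lambda>z. ennreal (g z))) H"
      using disj unfolding UK[symmetric] by (intro suminf_emeasure) auto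
    also have "\<dots> = (\<integral>\<^sup>+z. ennreal (g z) * indicator H z \<partial>Q)"
      by (rule emeasure_density) auto
    also have "\<dots> = (\<integral>\<^sup>+z. ennreal (indicator H z * g z) \<partial>Q)"
      by (rule nn_integral_cong) (auto simp: indicator_def)
    also have "\<dots> = ennreal (\<integral>z. indicator H z * g z \<partial>Q)"
    proof (rule nn_integral_eq_integral)
      show "integrable Q (\<lambda>z. indicator H z * g z)"
        by (rule QE.integrable_const_bound[of _ 1]) (use g01 in \<open>auto simp: indicator_def\<close>)
    qed (use g01 in \<open>auto simp: indicator_def\<close>)
    finally have "measure Q (H \<inter> A) = (\<integral>z. indicator H z * g z \<partial>Q)"
      using g01 by (simp add: measure_def integral_nonneg_AE)
    moreover have "(\<integral>z. indicator H z * indicator A z \<partial>Q) = measure Q (H \<inter> A)"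
      by (simp add: indicator_inter_arith[symmetric])
    ultimately show "(\<integral>z\<in>H. indicator A z \<partial>Q) = (\<integral>z\<in>H. g z \<partial>Q)"
      by (simp add: set_lebesgue_integral_def)
  qed
  then show "AE z in Q. real_cond_exp Q ?F (indicator {u \<in> space Q. ?X j (Suc n) u = ?X j n u + 1}) z
      = leftover_env (fst z) (\<lambda>i m. ?X i m z) (j - 1) (?X j n z, visits (\<lambda>m. ?X j m z) n (?X j n z))"
    unfolding g_eq A_def .
qed

subsection \<open>Its walkers have a speed\<close>

abbreviation arrow_measure :: "arrows measure" where
  "arrow_measure \<equiv> distr Q arrow_space (\<lambda>z. arrows_of (bits z))"

lemma arrow_law_bits: "arrow_law arrow_measure"
proof -
  have "ergodic_system arrow_measure translate"
  proof (rule ergodic_system_factor[OF QE.ergodic_system_axioms measurable_arrows_of measurable_translate])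
    fix z :: "cookie_env \<times> (int \<times> (nat + nat) \<Rightarrow> real)"
    show "arrows_of (bits (driven.skew z)) = translate (arrows_of (bits z))"
      by (cases z) (auto simp: arrows_of_def bits_def driven.skew_def translate_def site_shift_def)
  qed
  then show ?thesis by (simp add: arrow_law_def arrow_law_axioms_def)
qed

text \<open>The steps are the values of one function along the orbit of the shift, so the ergodic theorem applies.\<close>

lemma srw_speed: "AE z in Q. srw (bits z) j has_speed 0"
proof -
  define f :: "cookie_env \<times> (int \<times> (nat + nat) \<Rightarrow> real) \<Rightarrow> real"
    where "f z = (if bits z (0, Inr j) then 1 else - 1)" for z
  have [measurable]: "f \<in> borel_measurable Q" unfolding f_def by measurable
  have int: "integrable Q f" by (rule QE.integrable_const_bound[of _ 1]) (auto simp: f_def)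
  have sum: "(\<Sum>i<n. f ((driven.skew ^^ i) z)) = real_of_int (srw (bits z) j n)" for n z
  proof -
    have "f ((driven.skew ^^ i) z) = real_of_int (if bits z (int i, Inr j) then 1 else - 1)" for i
      by (cases z) (simp add: f_def driven.skew_iter bits_def translate_iter)
    then show ?thesis by (simp add: srw_def)
  qed
  define A where "A = {z \<in> space Q. bits z (0, Inr j)}"
  have A [measurable]: "A \<in> sets Q" unfolding A_def by measurable
  have "measure Q A = 1 / 2"
  proof -
    let ?D = "{u :: int \<times> (nat + nat) \<Rightarrow> real. \<forall>i\<in>{(0, Inr j)}. u i \<in> {..<1 / 2}}"
    have "A = space P \<times> ?D" by (auto simp: A_def bits_def space_pair_measure)
    moreover have "?D \<in> sets US"
      using measurable_sets[OF measurable_seed_borel, of "{..<1 / 2}" "(0, Inr j)"] by (simp add: vimage_def)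
    ultimately have "emeasure Q A = emeasure P (space P) * emeasure US ?D"
      by (simp only: US.emeasure_pair_measure_Times[OF sets.top])
    also have "emeasure US ?D = emeasure unif {..<1 / 2}"
      using unif.emeasure_seeds_cylinder[of "{(0, Inr j)}" "\<lambda>_. {..<1 / 2}"] by simp
    finally show ?thesis
      using measure_unif_less[of "1 / 2"] by (simp add: measure_def lessThan_def emeasure_space_1)
  qed
  have "(\<integral>z. f z \<partial>Q) = (\<integral>z. 2 * indicator A z - 1 \<partial>Q)"
    by (rule Bochner_Integration.integral_cong) (auto simp: f_def A_def)
  also have "\<dots> = 0" using \<open>measure Q A = 1 / 2\<close>
    by (subst Bochner_Integration.integral_diff) (auto simp: QE.emeasure_eq_measure QE.prob_space)
  finally show ?thesis using QE.birkhoff[OF int] by (simp add: sum)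
qed

text \<open>Being preceded by transient walkers only has probability 0 or 1, so only one of the two regimes of
  \<open>model_walk\<close> matters.\<close>

theorem model_speed: "\<exists>v. AE z in Q. model_walk (bits z) j has_speed v"
proof -
  interpret A: arrow_law "arrow_measure" by (rule arrow_law_bits)
  have AE_bits: "AE z in Q. R (arrows_of (bits z))"
    if "AE a in arrow_measure. R a" for R
    by (rule AE_distrD[OF measurable_arrows_of that])
  from A.mob_speed[of "j - 1"] obtain v where
    "((AE a in arrow_measure. alive a (j - 1)) \<and>
      (AE a in arrow_measure. mob a 0 (j - 1) has_speed v)) \<or>
     (AE a in arrow_measure. \<not> alive a (j - 1))"
    unfolding alive_def by auto
  then show ?thesis
  proof (elim disjE conjE)
    assume "AE a in arrow_measure. alive a (j - 1)"
      "AE a in arrow_measure. mob a 0 (j - 1) has_speed v"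
    from this[THEN AE_bits] have "AE z in Q. model_walk (bits z) j has_speed v"
      by eventually_elim (simp add: model_walk_def)
    then show ?thesis by blast
  next
    assume "AE a in arrow_measure. \<not> alive a (j - 1)"
    from AE_bits[OF this] srw_speed[of j]
    have "AE z in Q. model_walk (bits z) j has_speed 0"
      by eventually_elim (simp add: model_walk_def)
    then show ?thesis by blast
  qed
qed

end

section \<open>The law of large numbers\<close>

lemma speed_transfer:
  assumes E: "leftover_erw P M \<eta> X" and E': "leftover_erw P M' \<eta>' X'" and k: "k \<ge> 1"
    and lim: "AE w in M'. (\<lambda>n. real_of_int (X' k n w) / real n) \<longlonglongrightarrow> v"
  shows "AE w in M. (\<lambda>n. real_of_int (X k n w) / real n) \<longlonglongrightarrow> v"
proof -
  let ?I = "{(i, m :: nat). 1 \<le> (i :: nat)}"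
  let ?R = "\<lambda>z. (\<lambda>n. real_of_int (snd z (k, n)) / real n) \<longlonglongrightarrow> v"
  have "(\<lambda>z. snd z (k, n)) \<in> record_space \<rightarrow>\<^sub>M count_space UNIV" for n
    by (rule measurable_compose[OF measurable_snd measurable_path])
  then have "(\<lambda>z. real_of_int (snd z (k, n)) / real n) \<in> borel_measurable record_space" for n
    by (rule measurable_compose) simp
  then have meas: "{z \<in> space record_space. ?R z} \<in> sets record_space"
    using measurable_limit[of "\<lambda>n z. real_of_int (snd z (k, n)) / real n" record_space v]
    by (simp add: pred_def)
  have transcript: "transcript \<eta> X ?I \<in> M \<rightarrow>\<^sub>M record_space" "transcript \<eta>' X' ?I \<in> M' \<rightarrow>\<^sub>M record_space"
    using leftover_erwD(2,4)[OF E] leftover_erwD(2,4)[OF E'] by (auto intro!: measurable_transcript)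
  have "AE z in law M' \<eta>' X' ?I. ?R z"
    unfolding AE_distr_iff[OF transcript(2) meas] using lim k by (simp add: transcript_def)
  then have "AE z in law M \<eta> X ?I. ?R z"
    by (simp only: erw_law_unique[OF E E'])
  then show ?thesis
    unfolding AE_distr_iff[OF transcript(1) meas] using k by (simp add: transcript_def)
qed

theorem theorem1p3:
  fixes P :: "cookie_env measure"
  assumes "prob_space P"
    and "sets P = sets cookie_space"
    and "stationary_ergodic P"
  shows "\<exists>v :: nat \<Rightarrow> real. \<forall>(M :: 'a measure) \<eta> X. leftover_erw P M \<eta> X \<longrightarrow>
           (\<forall>k\<ge>1. AE w in M. (\<lambda>n. real_of_int (X k n w) / real n) \<longlonglongrightarrow> v k)"
proof -
  interpret P: prob_space P by fact
  have "distr P P site_shift = distr P cookie_space site_shift"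
    by (rule distr_cong) (simp_all add: assms(2))
  then have "distr P P site_shift = P" using assms(3) by (simp add: stationary_ergodic_def)
  moreover have "site_shift \<in> P \<rightarrow>\<^sub>M P"
    using measurable_site_shift measurable_cong_sets[OF assms(2) assms(2)] by blast
  ultimately have "ergodic_system P site_shift"
    using assms(1,3) unfolding stationary_ergodic_def
    by (intro ergodic_system.intro ergodic_system_axioms.intro) blast+
  then interpret cookie_law P
    by (simp add: cookie_law_def cookie_law_axioms_def assms(2))
  obtain v where v: "\<And>k. AE z in Q. model_walk (bits z) k has_speed v k"
    using choice[of "\<lambda>k v. AE z in Q. model_walk (bits z) k has_speed v"] model_speed
    by blast
  show ?thesis
  proof (intro exI[of _ v] allI impI)
    fix M :: "'a measure" and \<eta> X and k :: nat
    assume E: "leftover_erw P M \<eta> X" and k: "1 \<le> k"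
    show "AE w in M. (\<lambda>n. real_of_int (X k n w) / real n) \<longlonglongrightarrow> v k"
      by (rule speed_transfer[OF E model_erw k v])
  qed
qed

end
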